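(* Let $t\ge 4$ be an integer with $t\equiv 0,3,4$ or $7 \pmod{12}$, and let $g(t)=\left\lceil \frac{(t-3)(t-4)}{12}\right\rceil$. Let $f:\mathbb{N}\to\mathbb{R}_{\ge 1}$ be a function for which there exists $n_0$ such that $f(n) < \frac{n}{t}-1$ for all $n\ge n_0$. Then there exist an infinite family $\mathcal{G}$ of hamiltonian triangulations of the orientable surface of genus $g(t)$ and a constant $C>0$ such that every $G\in\mathcal{G}$, with $n:=|V(G)|$, contains at most $C\, f(n)^{2t-3}$ cycles of length $k$ for every integer $k$ with $\lceil n-f(n)\rceil \le k \le n$.
   Context: A triangulation of a surface is a simple graph embedded in that closed surface such that every face is bounded by a triangle (3-cycle). A graph is hamiltonian if it has a cycle through all its vertices. The paper states the bound as "$O(f(n)^{2t-3})$ $k$-cycles". *)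

theory Defs
  imports "HOL-Analysis.Analysis"
begin

definition simple_graph :: "'a set \<Rightarrow> 'a set set \<Rightarrow> bool" where
  "simple_graph V E \<longleftrightarrow>
     finite V \<and> (\<forall>e\<in>E. \<exists>u\<in>V. \<exists>v\<in>V. u \<noteq> v \<and> e = {u, v})"

definition cycle_edges :: "'a list \<Rightarrow> 'a set set" where
  "cycle_edges p = {{p ! i, p ! (Suc i mod length p)} | i. i < length p}"

definition is_cycle :: "'a set set \<Rightarrow> 'a list \<Rightarrow> bool" where
  "is_cycle E p \<longleftrightarrow> 3 \<le> length p \<and> distinct p \<and> cycle_edges p \<subseteq> E"

text \<open>Cycles are counted as subgraphs, that is, as edge sets: neither the starting vertex
  nor the direction of traversal matters.\<close>

definition cycles_of_length :: "'a set set \<Rightarrow> nat \<Rightarrow> 'a set set set" where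
  "cycles_of_length E k = {cycle_edges p | p. is_cycle E p \<and> length p = k}"

definition hamiltonian :: "'a set \<Rightarrow> 'a set set \<Rightarrow> bool" where
  "hamiltonian V E \<longleftrightarrow> (\<exists>p. is_cycle E p \<and> set p = V)"

text \<open>The closed orientable surface of genus \<open>g\<close> (the sphere with \<open>g\<close> handles) is modelled
  as the boundary of a solid in 3-space: a box through which \<open>g\<close> disjoint parallel tunnels
  have been drilled. For \<open>g = 0\<close> this is the boundary of a box, a sphere.\<close>

definition solid_handlebody :: "nat \<Rightarrow> (real \<times> real \<times> real) set" where
  "solid_handlebody g =
     {0..2 * real g + 1} \<times> {0..3} \<times> {0..1}
     - (\<Union>i<g. {2 * real i + 1<..<2 * real i + 2} \<times> {1<..<2} \<times> UNIV)"

definition orientable_surface :: "nat \<Rightarrow> (real \<times> real \<times> real) set" where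
  "orientable_surface g = frontier (solid_handlebody g)"

text \<open>Vertices \<open>v\<close> go to points \<open>\<phi> v\<close> and edges \<open>e\<close> to arcs \<open>A e\<close> joining the images of
  their ends; arcs meet vertices and each other only in common ends.\<close>

definition graph_embedding ::
  "'a set \<Rightarrow> 'a set set \<Rightarrow> 'b::topological_space set \<Rightarrow> ('a \<Rightarrow> 'b) \<Rightarrow> ('a set \<Rightarrow> 'b set) \<Rightarrow> bool" where
  "graph_embedding V E S \<phi> A \<longleftrightarrow>
     inj_on \<phi> V \<and> \<phi> ` V \<subseteq> S \<and>
     (\<forall>u v. {u, v} \<in> E \<longrightarrow>
        (\<exists>\<gamma>. arc \<gamma> \<and> pathstart \<gamma> = \<phi> u \<and> pathfinish \<gamma> = \<phi> v \<and>
             path_image \<gamma> = A {u, v} \<and> path_image \<gamma> \<subseteq> S)) \<and>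
     (\<forall>e\<in>E. A e \<inter> \<phi> ` V = \<phi> ` e) \<and>
     (\<forall>e\<in>E. \<forall>e'\<in>E. e \<noteq> e' \<longrightarrow> A e \<inter> A e' = \<phi> ` (e \<inter> e'))"

definition faces ::
  "'a set \<Rightarrow> 'a set set \<Rightarrow> 'b::topological_space set \<Rightarrow> ('a \<Rightarrow> 'b) \<Rightarrow> ('a set \<Rightarrow> 'b set) \<Rightarrow> 'b set set" where
  "faces V E S \<phi> A = components (S - (\<phi> ` V \<union> (\<Union>e\<in>E. A e)))"

text \<open>A face bounded by a triangle is an open disc whose closure is a closed disc with the
  image of a 3-cycle as its boundary circle. Requiring only that the topological boundary of
  the face be a 3-cycle would admit faces that are not discs. The closure is taken in the
  ambient space, so the definition is meant for closed \<open>S\<close>.\<close>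

definition triangular_face :: "'a set set \<Rightarrow> ('a set \<Rightarrow> 'b::topological_space set) \<Rightarrow> 'b set \<Rightarrow> bool" where
  "triangular_face E A F \<longleftrightarrow>
     (\<exists>u v w h h'. is_cycle E [u, v, w] \<and>
        homeomorphism (cball (0::complex) 1) (closure F) h h' \<and>
        h ` ball 0 1 = F \<and>
        h ` sphere 0 1 = A {u, v} \<union> A {v, w} \<union> A {w, u})"

definition triangulation_of :: "'a set \<Rightarrow> 'a set set \<Rightarrow> 'b::topological_space set \<Rightarrow> bool" where
  "triangulation_of V E S \<longleftrightarrow>
     simple_graph V E \<and>
     (\<exists>\<phi> A. graph_embedding V E S \<phi> A \<and> (\<forall>F\<in>faces V E S \<phi> A. triangular_face E A F))"

end

theory Submission
  imports Defs
begin

text \<open>The surface is triangulated by straight triangles: the unit squares of the integer grid on the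
  drilled box, each cut along a diagonal. In a corner square \<open>a c b y\<close> with diagonal \<open>a b\<close> a vertex \<open>d\<close>
  is placed inside the triangle \<open>a b c\<close>, and the triangles \<open>a b d\<close>, \<open>c d a\<close>, \<open>c d b\<close>, \<open>a b y\<close> are
  filled with fans: long paths all of whose vertices are joined to two of the corners. Removing
  \<open>a, b, c, d\<close> leaves four pieces of \<open>m\<close> vertices each, where \<open>n = 4 m + 4\<close>. Since
  \<open>f n < n / t - 1 \<le> m\<close>, a cycle missing at most \<open>f n\<close> vertices meets all four pieces, hence spends
  the eight edge ends available at \<open>a, b, c, d\<close> on entering and leaving each piece once. So it
  traverses each fan in a single interval, and the cycle is determined, up to a bounded amount of
  information, by the eight numbers of vertices missed at the ends of the fans. Two of these
  numbers vanish and their sum is prescribed by the length, which leaves \<open>O (f n ^ 5)\<close> cycles, and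
  \<open>5 \<le> 2 t - 3\<close>. The grid has a bounded number of vertices, so the genus plays no further role; in
  particular no triangular embedding of a complete graph is needed.\<close>

subsection \<open>Flat triangulations\<close>

text \<open>For \<open>t = 4\<close> the numbers are tight: \<open>n / t - 1\<close> is exactly
  \<open>m\<close>, and \<open>2 * t - 3\<close> is 5, so three of the eight gaps must be
  eliminated. The prescribed length accounts for one. For the other two, the fans come in pairs with
  common hubs, \<open>a\<close>, \<open>b\<close> for one pair and \<open>c\<close>,
  \<open>d\<close> for the other. If a cycle visited both fans of a pair but neither of the vertices
  next to their tips, the two fans would use up all four edge ends at the hubs, and hubs and fans
  together would be cut off from the rest. Each fan is traversed in one interval because a hole in
  it would leave two parts with two exits each, while a piece has only two exits and at most one
  more edge leaves a fan inside its piece.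

  The obstacle on the topological side is that faces are components of a complement, for arbitrary
  genus and fan length. It is met by giving every vertex one coordinate function valid on all
  triangles at once. Such functions come from the Kuhn triangulation of 3-space, and they can be
  updated when a vertex is inserted, which makes the fans an induction.\<close>

lemma cycle_edges_image:
  "cycle_edges p = (\<lambda>i. {p ! i, p ! (Suc i mod length p)}) ` {..<length p}"
  unfolding cycle_edges_def by auto

text \<open>\<open>h v p\<close> is the coordinate of the point \<open>p\<close> at the vertex \<open>v\<close>. That it does not depend on the
  triangle containing \<open>p\<close> forces the triangles to meet in common faces.\<close>

definition barycentric :: "'p::real_vector set set \<Rightarrow> ('p \<Rightarrow> 'p \<Rightarrow> real) \<Rightarrow> bool" where
  "barycentric T h \<longleftrightarrow>
     (\<forall>t\<in>T. \<forall>l. (\<forall>x\<in>t. 0 \<le> l x) \<and> sum l t = 1 \<longrightarrow>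
        (\<forall>v\<in>\<Union>T. h v (\<Sum>x\<in>t. l x *\<^sub>R x) = (if v \<in> t then l v else 0)))"

definition flat_triangulation :: "'p::real_vector set set \<Rightarrow> 'p set \<Rightarrow> bool" where
  "flat_triangulation T S \<longleftrightarrow>
     finite T \<and> (\<forall>t\<in>T. card t = 3) \<and> (\<exists>h. barycentric T h) \<and> (\<Union>t\<in>T. convex hull t) = S"

definition edges_of :: "'p set set \<Rightarrow> 'p set set" where
  "edges_of T = {{u, v} | u v t. t \<in> T \<and> u \<in> t \<and> v \<in> t \<and> u \<noteq> v}"

lemma flat_triangulationD:
  assumes "flat_triangulation T S"
  shows "finite T" "\<And>t. t \<in> T \<Longrightarrow> card t = 3" "\<And>t. t \<in> T \<Longrightarrow> finite t"
    "finite (\<Union>T)" "(\<Union>t\<in>T. convex hull t) = S"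
proof -
  show "finite T" "\<And>t. t \<in> T \<Longrightarrow> card t = 3" "(\<Union>t\<in>T. convex hull t) = S"
    using assms unfolding flat_triangulation_def by auto
  then show "\<And>t. t \<in> T \<Longrightarrow> finite t" by (simp add: card_ge_0_finite)
  with \<open>finite T\<close> show "finite (\<Union>T)" by blast
qed

text \<open>Coefficients of a point over a face, padded with zeros, are coefficients over the whole
  triangle, so \<open>h\<close> reads them off. A point of both hulls gets the same values of
  \<open>h\<close> from \<open>s\<close> and from \<open>t\<close>; hence its coefficients over
  \<open>s\<close> vanish outside \<open>s' \<inter> t'\<close>.\<close>

lemma flat_hull_Int:
  fixes T :: "'p::real_vector set set"
  assumes T: "flat_triangulation T S" and "s \<in> T" "t \<in> T" "s' \<subseteq> s" "t' \<subseteq> t"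
  shows "convex hull s' \<inter> convex hull t' = convex hull (s' \<inter> t')"
proof
  show "convex hull (s' \<inter> t') \<subseteq> convex hull s' \<inter> convex hull t'"
    by (simp add: hull_mono)
next
  obtain h where h: "barycentric T h" using T unfolding flat_triangulation_def by blast
  have ext: "\<exists>l. (\<forall>x\<in>s. 0 \<le> l x) \<and> sum l s = 1 \<and> (\<Sum>x\<in>s. l x *\<^sub>R x) = p \<and> (\<forall>x. x \<notin> s' \<longrightarrow> l x = 0)"
    if s: "s \<in> T" "s' \<subseteq> s" "p \<in> convex hull s'" for s s' :: "'p set" and p
  proof -
    have fs: "finite s" using flat_triangulationD(3)[OF T s(1)] .
    have fs': "finite s'" using fs s(2) finite_subset by blast
    obtain u where u: "\<forall>x\<in>s'. 0 \<le> u x" "sum u s' = 1" "(\<Sum>x\<in>s'. u x *\<^sub>R x) = p"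
      using s(3) unfolding convex_hull_finite[OF fs'] by blast
    define l where "l x = (if x \<in> s' then u x else 0)" for x
    have "sum l s = sum l s'"
      by (rule sum.mono_neutral_right) (use fs s(2) in \<open>auto simp: l_def\<close>)
    moreover have "(\<Sum>x\<in>s. l x *\<^sub>R x) = (\<Sum>x\<in>s'. l x *\<^sub>R x)"
      by (rule sum.mono_neutral_right) (use fs s(2) in \<open>auto simp: l_def\<close>)
    ultimately show ?thesis using u by (intro exI[of _ l]) (auto simp: l_def)
  qed
  show "convex hull s' \<inter> convex hull t' \<subseteq> convex hull (s' \<inter> t')"
  proof
    fix p assume p: "p \<in> convex hull s' \<inter> convex hull t'"
    obtain l where l: "\<forall>x\<in>s. 0 \<le> l x" "sum l s = 1" "(\<Sum>x\<in>s. l x *\<^sub>R x) = p" "\<forall>x. x \<notin> s' \<longrightarrow> l x = 0"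
      using ext[of s s' p] assms p by blast
    obtain k where k: "\<forall>x\<in>t. 0 \<le> k x" "sum k t = 1" "(\<Sum>x\<in>t. k x *\<^sub>R x) = p" "\<forall>x. x \<notin> t' \<longrightarrow> k x = 0"
      using ext[of t t' p] assms p by blast
    have lh: "h v p = (if v \<in> s then l v else 0)" if "v \<in> \<Union>T" for v
      using h l \<open>s \<in> T\<close> that unfolding barycentric_def by blast
    have kh: "h v p = (if v \<in> t then k v else 0)" if "v \<in> \<Union>T" for v
      using h k \<open>t \<in> T\<close> that unfolding barycentric_def by blast
    have z: "l v = 0" if v: "v \<in> s" "v \<notin> s' \<inter> t'" for v
    proof (cases "v \<in> s'")
      case True
      then have "k v = 0" using v k(4) by blast
      moreover have "v \<in> \<Union>T" using v \<open>s \<in> T\<close> by blast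
      ultimately show ?thesis using lh[of v] kh[of v] v(1) by (simp split: if_splits)
    qed (use l(4) in blast)
    have fs: "finite s" using flat_triangulationD(3)[OF T \<open>s \<in> T\<close>] .
    have sub: "s' \<inter> t' \<subseteq> s" using assms by blast
    have fi: "finite (s' \<inter> t')" using fs sub finite_subset by blast
    have "sum l s = sum l (s' \<inter> t')"
      by (rule sum.mono_neutral_right) (use fs sub z in auto)
    moreover have "(\<Sum>x\<in>s. l x *\<^sub>R x) = (\<Sum>x\<in>s' \<inter> t'. l x *\<^sub>R x)"
      by (rule sum.mono_neutral_right) (use fs sub z in auto)
    ultimately show "p \<in> convex hull (s' \<inter> t')"
      unfolding convex_hull_finite[OF fi] using l sub by auto
  qed
qed

text \<open>A dependent triangle would have a Radon partition into disjoint parts with intersecting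
  hulls, whereas \<open>flat_hull_Int\<close> for a single triangle makes that intersection the hull
  of the empty set.\<close>

lemma flat_affine_independent:
  fixes T :: "'p::euclidean_space set set"
  assumes T: "flat_triangulation T S" and "t \<in> T"
  shows "\<not> affine_dependent t"
proof
  assume "affine_dependent t"
  then obtain M P where MP: "M \<inter> P = {}" "M \<union> P = t" "convex hull M \<inter> convex hull P \<noteq> {}"
    using Radon_partition[OF flat_triangulationD(3)[OF assms]] by meson
  then show False using flat_hull_Int[OF T \<open>t \<in> T\<close> \<open>t \<in> T\<close>, of M P] by auto
qed

lemma edges_ofE:
  assumes "e \<in> edges_of T"
  obtains u v t where "t \<in> T" "u \<in> t" "v \<in> t" "u \<noteq> v" "e = {u, v}"
  using assms unfolding edges_of_def by blast

lemma edges_ofI: "t \<in> T \<Longrightarrow> u \<in> t \<Longrightarrow> v \<in> t \<Longrightarrow> u \<noteq> v \<Longrightarrow> {u, v} \<in> edges_of T"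
  unfolding edges_of_def by blast

lemma edges_of_Int:
  assumes "e \<in> edges_of T" "e' \<in> edges_of T" "e \<noteq> e'"
  shows "e \<inter> e' = {} \<or> (\<exists>w. e \<inter> e' = {w})"
proof -
  obtain u v where "e = {u, v}" using assms(1) by (rule edges_ofE)
  moreover obtain u' v' where "e' = {u', v'}" using assms(2) by (rule edges_ofE)
  ultimately have e: "e = {u, v}" "e' = {u', v'}" by blast+
  show ?thesis using assms(3) unfolding e by (cases "u \<in> {u', v'}"; cases "v \<in> {u', v'}") auto
qed

text \<open>Any homeomorphism of the disc onto the triangle respects the boundaries, by invariance of
  domain.\<close>

lemma triangle_homeomorphism:
  fixes t :: "'p::euclidean_space set"
  assumes "\<not> affine_dependent t" "card t = 3"
  shows "\<exists>f g. homeomorphism (cball (0::complex) 1) (convex hull t) f g \<and>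
           f ` ball 0 1 = rel_interior (convex hull t) \<and>
           f ` sphere 0 1 = rel_frontier (convex hull t)"
proof -
  have dim: "aff_dim (cball (0::complex) 1) = aff_dim (convex hull t)"
    using aff_dim_affine_independent[OF assms(1)] assms(2)
    by (simp add: aff_dim_cball aff_dim_convex_hull)
  have ct: "compact (convex hull t)"
    using assms by (meson aff_independent_finite compact_convex_hull finite_imp_compact)
  have "cball (0::complex) 1 homeomorphic convex hull t"
    using homeomorphic_convex_compact_sets[OF _ _ _ ct dim] by simp
  then obtain f g where fg: "homeomorphism (cball (0::complex) 1) (convex hull t) f g"
    unfolding homeomorphic_def by blast
  have fgD: "continuous_on (cball 0 1) f" "f ` cball 0 1 = convex hull t"
    "continuous_on (convex hull t) g" "g ` (convex hull t) = cball 0 1"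
    "\<And>x. x \<in> cball 0 1 \<Longrightarrow> g (f x) = x" "\<And>y. y \<in> convex hull t \<Longrightarrow> f (g y) = y"
    using fg unfolding homeomorphism_def by auto
  have injf: "inj_on f (cball 0 1)" by (metis fgD(5) inj_onI)
  have injg: "inj_on g (convex hull t)" by (metis fgD(6) inj_onI)
  have ri: "rel_interior (cball (0::complex) 1) = ball 0 1"
    by (simp add: rel_interior_nonempty_interior)
  have "f \<in> rel_interior (cball 0 1) \<rightarrow> rel_interior (f ` cball 0 1)"
    by (rule continuous_image_subset_rel_interior[OF fgD(1) injf, of "convex hull t"])
      (use fgD(2) dim in auto)
  then have f1: "f ` ball 0 1 \<subseteq> rel_interior (convex hull t)"
    unfolding ri fgD(2) by blast
  have "g \<in> rel_interior (convex hull t) \<rightarrow> rel_interior (g ` (convex hull t))"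
    by (rule continuous_image_subset_rel_interior[OF fgD(3) injg, of "cball 0 1"])
      (use fgD(4) dim in auto)
  then have g1: "g ` rel_interior (convex hull t) \<subseteq> ball 0 1"
    unfolding ri fgD(4) by blast
  have f2: "rel_interior (convex hull t) \<subseteq> f ` ball 0 1"
  proof
    fix y assume y: "y \<in> rel_interior (convex hull t)"
    then have "f (g y) = y" using fgD(6) rel_interior_subset by blast
    moreover have "g y \<in> ball 0 1" using g1 y by blast
    ultimately show "y \<in> f ` ball 0 1" by (metis imageI)
  qed
  have f3: "f ` ball 0 1 = rel_interior (convex hull t)" using f1 f2 by blast
  have "f ` sphere 0 1 = f ` (cball 0 1 - ball 0 1)"
    by (rule arg_cong[of _ _ "\<lambda>A. f ` A"]) auto
  also have "\<dots> = f ` cball 0 1 - f ` ball 0 1"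
    by (rule inj_on_image_set_diff[OF injf]) auto
  also have "\<dots> = rel_frontier (convex hull t)"
    unfolding f3 fgD(2) rel_frontier_def using ct by (simp add: closure_closed compact_imp_closed)
  finally show ?thesis using fg f3 by blast
qed

lemma triangle_rel_frontier:
  fixes t :: "'p::euclidean_space set"
  assumes "\<not> affine_dependent t" "t = {u, v, w}" "u \<noteq> v" "u \<noteq> w" "v \<noteq> w"
  shows "rel_frontier (convex hull t) = convex hull {u, v} \<union> convex hull {v, w} \<union> convex hull {w, u}"
proof -
  have "t - {u} = {v, w}" "t - {v} = {w, u}" "t - {w} = {u, v}" using assms by auto
  moreover have "\<Union>{convex hull (t - {x}) |x. x \<in> t} =
     convex hull (t - {w}) \<union> convex hull (t - {u}) \<union> convex hull (t - {v})"
    using assms(2) by blast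
  ultimately show ?thesis using rel_frontier_convex_hull_cases[OF assms(1)] by simp
qed

text \<open>As \<open>T\<close> is finite, the union of all pieces but one is relatively closed as
  well. A component that contains \<open>R t\<close> is thus covered by two disjoint closed sets and
  cannot leave \<open>R t\<close>.\<close>

lemma components_closed_pieces:
  assumes "finite T" "\<And>t. t \<in> T \<Longrightarrow> connected (R t)" "\<And>t. t \<in> T \<Longrightarrow> R t \<noteq> {}"
    and "\<And>t. t \<in> T \<Longrightarrow> closedin (top_of_set X) (R t)"
    and "\<And>s t. s \<in> T \<Longrightarrow> t \<in> T \<Longrightarrow> s \<noteq> t \<Longrightarrow> R s \<inter> R t = {}"
    and "X = (\<Union>t\<in>T. R t)"
  shows "components X \<subseteq> R ` T"
proof
  fix F assume F: "F \<in> components X"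
  then obtain x where x: "x \<in> F" using in_components_nonempty by blast
  have FX: "F \<subseteq> X" using F in_components_subset by blast
  then obtain t where t: "t \<in> T" "x \<in> R t" using x assms(6) by blast
  have sub: "R t \<subseteq> F"
    using components_maximal[OF F assms(2)[OF t(1)]] t x assms(6) by blast
  define U where "U = (\<Union>s\<in>T - {t}. R s)"
  have "closedin (top_of_set X) U"
    unfolding U_def using assms(1,4) by (intro closedin_Union) auto
  then obtain K where K: "closed K" "U = X \<inter> K"
    by (auto simp: closedin_closed)
  obtain L where L: "closed L" "R t = X \<inter> L"
    using assms(4)[OF t(1)] by (auto simp: closedin_closed)
  have con: "connected F" using F in_components_connected by blast
  have dis: "R t \<inter> U = {}" unfolding U_def using assms(5) t(1) by blast
  have un: "X = R t \<union> U" unfolding U_def using assms(6) t(1) by blast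
  have "F \<subseteq> L \<union> K" using FX un K L by blast
  moreover have "L \<inter> K \<inter> F = {}" using FX dis K L by blast
  moreover have "L \<inter> F \<noteq> {}" using x t L by blast
  ultimately have "K \<inter> F = {}"
    using connected_closedD[OF con, of L K] K(1) L(1) by blast
  then have "F \<subseteq> R t" using FX un K by blast
  then show "F \<in> R ` T" using sub t by blast
qed

text \<open>The vertices stay where they are and the edges become segments. The faces are the
  triangle interiors: each is the trace of a compact triangle on the complement of the graph, hence
  relatively closed there, and \<open>components_closed_pieces\<close> applies.\<close>

theorem flat_triangulation_imp_triangulation:
  fixes T :: "'p::euclidean_space set set"
  assumes T: "flat_triangulation T S"
  shows "triangulation_of (\<Union>T) (edges_of T) S"
proof -
  let ?V = "\<Union>T" and ?E = "edges_of T" and ?A = "\<lambda>e::'p set. convex hull e"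
  note TD = flat_triangulationD[OF T]
  have simple: "simple_graph ?V ?E"
    unfolding simple_graph_def using TD(4) by (auto elim!: edges_ofE)
  have sing: "t \<inter> {v} = (if v \<in> t then {v} else {})" for t and v :: 'p by auto
  have emb: "graph_embedding ?V ?E S id ?A"
    unfolding graph_embedding_def
  proof (intro conjI allI ballI impI)
    show "id ` ?V \<subseteq> S" using TD(5) hull_inc by fastforce
  next
    fix u v assume "{u, v} \<in> ?E"
    then obtain t where t: "t \<in> T" "u \<in> t" "v \<in> t" "u \<noteq> v"
      by (elim edges_ofE) (auto simp: doubleton_eq_iff)
    have "convex hull {u, v} \<subseteq> convex hull t" using t by (intro hull_mono) auto
    then have "convex hull {u, v} \<subseteq> S" using TD(5) t by blast
    then show "\<exists>\<gamma>. arc \<gamma> \<and> pathstart \<gamma> = id u \<and> pathfinish \<gamma> = id v \<and>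
                 path_image \<gamma> = ?A {u, v} \<and> path_image \<gamma> \<subseteq> S"
      using t by (intro exI[of _ "linepath u v"]) (auto simp: segment_convex_hull)
  next
    fix e assume "e \<in> ?E"
    then obtain u v t where e: "t \<in> T" "u \<in> t" "v \<in> t" "u \<noteq> v" "e = {u, v}" by (elim edges_ofE)
    have "w \<in> e" if "w \<in> convex hull e" "w \<in> ?V" for w
    proof -
      obtain s where s: "s \<in> T" "w \<in> s" using \<open>w \<in> ?V\<close> by blast
      have "w \<in> convex hull {w}" by simp
      then have "w \<in> convex hull (e \<inter> {w})"
        using flat_hull_Int[OF T e(1) s(1), of e "{w}"] e s that by auto
      then show ?thesis by (auto simp: sing split: if_splits)
    qed
    moreover have "e \<subseteq> convex hull e" by (rule hull_subset)
    moreover have "e \<subseteq> ?V" using e by blast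
    ultimately show "?A e \<inter> id ` ?V = id ` e" by auto
  next
    fix e e' assume e: "e \<in> ?E" "e' \<in> ?E" "e \<noteq> e'"
    obtain t where t: "t \<in> T" "e \<subseteq> t" using e(1) by (elim edges_ofE) blast
    obtain s where s: "s \<in> T" "e' \<subseteq> s" using e(2) by (elim edges_ofE) blast
    have "?A e \<inter> ?A e' = convex hull (e \<inter> e')" by (rule flat_hull_Int[OF T t(1) s(1) t(2) s(2)])
    moreover have "convex hull (e \<inter> e') = e \<inter> e'"
      using edges_of_Int[OF e] by (elim disjE exE) simp_all
    ultimately show "?A e \<inter> ?A e' = id ` (e \<inter> e')" by simp
  qed auto
  define G where "G = id ` ?V \<union> (\<Union>e\<in>?E. ?A e)"
  let ?R = "\<lambda>t::'p set. rel_interior (convex hull t)"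
  have tri: "\<exists>u v w. t = {u, v, w} \<and> u \<noteq> v \<and> u \<noteq> w \<and> v \<noteq> w" if "t \<in> T" for t
    using TD(2)[OF that] by (auto simp: card_3_iff)
  have cl: "compact (convex hull t)" if "t \<in> T" for t
    using TD(3)[OF that] by (simp add: compact_convex_hull finite_imp_compact)
  have front: "convex hull e \<subseteq> rel_frontier (convex hull t)" if t: "t \<in> T" and e: "e \<subset> t" for t e
  proof -
    obtain x where x: "x \<in> t" "e \<subseteq> t - {x}" using e by blast
    have "convex hull e \<subseteq> convex hull (t - {x})" using x by (intro hull_mono)
    then show ?thesis
      using rel_frontier_convex_hull_cases[OF flat_affine_independent[OF T t]] x by blast
  qed
  have R_eq: "?R t = convex hull t - rel_frontier (convex hull t)" if "t \<in> T" for t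
    using rel_interior_subset[of "convex hull t"] cl[OF that]
    by (auto simp: rel_frontier_def closure_closed compact_imp_closed)
  have R_G: "?R t \<inter> G = {}" if t: "t \<in> T" for t
  proof -
    \<comment> \<open>Vertices and edges are handled together: with fewer than three points,
      \<open>e\<close> meets \<open>t\<close> in a proper subset, so the common part of the hulls
      lies in the relative boundary of the triangle.\<close>
    have "?R t \<inter> convex hull e = {}" if e: "s \<in> T" "e \<subseteq> s" "card e < 3" "finite e" for s e
    proof -
      have "?R t \<inter> convex hull e \<subseteq> convex hull t \<inter> convex hull e"
        using rel_interior_subset by blast
      also have "\<dots> = convex hull (t \<inter> e)"
        by (rule flat_hull_Int[OF T t e(1)]) (use e in auto)
      also have "\<dots> \<subseteq> rel_frontier (convex hull t)"
      proof (rule front[OF t])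
        show "t \<inter> e \<subset> t" using TD(2)[OF t] e card_mono[OF e(4), of "t \<inter> e"] by force
      qed
      finally show ?thesis using R_eq[OF t] by blast
    qed
    note A = this
    have "?R t \<inter> ?V = {}"
    proof -
      have "v \<notin> ?R t" if "v \<in> s" "s \<in> T" for v s
        using A[of s "{v}"] that by simp
      then show ?thesis by blast
    qed
    moreover have "?R t \<inter> convex hull e = {}" if "e \<in> ?E" for e
    proof -
      obtain u v s where "s \<in> T" "u \<in> s" "v \<in> s" "u \<noteq> v" "e = {u, v}"
        using \<open>e \<in> ?E\<close> by (rule edges_ofE)
      then show ?thesis using A[of s e] by simp
    qed
    ultimately show ?thesis unfolding G_def by auto
  qed
  have hull_G: "convex hull t \<subseteq> ?R t \<union> G" if t: "t \<in> T" for t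
  proof -
    obtain u v w where uvw: "t = {u, v, w}" "u \<noteq> v" "u \<noteq> w" "v \<noteq> w" using tri[OF t] by blast
    have "{u, v} \<in> ?E" "{v, w} \<in> ?E" "{w, u} \<in> ?E"
      using uvw t by (auto intro!: edges_ofI[OF t])
    then have "rel_frontier (convex hull t) \<subseteq> G"
      unfolding triangle_rel_frontier[OF flat_affine_independent[OF T t] uvw] G_def by blast
    then show ?thesis using R_eq[OF t] by blast
  qed
  have "components (S - G) \<subseteq> ?R ` T"
  proof (rule components_closed_pieces[OF TD(1)])
    show "connected (?R t)" for t :: "'p set"
      by (simp add: convex_connected convex_rel_interior)
    show "?R t \<noteq> {}" if "t \<in> T" for t
      using tri[OF that] by (auto simp: rel_interior_eq_empty)
    show un: "S - G = (\<Union>t\<in>T. ?R t)"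
    proof
      show "S - G \<subseteq> (\<Union>t\<in>T. ?R t)" 
        using hull_G unfolding TD(5)[symmetric] by blast
      show "(\<Union>t\<in>T. ?R t) \<subseteq> S - G" 
      proof
        fix p assume "p \<in> (\<Union>t\<in>T. ?R t)"
        then obtain t where t: "t \<in> T" "p \<in> ?R t" by blast
        then have "p \<in> convex hull t" using rel_interior_subset by blast
        then show "p \<in> S - G" using R_G[OF t(1)] t TD(5) by blast
      qed
    qed
    show "closedin (top_of_set (S - G)) (?R t)" if t: "t \<in> T" for t
    proof -
      have "?R t = (S - G) \<inter> convex hull t"
      proof
        show "?R t \<subseteq> (S - G) \<inter> convex hull t"
          unfolding un using rel_interior_subset t by blast
        show "(S - G) \<inter> convex hull t \<subseteq> ?R t" using hull_G[OF t] by blast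
      qed
      then show ?thesis using cl[OF t] by (metis closedin_closed_Int compact_imp_closed)
    qed
    show "?R s \<inter> ?R t = {}" if st: "s \<in> T" "t \<in> T" "s \<noteq> t" for s t
    proof -
      have "s \<inter> t \<subset> s"
        using TD(2,3) st by (metis Int_lower1 card_subset_eq inf.cobounded2 psubsetI)
      then have "convex hull (s \<inter> t) \<subseteq> rel_frontier (convex hull s)" by (rule front[OF st(1)])
      moreover have "?R s \<inter> ?R t \<subseteq> convex hull (s \<inter> t)"
        using flat_hull_Int[OF T st(1,2), of s t] rel_interior_subset by blast
      ultimately show ?thesis using R_eq[OF st(1)] by blast
    qed
  qed
  moreover have "triangular_face ?E ?A (?R t)" if t: "t \<in> T" for t
  proof -
    obtain u v w where uvw: "t = {u, v, w}" "u \<noteq> v" "u \<noteq> w" "v \<noteq> w" using tri[OF t] by blast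
    note ind = flat_affine_independent[OF T t]
    obtain f g where fg: "homeomorphism (cball (0::complex) 1) (convex hull t) f g"
      "f ` ball 0 1 = ?R t" "f ` sphere 0 1 = rel_frontier (convex hull t)"
      using triangle_homeomorphism[OF ind TD(2)[OF t]] by blast
    have "{u, v} \<in> ?E" "{v, w} \<in> ?E" "{w, u} \<in> ?E"
      using uvw t by (auto intro!: edges_ofI[OF t])
    moreover have "cycle_edges [u, v, w] = {{u, v}, {v, w}, {w, u}}"
      unfolding cycle_edges_image by (simp add: lessThan_Suc insert_commute)
    ultimately have "is_cycle ?E [u, v, w]"
      using uvw unfolding is_cycle_def by simp
    moreover have "closure (?R t) = convex hull t"
      using cl[OF t] by (simp add: convex_closure_rel_interior closure_closed compact_imp_closed)
    ultimately show ?thesis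
      unfolding triangular_face_def
      by (intro exI[of _ u] exI[of _ v] exI[of _ w] exI[of _ f] exI[of _ g])
        (simp add: fg triangle_rel_frontier[OF ind uvw])
  qed
  ultimately have "\<forall>F\<in>faces ?V ?E S id ?A. triangular_face ?E ?A F"
    unfolding faces_def G_def[symmetric] by auto
  then show ?thesis unfolding triangulation_of_def using simple emb by blast
qed

subsection \<open>Stellar subdivision and fans\<close>

text \<open>A stack of nested subdivisions: each new vertex is placed in the triangle formed by the
  hubs \<open>p\<close>, \<open>q\<close> and its predecessor, and \<open>r\<close> acts as the
  predecessor of the first.\<close>

definition fan_edges :: "'p \<Rightarrow> 'p \<Rightarrow> 'p \<Rightarrow> (nat \<Rightarrow> 'p) \<Rightarrow> nat \<Rightarrow> 'p set set" where
  "fan_edges p q r x m =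
     (\<Union>j<m. {{x j, p}, {x j, q}, {x j, if j = 0 then r else x (j - 1)}})"

text \<open>The three parts are distinguished by which of the three coefficients is least.\<close>

lemma convex_hull_stellar:
  fixes a b c :: "'p::real_vector"
  defines "x \<equiv> (1/3) *\<^sub>R a + (1/3) *\<^sub>R b + (1/3) *\<^sub>R c"
  shows "convex hull {a, b, c} =
    convex hull {a, b, x} \<union> convex hull {a, c, x} \<union> convex hull {b, c, x}"
proof
  have x: "x \<in> convex hull {a, b, c}"
    unfolding x_def convex_hull_3
    by (rule CollectI, intro exI[of _ "1/3"]) auto
  have "convex hull {u, v, x} \<subseteq> convex hull {a, b, c}" if "{u, v} \<subseteq> {a, b, c}" for u v
    by (rule hull_minimal) (use x that hull_subset[of "{a, b, c}" convex] in auto)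
  then show "convex hull {a, b, x} \<union> convex hull {a, c, x} \<union> convex hull {b, c, x}
     \<subseteq> convex hull {a, b, c}" by simp
  \<comment> \<open>The least coefficient \<open>\<gamma>\<close> is subtracted from all three; the
    total removed, \<open>3 * \<gamma>\<close>, becomes the weight of \<open>x\<close>.\<close>
  have key: "p \<in> convex hull {u, v, x}"
    if "x = (1/3) *\<^sub>R u + (1/3) *\<^sub>R v + (1/3) *\<^sub>R w" "p = \<alpha> *\<^sub>R u + \<beta> *\<^sub>R v + \<gamma> *\<^sub>R w"
      "0 \<le> \<gamma>" "\<gamma> \<le> \<alpha>" "\<gamma> \<le> \<beta>" "\<alpha> + \<beta> + \<gamma> = 1" for u v w p :: 'p and \<alpha> \<beta> \<gamma>
  proof -
    have "p = (\<alpha> - \<gamma>) *\<^sub>R u + (\<beta> - \<gamma>) *\<^sub>R v + (3 * \<gamma>) *\<^sub>R x"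
      unfolding that(1,2) by (simp add: algebra_simps)
    then show ?thesis unfolding convex_hull_3 using that by fastforce
  qed
  show "convex hull {a, b, c} \<subseteq>
    convex hull {a, b, x} \<union> convex hull {a, c, x} \<union> convex hull {b, c, x}"
  proof
    fix p assume "p \<in> convex hull {a, b, c}"
    then obtain \<alpha> \<beta> \<gamma> where p: "p = \<alpha> *\<^sub>R a + \<beta> *\<^sub>R b + \<gamma> *\<^sub>R c"
      "0 \<le> \<alpha>" "0 \<le> \<beta>" "0 \<le> \<gamma>" "\<alpha> + \<beta> + \<gamma> = 1"
      unfolding convex_hull_3 by blast
    consider "\<gamma> \<le> \<alpha>" "\<gamma> \<le> \<beta>" | "\<beta> \<le> \<alpha>" "\<beta> \<le> \<gamma>" | "\<alpha> \<le> \<beta>" "\<alpha> \<le> \<gamma>" by linarith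
    then show "p \<in> convex hull {a, b, x} \<union> convex hull {a, c, x} \<union> convex hull {b, c, x}"
    proof cases
      case 1
      then have "p \<in> convex hull {a, b, x}"
        by (intro key[of a b c p \<alpha> \<beta> \<gamma>]) (use p in \<open>auto simp: x_def\<close>)
      then show ?thesis by blast
    next
      case 2
      then have "p \<in> convex hull {a, c, x}"
        by (intro key[of a c b p \<alpha> \<gamma> \<beta>]) (use p in \<open>auto simp: x_def algebra_simps\<close>)
      then show ?thesis by blast
    next
      case 3
      then have "p \<in> convex hull {b, c, x}"
        by (intro key[of b c a p \<beta> \<gamma> \<alpha>]) (use p in \<open>auto simp: x_def algebra_simps\<close>)
      then show ?thesis by blast
    qed
  qed
qed

lemma barycentric_point:
  assumes "barycentric T h" "t \<in> T" "v \<in> \<Union>T" "\<And>x. x \<in> t \<Longrightarrow> 0 \<le> l x" "sum l t = 1"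
    and "p = (\<Sum>x\<in>t. l x *\<^sub>R x)"
  shows "h v p = (if v \<in> t then l v else 0)"
  using assms unfolding barycentric_def by blast

lemma stellar_subdivision:
  fixes T :: "'p::real_vector set set"
  assumes T: "flat_triangulation T S" and t: "{a, b, c} \<in> T"
  defines "x \<equiv> (1/3) *\<^sub>R a + (1/3) *\<^sub>R b + (1/3) *\<^sub>R c"
  shows "x \<notin> \<Union>T"
    and "flat_triangulation (T - {{a, b, c}} \<union> {{a, b, x}, {a, c, x}, {b, c, x}}) S"
proof -
  let ?t = "{a, b, c}"
  define T' where "T' = T - {?t} \<union> {{a, b, x}, {a, c, x}, {b, c, x}}"
  note TD = flat_triangulationD[OF T]
  obtain h where h: "barycentric T h" using T unfolding flat_triangulation_def by blast
  have dist: "a \<noteq> b" "a \<noteq> c" "b \<noteq> c" using TD(2)[OF t] by (auto simp: card_insert_if split: if_splits)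
  show xT: "x \<notin> \<Union>T"
  proof
    assume x: "x \<in> \<Union>T"
    then obtain s where s: "s \<in> T" "x \<in> s" by blast
    \<comment> \<open>If \<open>x\<close> were a vertex, a triangle with corner \<open>x\<close>
      would give it the coordinate 1 at itself; as the barycentre of \<open>{a, b, c}\<close> it has
      1/3 or 0 there.\<close>
    have "h x x = (if x \<in> s then if x = x then 1 else 0 else 0)"
    proof (rule barycentric_point[OF h s(1) x, where l = "\<lambda>y. if y = x then 1 else 0"])
      show "(\<Sum>y\<in>s. if y = x then 1 else 0) = (1::real)" using TD(3)[OF s(1)] s(2) by simp
      show "x = (\<Sum>y\<in>s. (if y = x then 1 else 0) *\<^sub>R y)"
        using TD(3)[OF s(1)] s(2) by (simp add: if_distrib[of "\<lambda>c. c *\<^sub>R _"] cong: if_cong)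
    qed auto
    moreover have "h x x = (if x \<in> ?t then 1/3 else 0)"
      by (rule barycentric_point[OF h t x, of "\<lambda>_. 1/3"]) (use dist in \<open>auto simp: x_def\<close>)
    ultimately show False using s by (simp split: if_splits)
  qed
  have VT': "\<Union>T' = insert x (\<Union>T)" unfolding T'_def using t by auto
  \<comment> \<open>The new vertex is the barycentre of \<open>t\<close>: its coordinate is three times the least of the old
    coordinates at \<open>t\<close>, and a third of it is taken from each of them.\<close>
  define m where "m p = Min ((\<lambda>v. h v p) ` ?t)" for p
  define h' where "h' v p = (if v = x then 3 * m p else if v \<in> ?t then h v p - m p else h v p)" for v p
  have old: "h' v p = (if v \<in> s then l v else 0)"
    if s: "s \<in> T" "s \<noteq> ?t" and v: "v \<in> \<Union>T'" and l: "\<And>x. x \<in> s \<Longrightarrow> 0 \<le> l x" "sum l s = 1"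
      and p: "p = (\<Sum>x\<in>s. l x *\<^sub>R x)" for s v p l
  proof -
    have hp: "h w p = (if w \<in> s then l w else 0)" if "w \<in> \<Union>T" for w
      by (rule barycentric_point[OF h s(1) that l p])
    \<comment> \<open>A triangle other than \<open>?t\<close> misses some corner \<open>z\<close> of
      it. The coordinate at \<open>z\<close> is 0 there, so \<open>m p = 0\<close> and nothing
      changes.\<close>
    have "\<not> ?t \<subseteq> s" using card_subset_eq[OF TD(3)[OF s(1)]] TD(2)[OF s(1)] TD(2)[OF t] s(2) by metis
    then obtain z where z: "z \<in> ?t" "z \<notin> s" by blast
    have mem: "w \<in> \<Union>T" if "w \<in> ?t" for w using t that by blast
    have "m p = 0"
      unfolding m_def
    proof (rule Min_eqI)
      show "0 \<le> y" if "y \<in> (\<lambda>v. h v p) ` ?t" for y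
      proof -
        obtain w where w: "w \<in> ?t" "y = h w p" using \<open>y \<in> _\<close> by blast
        show ?thesis using hp[OF mem[OF w(1)]] w(2) l(1) by (simp split: if_splits)
      qed
      show "0 \<in> (\<lambda>v. h v p) ` ?t" using hp[OF mem[OF z(1)]] z by (metis imageI)
    qed auto
    moreover have "x \<notin> s" using xT s(1) by blast
    ultimately show ?thesis
      using hp[of v] v unfolding h'_def VT' by (cases "v = x") simp_all
  qed
  have new: "h' v p = (if v \<in> {u, w, x} then l v else 0)"
    if uwz: "?t = {u, w, z}" "u \<noteq> w" "u \<noteq> z" "w \<noteq> z"
      "x = (1/3) *\<^sub>R u + (1/3) *\<^sub>R w + (1/3) *\<^sub>R z"
      and v: "v \<in> \<Union>T'"
      and l: "\<And>y. y \<in> {u, w, x} \<Longrightarrow> 0 \<le> l y" "sum l {u, w, x} = 1"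
      and p: "p = (\<Sum>y\<in>{u, w, x}. l y *\<^sub>R y)" for u w z v p l
  proof -
    have xn: "x \<noteq> u" "x \<noteq> w" "x \<noteq> z" using xT t uwz(1) by blast+
    \<comment> \<open>Coefficients of \<open>p\<close> over the undivided triangle: the weight of
      \<open>x\<close> is shared equally among the three corners. The corner \<open>z\<close> has
      nothing but its share, which is therefore the minimum \<open>m p\<close>.\<close>
    define k where "k y = (if y = z then l x / 3 else l y + l x / 3)" for y
    have lsum: "l u + l w + l x = 1" using l(2) xn uwz(2) by (simp add: add.assoc)
    have ps: "p = l u *\<^sub>R u + l w *\<^sub>R w + l x *\<^sub>R x" using p xn uwz(2) by (simp add: add.assoc)
    have hp: "h y p = (if y \<in> ?t then k y else 0)" if y: "y \<in> \<Union>T" for y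
    proof (rule barycentric_point[OF h t y])
      show "0 \<le> k y" if "y \<in> ?t" for y
        using that l(1) unfolding uwz(1) k_def by auto
      show "sum k ?t = 1"
        unfolding uwz(1) k_def using uwz(2,3,4) lsum by (simp add: field_simps)
      show "p = (\<Sum>x\<in>?t. k x *\<^sub>R x)"
        unfolding uwz(1) ps k_def using uwz(2,3,4)
        by (subst (2) uwz(5)) (simp add: algebra_simps)
    qed
    have mem: "u \<in> \<Union>T" "w \<in> \<Union>T" "z \<in> \<Union>T" using t uwz(1) by blast+
    have hs: "h u p = l u + l x / 3" "h w p = l w + l x / 3" "h z p = l x / 3"
      using hp[OF mem(1)] hp[OF mem(2)] hp[OF mem(3)] uwz(2,3,4) unfolding uwz(1) k_def by auto
    have mp: "m p = l x / 3"
    proof -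
      have "0 \<le> l u" "0 \<le> l w" "h z p = l x / 3" using l(1) hs by auto
      then show ?thesis unfolding m_def uwz(1) by (simp add: hs(1,2))
    qed
    show ?thesis
    proof (cases "v = x \<or> v = u \<or> v = w \<or> v = z")
      case True
      then show ?thesis using hs xn uwz(2,3,4) unfolding h'_def mp uwz(1) by auto
    next
      case False
      then have "v \<in> \<Union>T" "v \<notin> ?t" using v VT' unfolding uwz(1) by auto
      then show ?thesis using hp[of v] False unfolding h'_def by auto
    qed
  qed
  have "barycentric T' h'"
    unfolding barycentric_def
  proof (intro ballI allI impI, elim conjE)
    fix s v and l :: "'p \<Rightarrow> real" assume s: "s \<in> T'" and l: "\<forall>x\<in>s. 0 \<le> l x" "sum l s = 1" and v: "v \<in> \<Union>T'"
    consider "s \<in> T" "s \<noteq> ?t" | "s = {a, b, x}" | "s = {a, c, x}" | "s = {b, c, x}"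
      using s unfolding T'_def by blast
    then show "h' v (\<Sum>x\<in>s. l x *\<^sub>R x) = (if v \<in> s then l v else 0)"
    proof cases
      case 1
      then show ?thesis by (rule old) (use l v in auto)
    next
      case 2
      show ?thesis unfolding 2
        by (rule new[where z = c]) (use dist l v in \<open>auto simp: x_def 2\<close>)
    next
      case 3
      show ?thesis unfolding 3
        by (rule new[where z = b]) (use dist l v in \<open>auto simp: x_def 3\<close>)
    next
      case 4
      show ?thesis unfolding 4
        by (rule new[where z = a]) (use dist l v in \<open>auto simp: x_def 4\<close>)
    qed
  qed
  moreover have "\<forall>s\<in>T'. card s = 3"
  proof
    fix s assume s: "s \<in> T'"
    have "x \<noteq> a" "x \<noteq> b" "x \<noteq> c" using xT t by blast+
    then show "card s = 3" using s dist TD(2) unfolding T'_def by auto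
  qed
  moreover have "finite T'" unfolding T'_def using TD(1) by simp
  moreover have "(\<Union>s\<in>T'. convex hull s) = S"
  proof -
    have "(\<Union>s\<in>T'. convex hull s) = (\<Union>s\<in>T - {?t}. convex hull s) \<union> convex hull ?t"
      unfolding T'_def convex_hull_stellar[of a b c, folded x_def] by auto
    also have "\<dots> = (\<Union>s\<in>T. convex hull s)" using t by blast
    finally show ?thesis using TD(5) by simp
  qed
  ultimately show "flat_triangulation (T - {?t} \<union> {{a, b, x}, {a, c, x}, {b, c, x}}) S"
    unfolding flat_triangulation_def T'_def[symmetric] by blast
qed

text \<open>No edge is lost: any two corners of the divided triangle still lie together in one of
  the three new ones.\<close>

lemma edges_of_stellar:
  assumes "{a, b, c} \<in> T" "a \<noteq> b" "a \<noteq> c" "b \<noteq> c" "x \<notin> \<Union>T"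
  shows "edges_of (T - {{a, b, c}} \<union> {{a, b, x}, {a, c, x}, {b, c, x}}) =
    edges_of T \<union> {{x, a}, {x, b}, {x, c}}" (is "edges_of ?T' = _")
proof
  have x: "x \<noteq> a" "x \<noteq> b" "x \<noteq> c" using assms(1,5) by blast+
  show "edges_of ?T' \<subseteq> edges_of T \<union> {{x, a}, {x, b}, {x, c}}"
  proof
    fix e assume "e \<in> edges_of ?T'"
    then obtain u v s where e: "s \<in> ?T'" "u \<in> s" "v \<in> s" "u \<noteq> v" "e = {u, v}" by (rule edges_ofE)
    have "{u, v} \<in> edges_of T" if "{u, v} \<subseteq> {a, b, c}"
      using that e(4) by (intro edges_ofI[OF assms(1)]) auto
    moreover have "{u, v} \<in> edges_of T" if "s \<in> T"
      using that e by (intro edges_ofI[OF that]) auto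
    moreover have "{u, v} \<subseteq> {a, b, c} \<or> {u, v} \<in> {{x, a}, {x, b}, {x, c}}" if "s \<notin> T"
    proof -
      have "s \<in> {{a, b, x}, {a, c, x}, {b, c, x}}" using e(1) that by blast
      then have "u \<in> {a, b, c, x}" "v \<in> {a, b, c, x}" using e(2,3) by blast+
      then show ?thesis using e(4) by (elim insertE emptyE) auto
    qed
    ultimately show "e \<in> edges_of T \<union> {{x, a}, {x, b}, {x, c}}"
      unfolding e(5) by blast
  qed
  have old: "{u, v} \<in> edges_of ?T'" if uv: "u \<in> s" "v \<in> s" "s \<in> T" "u \<noteq> v" for u v s
  proof (cases "s = {a, b, c}")
    case False
    then show ?thesis using uv by (intro edges_ofI[of s]) auto
  next
    case True
    then consider "{u, v} \<subseteq> {a, b, x}" | "{u, v} \<subseteq> {a, c, x}" | "{u, v} \<subseteq> {b, c, x}"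
      using uv by blast
    then show ?thesis
    proof cases
      case 1 then show ?thesis using uv by (intro edges_ofI[of "{a, b, x}"]) auto
    next
      case 2 then show ?thesis using uv by (intro edges_ofI[of "{a, c, x}"]) auto
    next
      case 3 then show ?thesis using uv by (intro edges_ofI[of "{b, c, x}"]) auto
    qed
  qed
  have "{x, a} \<in> edges_of ?T'" "{x, b} \<in> edges_of ?T'"
    using x by (intro edges_ofI[of "{a, b, x}"]; simp)+
  moreover have "{x, c} \<in> edges_of ?T'"
    using x by (intro edges_ofI[of "{a, c, x}"]; simp)
  moreover have "edges_of T \<subseteq> edges_of ?T'"
    using old by (fastforce elim!: edges_ofE)
  ultimately show "edges_of T \<union> {{x, a}, {x, b}, {x, c}} \<subseteq> edges_of ?T'" by blast
qed

text \<open>Dividing over and over the triangle on \<open>p\<close>, \<open>q\<close> and the newest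
  vertex builds the fan. The last conjunct names that triangle for the next step; the inclusion
  before it keeps the other triangles available for further fans.\<close>

lemma fan_insertion:
  fixes T :: "'p::real_vector set set"
  assumes T: "flat_triangulation T S" and t: "{p, q, r} \<in> T"
  shows "\<exists>x T'. flat_triangulation T' S \<and> inj_on x {..<m} \<and> x ` {..<m} \<inter> \<Union>T = {} \<and>
     \<Union>T' = \<Union>T \<union> x ` {..<m} \<and> edges_of T' = edges_of T \<union> fan_edges p q r x m \<and>
     T - {{p, q, r}} \<subseteq> T' \<and> {p, q, if m = 0 then r else x (m - 1)} \<in> T'"
proof (induction m)
  case 0
  show ?case by (rule exI, rule exI[of _ T]) (use T t in \<open>auto simp: fan_edges_def\<close>)
next
  case (Suc m)
  then obtain x T' where IH: "flat_triangulation T' S" "inj_on x {..<m}" "x ` {..<m} \<inter> \<Union>T = {}"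
    "\<Union>T' = \<Union>T \<union> x ` {..<m}" "edges_of T' = edges_of T \<union> fan_edges p q r x m"
    "T - {{p, q, r}} \<subseteq> T'" "{p, q, if m = 0 then r else x (m - 1)} \<in> T'" by blast
  define y where "y = (if m = 0 then r else x (m - 1))"
  have y: "{p, q, y} \<in> T'" using IH(7) y_def by simp
  define z where "z = (1/3) *\<^sub>R p + (1/3) *\<^sub>R q + (1/3) *\<^sub>R y"
  define T'' where "T'' = T' - {{p, q, y}} \<union> {{p, q, z}, {p, y, z}, {q, y, z}}"
  define x' where "x' = x(m := z)"
  have z: "z \<notin> \<Union>T'" and flat: "flat_triangulation T'' S"
    using stellar_subdivision[OF IH(1) y] unfolding z_def T''_def by blast+
  have "card {p, q, y} = 3" using flat_triangulationD(2)[OF IH(1) y] .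
  then have dist: "p \<noteq> q" "p \<noteq> y" "q \<noteq> y" by (auto simp: card_insert_if split: if_splits)
  have im: "x' ` {..<Suc m} = insert z (x ` {..<m})"
    unfolding x'_def by (auto simp: lessThan_Suc)
  have "inj_on x' {..<Suc m}"
    unfolding lessThan_Suc
  proof (rule inj_on_insert[THEN iffD2], intro conjI)
    show "inj_on x' {..<m}" using IH(2) unfolding x'_def inj_on_def by auto
    show "x' m \<notin> x' ` ({..<m} - {m})" using z IH(4) unfolding x'_def by auto
  qed
  moreover have "x' ` {..<Suc m} \<inter> \<Union>T = {}" using z IH(3,4) unfolding im by blast
  moreover have "\<Union>T'' = \<Union>T \<union> x' ` {..<Suc m}"
  proof -
    have "\<Union>T'' = insert z (\<Union>T')" unfolding T''_def using y by auto
    then show ?thesis unfolding im IH(4) by blast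
  qed
  moreover have "edges_of T'' = edges_of T \<union> fan_edges p q r x' (Suc m)"
  proof -
    have "fan_edges p q r x' (Suc m) = fan_edges p q r x m \<union> {{z, p}, {z, q}, {z, y}}"
    proof -
      have "fan_edges p q r x' m = fan_edges p q r x m"
        unfolding fan_edges_def by (intro SUP_cong) (auto simp: x'_def)
      moreover have "fan_edges p q r x' (Suc m) = fan_edges p q r x' m \<union> {{z, p}, {z, q}, {z, y}}"
        unfolding fan_edges_def lessThan_Suc by (auto simp: x'_def y_def)
      ultimately show ?thesis by simp
    qed
    then show ?thesis
      using edges_of_stellar[OF y dist z] IH(5) unfolding T''_def by (simp add: Un_assoc)
  qed
  moreover have "T - {{p, q, r}} \<subseteq> T''"
  proof -
    \<comment> \<open>From the second step on, the triangle being divided contains a new vertex, so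
      no triangle of \<open>T\<close> other than \<open>{p, q, r}\<close> is ever removed.\<close>
    have "{p, q, y} \<notin> T - {{p, q, r}}"
    proof (cases m)
      case 0 then show ?thesis by (simp add: y_def)
    next
      case (Suc k)
      then have "y \<in> x ` {..<m}" by (auto simp: y_def)
      then show ?thesis using IH(3) by blast
    qed
    moreover have "T' - {{p, q, y}} \<subseteq> T''" unfolding T''_def by (rule Un_upper1)
    ultimately show ?thesis
      using IH(6) subset_Diff_insert[of "T - {{p, q, r}}" T' "{p, q, y}" "{}"] by simp
  qed
  moreover have "{p, q, if Suc m = 0 then r else x' (Suc m - 1)} \<in> T''"
    by (simp add: x'_def T''_def)
  ultimately show ?case using flat by blast
qed

subsection \<open>The grid triangulation of the surface\<close>

type_synonym pt = "real \<times> real \<times> real"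

text \<open>Apart from the truncation at 0, this is 1 minus the difference between the largest and
  the smallest of the numbers 0, \<open>x\<close>, \<open>y\<close>, \<open>z\<close>; the second
  maximum is the negated minimum.\<close>

definition hat3 :: "real \<Rightarrow> real \<Rightarrow> real \<Rightarrow> real" where
  "hat3 x y z = max 0 (1 - max 0 (max x (max y z)) - max 0 (max (- x) (max (- y) (- z))))"

text \<open>The coordinate of \<open>p\<close> at the vertex \<open>v\<close> in the Kuhn (Freudenthal) triangulation of 3-space,
  whose simplices are spanned by chains of lattice points in a unit cube.\<close>

definition kuhn_hat :: "pt \<Rightarrow> pt \<Rightarrow> real" where
  "kuhn_hat v p = hat3 (fst p - fst v) (fst (snd p) - fst (snd v)) (snd (snd p) - snd (snd v))"

lemma hat3_perm:
  "hat3 x y z = hat3 x z y" "hat3 x y z = hat3 y x z" "hat3 x y z = hat3 y z x"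
  "hat3 x y z = hat3 z x y" "hat3 x y z = hat3 z y x"
  unfolding hat3_def by (simp_all add: max.commute max.left_commute)

text \<open>The point has offsets \<open>s\<close>, \<open>r\<close>, 0 from a base corner, and the
  integers are that corner minus the vertex. For \<open>r \<le> s\<close> the coefficients along the
  chain of corners are the successive differences \<open>1 - s\<close>, \<open>s - r\<close>,
  \<open>r\<close>.\<close>

lemma hat3_lattice:
  fixes k1 k2 k3 :: int
  assumes "0 \<le> r" "r \<le> s" "s \<le> 1"
  shows "hat3 (of_int k1 + s) (of_int k2 + r) (of_int k3) =
    (if k1 = 0 \<and> k2 = 0 \<and> k3 = 0 then 1 - s
     else if k1 = -1 \<and> k2 = 0 \<and> k3 = 0 then s - r
     else if k1 = -1 \<and> k2 = -1 \<and> k3 = 0 then r else 0)"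
proof -
  have zero: "hat3 x y z = 0" if "1 \<le> x \<or> x \<le> -1 \<or> 1 \<le> y \<or> y \<le> -1 \<or> 1 \<le> z \<or> z \<le> -1" for x y z
  proof -
    define A where "A = max 0 (max x (max y z))"
    define B where "B = max 0 (max (- x) (max (- y) (- z)))"
    have "x \<le> A" "y \<le> A" "z \<le> A" "0 \<le> A" unfolding A_def by simp_all
    moreover have "- x \<le> B" "- y \<le> B" "- z \<le> B" "0 \<le> B" unfolding B_def by simp_all
    ultimately have "1 - A - B \<le> 0" using that by linarith
    then show ?thesis unfolding hat3_def A_def B_def by simp
  qed
  have i1: "1 \<le> real_of_int k" if "1 \<le> k" for k using that by simp
  have i2: "real_of_int k \<le> - 2" if "k \<le> - 2" for k using that by simp
  \<comment> \<open>Unless \<open>k1\<close> and \<open>k2\<close> are 0 or -1 and \<open>k3\<close>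
    is 0, some argument has absolute value at least 1. Of the four remaining cases,
    \<open>k1 = 0\<close>, \<open>k2 = -1\<close> is the fourth corner of the square, where the
    untruncated value is \<open>r - s\<close>, which is not positive.\<close>
  consider "1 \<le> k1" | "k1 \<le> -2" | "1 \<le> k2" | "k2 \<le> -2" | "1 \<le> k3" | "k3 \<le> -1"
    | "k1 = 0" "k2 = 0" "k3 = 0" | "k1 = -1" "k2 = 0" "k3 = 0"
    | "k1 = 0" "k2 = -1" "k3 = 0" | "k1 = -1" "k2 = -1" "k3 = 0" by linarith
  then show ?thesis
  proof cases
    case 1 then show ?thesis using i1[of k1] assms by (subst zero) auto
  next
    case 2 then show ?thesis using i2[of k1] assms by (subst zero) auto
  next
    case 3 then show ?thesis using i1[of k2] assms by (subst zero) auto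
  next
    case 4 then show ?thesis using i2[of k2] assms by (subst zero) auto
  next
    case 5 then show ?thesis using i1[of k3] assms by (subst zero) auto
  next
    case 6
    then have "real_of_int k3 \<le> -1" by simp
    then show ?thesis using 6 assms by (subst zero) auto
  qed (use assms in \<open>simp_all add: hat3_def max_def\<close>)
qed

definition lattice :: "pt set" where
  "lattice = range (\<lambda>(i::int, j::int, k::int). (of_int i, of_int j, of_int k))"

definition axes :: "pt set" where "axes = {(1, 0, 0), (0, 1, 0), (0, 0, 1)}"

lemma kuhn_hat_triangle:
  assumes "b \<in> lattice" "v \<in> lattice" "d \<in> axes" "e \<in> axes" "d \<noteq> e" "0 \<le> r" "r \<le> s" "s \<le> 1"
  shows "kuhn_hat v (b + s *\<^sub>R d + r *\<^sub>R e) =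
    (if v = b then 1 - s else if v = b + d then s - r else if v = b + d + e then r else 0)"
proof -
  obtain b1 b2 b3 :: int where b: "b = (of_int b1, of_int b2, of_int b3)"
    using assms(1) unfolding lattice_def by auto
  obtain v1 v2 v3 :: int where v: "v = (of_int v1, of_int v2, of_int v3)"
    using assms(2) unfolding lattice_def by auto
  have eq: "real_of_int x = real_of_int y \<longleftrightarrow> x - y = 0" "real_of_int y = real_of_int x + 1 \<longleftrightarrow> x - y = -1" for x y
    by linarith+
  note h = hat3_lattice[OF assms(6-8)]
  have rw: "of_int x + t - of_int y = of_int (x - y) + (t::real)"
    "of_int x - of_int y = (of_int (x - y)::real)" for x y t by simp_all
  consider "d = (1,0,0)" "e = (0,1,0)" | "d = (1,0,0)" "e = (0,0,1)" | "d = (0,1,0)" "e = (1,0,0)"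
    | "d = (0,1,0)" "e = (0,0,1)" | "d = (0,0,1)" "e = (1,0,0)" | "d = (0,0,1)" "e = (0,1,0)"
    using assms(3-5) unfolding axes_def by blast
  then show ?thesis
  proof cases
    case 1
    show ?thesis using h[of "b1 - v1" "b2 - v2" "b3 - v3"]
      unfolding b v 1 kuhn_hat_def by (auto simp: algebra_simps eq)
  next
    case 2
    show ?thesis using h[of "b1 - v1" "b3 - v3" "b2 - v2"]
      unfolding b v 2 kuhn_hat_def by (subst hat3_perm(1)) (auto simp: algebra_simps eq)
  next
    case 3
    show ?thesis using h[of "b2 - v2" "b1 - v1" "b3 - v3"]
      unfolding b v 3 kuhn_hat_def by (subst hat3_perm(2)) (auto simp: algebra_simps eq)
  next
    case 4
    show ?thesis using h[of "b2 - v2" "b3 - v3" "b1 - v1"]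
      unfolding b v 4 kuhn_hat_def by (subst hat3_perm(3)) (auto simp: algebra_simps eq)
  next
    case 5
    show ?thesis using h[of "b3 - v3" "b1 - v1" "b2 - v2"]
      unfolding b v 5 kuhn_hat_def by (subst hat3_perm(4)) (auto simp: algebra_simps eq)
  next
    case 6
    show ?thesis using h[of "b3 - v3" "b2 - v2" "b1 - v1"]
      unfolding b v 6 kuhn_hat_def by (subst hat3_perm(5)) (auto simp: algebra_simps eq)
  qed
qed

lemma kuhn_barycentric:
  assumes T: "\<And>t. t \<in> T \<Longrightarrow> \<exists>b\<in>lattice. \<exists>d\<in>axes. \<exists>e\<in>axes. d \<noteq> e \<and> t = {b, b + d, b + d + e}"
  shows "barycentric T kuhn_hat" and "t \<in> T \<Longrightarrow> card t = 3"
proof -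
  have axes_indep: "d \<noteq> 0" "d + e \<noteq> 0" if "d \<in> axes" "e \<in> axes" for d e
    using that unfolding axes_def zero_prod_def by auto
  have lat: "d \<in> lattice" if "d \<in> axes" for d
  proof -
    have "(1, 0, 0) \<in> lattice" unfolding lattice_def by (rule range_eqI[of _ _ "(1, 0, 0)"]) simp
    moreover have "(0, 1, 0) \<in> lattice" unfolding lattice_def by (rule range_eqI[of _ _ "(0, 1, 0)"]) simp
    moreover have "(0, 0, 1) \<in> lattice" unfolding lattice_def by (rule range_eqI[of _ _ "(0, 0, 1)"]) simp
    ultimately show ?thesis using that unfolding axes_def by blast
  qed
  have add: "x + y \<in> lattice" if xy: "x \<in> lattice" "y \<in> lattice" for x y
  proof -
    obtain i j k :: int where "x = (of_int i, of_int j, of_int k)" using xy unfolding lattice_def by auto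
    moreover obtain i' j' k' :: int where "y = (of_int i', of_int j', of_int k')"
      using xy unfolding lattice_def by auto
    ultimately show ?thesis
      unfolding lattice_def by (intro range_eqI[of _ _ "(i + i', j + j', k + k')"]) simp
  qed
  have VT: "v \<in> lattice" if "v \<in> \<Union>T" for v
    using that T add lat by fastforce
  have dist: "b \<noteq> b + d" "b \<noteq> b + d + e" "b + d \<noteq> b + d + e" if "d \<in> axes" "e \<in> axes" for b d e
    using axes_indep[OF that] axes_indep[OF that(2,1)] by (auto simp: add.assoc)
  show "card t = 3" if t: "t \<in> T" for t
  proof -
    obtain b d e where bde: "d \<in> axes" "e \<in> axes" "t = {b, b + d, b + d + e}" using T[OF t] by blast
    show ?thesis unfolding bde(3) using dist[OF bde(1,2), of b] by (simp del: add_left_cancel)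
  qed
  show "barycentric T kuhn_hat"
    unfolding barycentric_def
  proof (intro ballI allI impI, elim conjE)
    fix t v and l :: "pt \<Rightarrow> real"
    assume t: "t \<in> T" and l: "\<forall>x\<in>t. 0 \<le> l x" "sum l t = 1" and v: "v \<in> \<Union>T"
    obtain b d e where bde: "b \<in> lattice" "d \<in> axes" "e \<in> axes" "d \<noteq> e" "t = {b, b + d, b + d + e}"
      using T[OF t] by blast
    note D = dist[OF bde(2,3), of b]
    \<comment> \<open>Partial sums of the coefficients from the far end turn the convex combination
      into \<open>b + s *\<^sub>R d + r *\<^sub>R e\<close> with \<open>0 \<le> r\<close>,
      \<open>r \<le> s\<close> and \<open>s \<le> 1\<close>.\<close>
    define r where "r = l (b + d + e)"
    define s where "s = l (b + d) + l (b + d + e)"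
    have sum1: "l b + l (b + d) + l (b + d + e) = 1"
      using l(2) D unfolding bde(5) by (simp add: add.assoc)
    have rs: "0 \<le> r" "r \<le> s" "s \<le> 1" using l(1) sum1 unfolding bde(5) r_def s_def by auto
    have "(\<Sum>x\<in>t. l x *\<^sub>R x) = l b *\<^sub>R b + l (b + d) *\<^sub>R (b + d) + l (b + d + e) *\<^sub>R (b + d + e)"
      unfolding bde(5) using D by (simp add: add.assoc)
    also have "\<dots> = (l b + l (b + d) + l (b + d + e)) *\<^sub>R b + s *\<^sub>R d + r *\<^sub>R e"
      unfolding r_def s_def by (simp add: algebra_simps)
    finally have p: "(\<Sum>x\<in>t. l x *\<^sub>R x) = b + s *\<^sub>R d + r *\<^sub>R e" unfolding sum1 by simp
    have "1 - s = l b" "s - r = l (b + d)" using sum1 unfolding r_def s_def by auto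
    then have "kuhn_hat v (b + s *\<^sub>R d + r *\<^sub>R e) = (if v \<in> t then l v else 0)"
      unfolding kuhn_hat_triangle[OF bde(1) VT[OF v] bde(2-4) rs] bde(5)
      using axes_indep[OF bde(2,3)] by (auto simp: r_def add.assoc)
    then show "kuhn_hat v (\<Sum>x\<in>t. l x *\<^sub>R x) = (if v \<in> t then l v else 0)"
      by (simp only: p)
  qed
qed

lemma convex_hull_kuhn_triangle:
  fixes b d e :: "'p::real_vector"
  shows "convex hull {b, b + d, b + d + e} = {b + s *\<^sub>R d + r *\<^sub>R e | s r. 0 \<le> r \<and> r \<le> s \<and> s \<le> 1}"
    (is "?L = ?R")
proof
  show "?L \<subseteq> ?R"
  proof
    fix p assume "p \<in> ?L"
    then obtain u v w where p: "p = u *\<^sub>R b + v *\<^sub>R (b + d) + w *\<^sub>R (b + d + e)"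
      "0 \<le> u" "0 \<le> v" "0 \<le> w" "u + v + w = 1" unfolding convex_hull_3 by blast
    have "p = (u + v + w) *\<^sub>R b + (v + w) *\<^sub>R d + w *\<^sub>R e" unfolding p(1) by (simp add: algebra_simps)
    then show "p \<in> ?R" unfolding p(5) using p by (intro CollectI exI[of _ "v + w"] exI[of _ w]) auto
  qed
  show "?R \<subseteq> ?L"
  proof
    fix p assume "p \<in> ?R"
    then obtain s r where p: "p = b + s *\<^sub>R d + r *\<^sub>R e" "0 \<le> r" "r \<le> s" "s \<le> 1" by blast
    then have "p = (1 - s) *\<^sub>R b + (s - r) *\<^sub>R (b + d) + r *\<^sub>R (b + d + e)" by (simp add: algebra_simps)
    then show "p \<in> ?L" unfolding convex_hull_3 using p
      by (intro CollectI exI[of _ "1 - s"] exI[of _ "s - r"] exI[of _ r]) auto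
  qed
qed

lemma kuhn_square:
  fixes b d e :: "'p::real_vector"
  shows "convex hull {b, b + d, b + d + e} \<union> convex hull {b, b + e, b + d + e} =
    {b + s *\<^sub>R d + r *\<^sub>R e | s r. 0 \<le> s \<and> s \<le> 1 \<and> 0 \<le> r \<and> r \<le> 1}"
proof -
  have comm: "b + d + e = b + e + d" by (simp add: algebra_simps)
  have second: "convex hull {b, b + e, b + d + e} = {b + s *\<^sub>R e + r *\<^sub>R d | s r. 0 \<le> r \<and> r \<le> s \<and> s \<le> 1}"
    by (subst comm) (rule convex_hull_kuhn_triangle)
  show ?thesis
    unfolding convex_hull_kuhn_triangle second
  proof (intro set_eqI iffI)
    fix p assume "p \<in> {b + s *\<^sub>R d + r *\<^sub>R e | s r. 0 \<le> r \<and> r \<le> s \<and> s \<le> 1} \<union>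
      {b + s *\<^sub>R e + r *\<^sub>R d | s r. 0 \<le> r \<and> r \<le> s \<and> s \<le> 1}"
    then consider s r where "p = b + s *\<^sub>R d + r *\<^sub>R e" "0 \<le> r" "r \<le> s" "s \<le> 1"
      | s r where "p = b + s *\<^sub>R e + r *\<^sub>R d" "0 \<le> r" "r \<le> s" "s \<le> 1" by blast
    then show "p \<in> {b + s *\<^sub>R d + r *\<^sub>R e | s r. 0 \<le> s \<and> s \<le> 1 \<and> 0 \<le> r \<and> r \<le> 1}"
    proof cases
      case (1 s r)
      then show ?thesis by (intro CollectI exI[of _ s] exI[of _ r]) auto
    next
      case (2 s r)
      then show ?thesis by (intro CollectI exI[of _ r] exI[of _ s]) (auto simp: algebra_simps)
    qed
  next
    fix p assume "p \<in> {b + s *\<^sub>R d + r *\<^sub>R e | s r. 0 \<le> s \<and> s \<le> 1 \<and> 0 \<le> r \<and> r \<le> 1}"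
    then obtain s r where p: "p = b + s *\<^sub>R d + r *\<^sub>R e" "0 \<le> s" "s \<le> 1" "0 \<le> r" "r \<le> 1" by blast
    then have p': "p = b + r *\<^sub>R e + s *\<^sub>R d" by (simp add: algebra_simps)
    show "p \<in> {b + s *\<^sub>R d + r *\<^sub>R e | s r. 0 \<le> r \<and> r \<le> s \<and> s \<le> 1} \<union>
      {b + s *\<^sub>R e + r *\<^sub>R d | s r. 0 \<le> r \<and> r \<le> s \<and> s \<le> 1}"
      using p p' linear[of s r] by blast
  qed
qed

section \<open>The squares of the drilled box and the set that they cover\<close>

text \<open>A square is given by its least corner and its two side directions.\<close>

definition surface_squares :: "nat \<Rightarrow> (pt \<times> pt \<times> pt) set" where
  "surface_squares g =
     {((real i, real j, real k), (1, 0, 0), (0, 1, 0)) | i j k.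
        i \<le> 2 * g \<and> j \<le> 2 \<and> k \<le> 1 \<and> \<not> (odd i \<and> j = 1)} \<union>
     {((real i, real j, 0), (1, 0, 0), (0, 0, 1)) | i j.
        i \<le> 2 * g \<and> j \<le> 3 \<and> (j = 0 \<or> j = 3 \<or> odd i)} \<union>
     {((real i, real j, 0), (0, 1, 0), (0, 0, 1)) | i j.
        i \<le> 2 * g + 1 \<and> j \<le> 2 \<and> (i = 0 \<or> i = 2 * g + 1 \<or> j = 1)}"

lemma surface_squaresI:
  "i \<le> 2 * g \<Longrightarrow> j \<le> 2 \<Longrightarrow> k \<le> 1 \<Longrightarrow> \<not> (odd i \<and> j = 1) \<Longrightarrow>
     ((real i, real j, real k), (1, 0, 0), (0, 1, 0)) \<in> surface_squares g"
  "i \<le> 2 * g \<Longrightarrow> j \<le> 3 \<Longrightarrow> j = 0 \<or> j = 3 \<or> odd i \<Longrightarrow>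
     ((real i, real j, 0), (1, 0, 0), (0, 0, 1)) \<in> surface_squares g"
  "i \<le> 2 * g + 1 \<Longrightarrow> j \<le> 2 \<Longrightarrow> i = 0 \<or> i = 2 * g + 1 \<or> j = 1 \<Longrightarrow>
     ((real i, real j, 0), (0, 1, 0), (0, 0, 1)) \<in> surface_squares g"
  unfolding surface_squares_def by blast+

text \<open>Cutting along the diagonal from the least corner makes both halves faces of Kuhn
  simplices, so triangles of different squares, even in different planes, share the coordinate
  functions \<open>kuhn_hat\<close>.\<close>

definition surface_triangles :: "nat \<Rightarrow> pt set set" where
  "surface_triangles g =
     (\<Union>(b, d, e)\<in>surface_squares g. {{b, b + d, b + d + e}, {b, b + e, b + d + e}})"

text \<open>The solid is closed, being a box minus open tunnels, so its frontier is the solid minus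
  its interior. The interior is the open box minus the closed tunnels, since closure commutes with
  the finite union.\<close>

lemma orientable_surface_iff:
  "(x, y, z) \<in> orientable_surface g \<longleftrightarrow>
     0 \<le> x \<and> x \<le> 2 * real g + 1 \<and> 0 \<le> y \<and> y \<le> 3 \<and> 0 \<le> z \<and> z \<le> 1 \<and>
     (\<forall>i<g. \<not> (2 * real i + 1 < x \<and> x < 2 * real i + 2 \<and> 1 < y \<and> y < 2)) \<and>
     (x = 0 \<or> x = 2 * real g + 1 \<or> y = 0 \<or> y = 3 \<or> z = 0 \<or> z = 1 \<or>
      (\<exists>i<g. 2 * real i + 1 \<le> x \<and> x \<le> 2 * real i + 2 \<and> 1 \<le> y \<and> y \<le> 2))"
proof -
  let ?B = "{0..2 * real g + 1} \<times> {0..3} \<times> {0..1} :: pt set"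
  let ?H = "\<lambda>i. {2 * real i + 1<..<2 * real i + 2} \<times> {1<..<2} \<times> UNIV :: pt set"
  have op: "open (\<Union>i<g. ?H i)" by (intro open_UN open_Times ballI) auto
  have cl: "closure (\<Union>i<n. ?H i) = (\<Union>i<n. closure (?H i))" for n :: nat
    by (induction n) (simp_all add: lessThan_Suc)
  have "closed ?B" by (intro closed_Times) auto
  then have "closed (solid_handlebody g)"
    unfolding solid_handlebody_def using op by (rule closed_Diff)
  moreover have "interior (solid_handlebody g) =
     {0<..<2 * real g + 1} \<times> {0<..<3} \<times> {0<..<1} -
     (\<Union>i<g. {2 * real i + 1..2 * real i + 2} \<times> {1..2} \<times> UNIV)"
    unfolding solid_handlebody_def interior_diff
    by (simp add: interior_Times closure_Times cl)
  ultimately have "orientable_surface g = solid_handlebody g -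
     ({0<..<2 * real g + 1} \<times> {0<..<3} \<times> {0<..<1} -
     (\<Union>i<g. {2 * real i + 1..2 * real i + 2} \<times> {1..2} \<times> UNIV))"
    unfolding orientable_surface_def frontier_def by simp
  moreover define H where "H \<longleftrightarrow> (\<forall>i<g. \<not> (2 * real i + 1 < x \<and> x < 2 * real i + 2 \<and> 1 < y \<and> y < 2))"
  moreover define K where "K \<longleftrightarrow> (\<exists>i<g. 2 * real i + 1 \<le> x \<and> x \<le> 2 * real i + 2 \<and> 1 \<le> y \<and> y \<le> 2)"
  have "(x, y, z) \<in> solid_handlebody g \<longleftrightarrow> (x, y, z) \<in> ?B \<and> H"
    unfolding solid_handlebody_def H_def by auto
  moreover have "(x, y, z) \<in> (\<Union>i<g. {2 * real i + 1..2 * real i + 2} \<times> {1..2} \<times> UNIV) \<longleftrightarrow> K"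
    unfolding K_def by auto
  ultimately have "(x, y, z) \<in> orientable_surface g \<longleftrightarrow> ((x, y, z) \<in> ?B \<and> H) \<and>
      \<not> ((x, y, z) \<in> {0<..<2 * real g + 1} \<times> {0<..<3} \<times> {0<..<1} \<and> \<not> K)"
    by blast
  then show ?thesis unfolding H_def[symmetric] K_def[symmetric] by (auto simp: less_le)
qed

lemma unit_interval_cover:
  assumes "0 \<le> x" "x \<le> real n + 1"
  obtains i where "i \<le> n" "real i \<le> x" "x \<le> real i + 1"
proof (cases "x = real n + 1")
  case True
  then show ?thesis using that[of n] by simp
next
  case False
  then show ?thesis using that[of "nat \<lfloor>x\<rfloor>"] assms by (simp add: le_nat_iff nat_le_iff floor_le_iff; linarith)
qed

lemma surface_cover: "(\<Union>t\<in>surface_triangles g. convex hull t) = orientable_surface g"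
proof -
  have "(\<Union>t\<in>surface_triangles g. convex hull t) = (\<Union>(b, d, e)\<in>surface_squares g.
      {b + s *\<^sub>R d + r *\<^sub>R e | s r. 0 \<le> s \<and> s \<le> 1 \<and> 0 \<le> r \<and> r \<le> 1})"
    unfolding surface_triangles_def kuhn_square[symmetric] by (simp add: case_prod_unfold UN_UN_flatten)
  also have "\<dots> = orientable_surface g"
  proof (intro set_eqI iffI)
    fix p assume "p \<in> (\<Union>(b, d, e)\<in>surface_squares g.
      {b + s *\<^sub>R d + r *\<^sub>R e | s r. 0 \<le> s \<and> s \<le> 1 \<and> 0 \<le> r \<and> r \<le> 1})"
    then obtain b d e s r where bde: "(b, d, e) \<in> surface_squares g" and p: "p = b + s *\<^sub>R d + r *\<^sub>R e"
      and sr: "0 \<le> s" "s \<le> 1" "0 \<le> r" "r \<le> 1" by blast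
    \<comment> \<open>A unit grid interval that meets the open range of tunnel \<open>k\<close> is
      that range. A horizontal square reaching into a tunnel would therefore have \<open>i\<close>
      odd and \<open>j = 1\<close>, which \<open>surface_squares\<close> excludes.\<close>
    have hole: "i = 2 * k + 1" if "real i \<le> x" "x \<le> real i + 1" "2 * real k + 1 < x" "x < 2 * real k + 2" for i k x
    proof -
      have "real i < real (2 * k + 2)" "real (2 * k + 1) < real (i + 1)" using that by auto
      then show ?thesis unfolding of_nat_less_iff by simp
    qed
    have hole1: "i = 1" if "real i \<le> x" "x \<le> real i + 1" "1 < x" "x < 2" for i x
      using hole[of i x 0] that by simp
    have int: False if "real k < real i" "real i < real k + 1" for i k
    proof -
      have "real i < real (k + 1)" using that by simp
      then show False using that(1) unfolding of_nat_less_iff by simp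
    qed
    consider (XY) i j k where "b = (real i, real j, real k)" "d = (1, 0, 0)" "e = (0, 1, 0)"
        "i \<le> 2 * g" "j \<le> 2" "k \<le> 1" "\<not> (odd i \<and> j = 1)"
      | (XZ) i j where "b = (real i, real j, 0)" "d = (1, 0, 0)" "e = (0, 0, 1)"
        "i \<le> 2 * g" "j \<le> 3" "j = 0 \<or> j = 3 \<or> odd i"
      | (YZ) i j where "b = (real i, real j, 0)" "d = (0, 1, 0)" "e = (0, 0, 1)"
        "i \<le> 2 * g + 1" "j \<le> 2" "i = 0 \<or> i = 2 * g + 1 \<or> j = 1"
      using bde unfolding surface_squares_def by blast
    then show "p \<in> orientable_surface g"
    proof cases
      case XY
      have "p = (real i + s, real j + r, real k)" using p XY by simp
      moreover have "real i \<le> 2 * real g" "real j \<le> 2" "k = 0 \<or> k = 1" using XY by auto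
      moreover have "\<not> (2 * real l + 1 < real i + s \<and> real i + s < 2 * real l + 2 \<and> 1 < real j + r \<and> real j + r < 2)" for l
      proof
        assume A: "2 * real l + 1 < real i + s \<and> real i + s < 2 * real l + 2 \<and> 1 < real j + r \<and> real j + r < 2"
        then have "i = 2 * l + 1" "j = 1"
          using hole[of i "real i + s" l] hole1[of j "real j + r"] sr by simp_all
        then show False using XY(7) by simp
      qed
      ultimately show ?thesis using sr by (auto simp: orientable_surface_iff)
    next
      case XZ
      have "p = (real i + s, real j, r)" using p XZ by simp
      moreover have "real i \<le> 2 * real g" "real j \<le> 3" using XZ by auto
      moreover have "\<not> (1 < real j \<and> real j < 2)" using int[of 1 j] by auto
      moreover have "j = 0 \<or> j = 3 \<or> (\<exists>l<g. 2 * real l + 1 \<le> real i + s \<and> real i + s \<le> 2 * real l + 2 \<and> 1 \<le> real j \<and> real j \<le> 2)"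
      proof (cases "j = 0 \<or> j = 3")
        case False
        then have "odd i" "j = 1 \<or> j = 2" using XZ by auto
        then obtain l where l: "i = 2 * l + 1" by (auto elim: oddE)
        then have "l < g" using XZ(4) by auto
        then show ?thesis using l sr \<open>j = 1 \<or> j = 2\<close> by (intro disjI2 exI[of _ l]) auto
      qed auto
      ultimately show ?thesis using sr by (auto simp: orientable_surface_iff)
    next
      case YZ
      have "p = (real i, real j + s, r)" using p YZ by simp
      moreover have "real i \<le> 2 * real g + 1" "real j \<le> 2" using YZ by auto
      moreover have "\<not> (2 * real l + 1 < real i \<and> real i < 2 * real l + 2)" for l
        using int[of "2 * l + 1" i] by auto
      moreover have "i = 0 \<or> i = 2 * g + 1 \<or> (\<exists>l<g. 2 * real l + 1 \<le> real i \<and> real i \<le> 2 * real l + 2 \<and> 1 \<le> real j + s \<and> real j + s \<le> 2)"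
      proof (cases "i = 0 \<or> i = 2 * g + 1")
        case False
        \<comment> \<open>The tunnel with a wall in the plane \<open>x = i\<close>: both
          \<open>i = 2 * l + 1\<close> and \<open>i = 2 * l + 2\<close> lead to this
          \<open>l\<close>.\<close>
        define l where "l = (i - 1) div 2"
        have "2 * l + 1 \<le> i" "i \<le> 2 * l + 2" "l < g" using False YZ(4) unfolding l_def by linarith+
        then have "2 * real l + 1 \<le> real i" "real i \<le> 2 * real l + 2" "l < g" by linarith+
        then show ?thesis using sr False YZ(6) by (intro disjI2 exI[of _ l]) auto
      qed auto
      ultimately show ?thesis using sr by (auto simp: orientable_surface_iff)
    qed
  next
    fix p assume pS: "p \<in> orientable_surface g"
    obtain x y z where p: "p = (x, y, z)" by (metis surj_pair)
    have S: "0 \<le> x" "x \<le> 2 * real g + 1" "0 \<le> y" "y \<le> 3" "0 \<le> z" "z \<le> 1"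
      "\<forall>i<g. \<not> (2 * real i + 1 < x \<and> x < 2 * real i + 2 \<and> 1 < y \<and> y < 2)"
      "x = 0 \<or> x = 2 * real g + 1 \<or> y = 0 \<or> y = 3 \<or> z = 0 \<or> z = 1 \<or>
        (\<exists>i<g. 2 * real i + 1 \<le> x \<and> x \<le> 2 * real i + 2 \<and> 1 \<le> y \<and> y \<le> 2)"
      using pS unfolding p orientable_surface_iff by auto
    have "\<exists>b d e s r. (b, d, e) \<in> surface_squares g \<and> p = b + s *\<^sub>R d + r *\<^sub>R e \<and>
        0 \<le> s \<and> s \<le> 1 \<and> 0 \<le> r \<and> r \<le> 1"
    proof -
      have sqI: ?thesis if "(b, d, e) \<in> surface_squares g" "p = b + s *\<^sub>R d + r *\<^sub>R e"
        "0 \<le> s" "s \<le> 1" "0 \<le> r" "r \<le> 1" for b d e s r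
        using that by blast
      have XY: ?thesis if "i \<le> 2 * g" "j \<le> 2" "k \<le> 1" "\<not> (odd i \<and> j = 1)" "z = real k"
        "real i \<le> x" "x \<le> real i + 1" "real j \<le> y" "y \<le> real j + 1" for i j k
        by (rule sqI[OF surface_squaresI(1)[of i g j k], of "x - real i" "y - real j"])
          (use that in \<open>simp_all add: p\<close>)
      have XZ: ?thesis if "i \<le> 2 * g" "j \<le> 3" "j = 0 \<or> j = 3 \<or> odd i" "y = real j"
        "real i \<le> x" "x \<le> real i + 1" for i j
        by (rule sqI[OF surface_squaresI(2)[of i g j], of "x - real i" z])
          (use that S(1-6) in \<open>simp_all add: p\<close>)
      have YZ: ?thesis if "i \<le> 2 * g + 1" "j \<le> 2" "i = 0 \<or> i = 2 * g + 1 \<or> j = 1" "x = real i"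
        "real j \<le> y" "y \<le> real j + 1" for i j
        by (rule sqI[OF surface_squaresI(3)[of i g j], of "y - real j" z])
          (use that S(1-6) in \<open>simp_all add: p\<close>)
      obtain i where i: "i \<le> 2 * g" "real i \<le> x" "x \<le> real i + 1"
        using unit_interval_cover[of x "2 * g"] S by auto
      obtain j where j: "j \<le> 2" "real j \<le> y" "y \<le> real j + 1"
        using unit_interval_cover[of y 2] S by auto
      show ?thesis
      proof (cases "\<exists>l<g. 2 * real l + 1 \<le> x \<and> x \<le> 2 * real l + 2 \<and> 1 \<le> y \<and> y \<le> 2")
        case True
        then obtain l where l: "l < g" "2 * real l + 1 \<le> x" "x \<le> 2 * real l + 2" "1 \<le> y" "y \<le> 2" by blast
        \<comment> \<open>The point is in the closed range of tunnel \<open>l\<close> but, being on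
          the surface, not in the open one. So it lies on one of the four walls.\<close>
        then consider "x = 2 * real l + 1" | "x = 2 * real l + 2" | "y = 1" | "y = 2"
          using S(7) by fastforce
        then show ?thesis
        proof cases
          case 1 show ?thesis by (rule YZ[of "2 * l + 1" 1]) (use 1 l in auto)
        next
          case 2 show ?thesis by (rule YZ[of "2 * l + 2" 1]) (use 2 l in auto)
        next
          case 3 show ?thesis by (rule XZ[of "2 * l + 1" 1]) (use 3 l in auto)
        next
          case 4 show ?thesis by (rule XZ[of "2 * l + 1" 2]) (use 4 l in auto)
        qed
      next
        case False
        then consider "x = 0" | "x = 2 * real g + 1" | "y = 0" | "y = 3" | "z = 0" | "z = 1"
          using S(8) by blast
        \<comment> \<open>The cell \<open>i\<close>, \<open>j\<close> containing the point cannot be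
          the mouth of a tunnel, since the point avoids all closed tunnels.\<close>
        moreover have nh: "\<not> (odd i \<and> j = 1)"
        proof
          assume ij: "odd i \<and> j = 1"
          then obtain l where "i = 2 * l + 1" by (auto elim: oddE)
          then show False using False i j ij by (auto dest!: spec[of _ l])
        qed
        ultimately show ?thesis
        proof cases
          case 1 show ?thesis by (rule YZ[of 0 j]) (use 1 j in auto)
        next
          case 2 show ?thesis by (rule YZ[of "2 * g + 1" j]) (use 2 j in auto)
        next
          case 3 show ?thesis by (rule XZ[of i 0]) (use 3 i in auto)
        next
          case 4 show ?thesis by (rule XZ[of i 3]) (use 4 i in auto)
        next
          case 5 show ?thesis by (rule XY[of i j 0]) (use 5 i j nh in auto)
        next
          case 6 show ?thesis by (rule XY[of i j 1]) (use 6 i j nh in auto)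
        qed
      qed
    qed
    then show "p \<in> (\<Union>(b, d, e)\<in>surface_squares g.
      {b + s *\<^sub>R d + r *\<^sub>R e | s r. 0 \<le> s \<and> s \<le> 1 \<and> 0 \<le> r \<and> r \<le> 1})" by blast
  qed
  finally show ?thesis .
qed

lemma surface_triangles_flat: "flat_triangulation (surface_triangles g) (orientable_surface g)"
proof -
  have "surface_squares g \<subseteq>
      (\<lambda>(i, j, k). ((real i, real j, real k), (1, 0, 0), (0, 1, 0))) ` ({..2 * g} \<times> {..2} \<times> {..1}) \<union>
      (\<lambda>(i, j). ((real i, real j, 0), (1, 0, 0), (0, 0, 1))) ` ({..2 * g} \<times> {..3}) \<union>
      (\<lambda>(i, j). ((real i, real j, 0), (0, 1, 0), (0, 0, 1))) ` ({..2 * g + 1} \<times> {..2})"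
    unfolding surface_squares_def image_def by auto
  then have "finite (surface_squares g)" by (rule finite_subset) (intro finite_UnI finite_imageI finite_cartesian_product finite_atMost)
  then have fin: "finite (surface_triangles g)" unfolding surface_triangles_def by auto
  have sq: "b \<in> lattice \<and> d \<in> axes \<and> e \<in> axes \<and> d \<noteq> e" if "(b, d, e) \<in> surface_squares g" for b d e
  proof -
    have "(real i, real j, real k) \<in> lattice" for i j k
      unfolding lattice_def by (rule range_eqI[of _ _ "(int i, int j, int k)"]) simp
    note lat = this this[of _ _ 0, unfolded of_nat_0]
    show ?thesis
      using that unfolding surface_squares_def
      by (elim UnE CollectE exE conjE) (simp_all add: lat axes_def)
  qed
  have kuhn: "\<exists>b\<in>lattice. \<exists>d\<in>axes. \<exists>e\<in>axes. d \<noteq> e \<and> t = {b, b + d, b + d + e}"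
    if "t \<in> surface_triangles g" for t
  proof -
    obtain b d e where bde: "(b, d, e) \<in> surface_squares g"
      "t = {b, b + d, b + d + e} \<or> t = {b, b + e, b + d + e}"
      using \<open>t \<in> _\<close> unfolding surface_triangles_def by auto
    have "b + d + e = b + e + d" by (simp add: algebra_simps)
    then show ?thesis using sq[OF bde(1)] bde(2) by metis
  qed
  show ?thesis
    unfolding flat_triangulation_def
    using fin kuhn_barycentric[OF kuhn] surface_cover by blast
qed

section \<open>Vertices and edges of the grid\<close>

lemma square_edges:
  assumes "(b, d, e) \<in> surface_squares g"
  shows "{b, b + d} \<in> edges_of (surface_triangles g)" "{b, b + e} \<in> edges_of (surface_triangles g)"
    "{b + d, b + d + e} \<in> edges_of (surface_triangles g)"
    "{b + e, b + d + e} \<in> edges_of (surface_triangles g)"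
proof -
  have t: "{b, b + d, b + d + e} \<in> surface_triangles g" "{b, b + e, b + d + e} \<in> surface_triangles g"
    unfolding surface_triangles_def using assms by blast+
  have "d \<noteq> 0" "e \<noteq> 0" using assms unfolding surface_squares_def zero_prod_def by auto
  then have "b \<noteq> b + d" "b \<noteq> b + e" "b + d \<noteq> b + d + e" "b + e \<noteq> b + d + e" by auto
  then show "{b, b + d} \<in> edges_of (surface_triangles g)" "{b, b + e} \<in> edges_of (surface_triangles g)"
    "{b + d, b + d + e} \<in> edges_of (surface_triangles g)"
    "{b + e, b + d + e} \<in> edges_of (surface_triangles g)"
    by (auto intro: edges_ofI[OF t(1)] edges_ofI[OF t(2)])
qed

text \<open>Each edge is a side of some square of the surface. In the first direction the squares of
  the middle row may be missing, so the rows 0 and 2 supply the edges at \<open>j = 1\<close> and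
  \<open>j = 2\<close>; the edges from \<open>j = 1\<close> to \<open>j = 2\<close> come from the
  vertical squares with \<open>j = 1\<close>, present at every \<open>i\<close>.\<close>

lemma grid_edges:
  shows "i \<le> 2 * g \<Longrightarrow> j \<le> 3 \<Longrightarrow> k \<le> 1 \<Longrightarrow>
      {(real i, real j, real k), (real (Suc i), real j, real k)} \<in> edges_of (surface_triangles g)"
    and "i \<le> 2 * g + 1 \<Longrightarrow> j \<le> 2 \<Longrightarrow> k \<le> 1 \<Longrightarrow>
      {(real i, real j, real k), (real i, real (Suc j), real k)} \<in> edges_of (surface_triangles g)"
    and "i \<le> 2 * g + 1 \<Longrightarrow> j \<le> 3 \<Longrightarrow>
      {(real i, real j, 0), (real i, real j, 1)} \<in> edges_of (surface_triangles g)"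
proof -
  show "{(real i, real j, real k), (real (Suc i), real j, real k)} \<in> edges_of (surface_triangles g)"
    if ijk: "i \<le> 2 * g" "j \<le> 3" "k \<le> 1"
  proof -
    consider "j = 0" | "j = 1" | "j = 2" | "j = 3" using ijk by linarith
    then show ?thesis
    proof cases
      case 1 then show ?thesis using square_edges(1)[OF surface_squaresI(1)[of i g 0 k]] ijk by (simp add: add.commute)
    next
      case 2 then show ?thesis using square_edges(4)[OF surface_squaresI(1)[of i g 0 k]] ijk by (simp add: add.commute)
    next
      case 3 then show ?thesis using square_edges(1)[OF surface_squaresI(1)[of i g 2 k]] ijk by (simp add: add.commute)
    next
      case 4 then show ?thesis using square_edges(4)[OF surface_squaresI(1)[of i g 2 k]] ijk by (simp add: add.commute)
    qed
  qed
  show "{(real i, real j, real k), (real i, real (Suc j), real k)} \<in> edges_of (surface_triangles g)"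
    if ijk: "i \<le> 2 * g + 1" "j \<le> 2" "k \<le> 1"
  proof -
    consider "j = 1" "k = 0" | "j = 1" "k = 1" | "j \<noteq> 1" "i \<le> 2 * g" | "j \<noteq> 1" "i = Suc (2 * g)" using ijk by linarith
    then show ?thesis
    proof cases
      case 1 then show ?thesis using square_edges(1)[OF surface_squaresI(3)[of i g 1]] ijk by simp
    next
      case 2 then show ?thesis using square_edges(4)[OF surface_squaresI(3)[of i g 1]] ijk by simp
    next
      case 3 then show ?thesis using square_edges(2)[OF surface_squaresI(1)[of i g j k]] ijk by (simp add: add.commute)
    next
      case 4 then show ?thesis using square_edges(3)[OF surface_squaresI(1)[of "2 * g" g j k]] ijk by (simp add: add.commute)
    qed
  qed
  show "{(real i, real j, 0), (real i, real j, 1)} \<in> edges_of (surface_triangles g)"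
    if ijk: "i \<le> 2 * g + 1" "j \<le> 3"
  proof -
    consider "j = 1" | "j = 2" | "j = 0 \<or> j = 3" "i \<le> 2 * g" | "j = 0 \<or> j = 3" "i = Suc (2 * g)" using ijk by linarith
    then show ?thesis
    proof cases
      case 1 then show ?thesis using square_edges(2)[OF surface_squaresI(3)[of i g 1]] ijk by simp
    next
      case 2 then show ?thesis using square_edges(3)[OF surface_squaresI(3)[of i g 1]] ijk by simp
    next
      case 3 then show ?thesis using square_edges(2)[OF surface_squaresI(2)[of i g j]] ijk by auto
    next
      case 4 then show ?thesis using square_edges(3)[OF surface_squaresI(2)[of "2 * g" g j]] ijk by (auto simp: add.commute)
    qed
  qed
qed

text \<open>The eight points of a layer of the grid, listed along a Hamiltonian path of the layer.\<close>

definition grid_point :: "nat \<Rightarrow> nat \<Rightarrow> pt" where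
  "grid_point i l = (real i, real (l div 2), if l mod 4 = 1 \<or> l mod 4 = 2 then 0 else 1)"

lemma less_8_cases:
  assumes "l < (8::nat)"
  obtains "l = 0" | "l = 1" | "l = 2" | "l = 3" | "l = 4" | "l = 5" | "l = 6" | "l = 7"
  using assms by linarith

lemma grid_point_simps:
  "grid_point i 0 = (real i, 0, 1)" "grid_point i (Suc 0) = (real i, 0, 0)" "grid_point i 1 = (real i, 0, 0)" "grid_point i 2 = (real i, 1, 0)"
  "grid_point i 3 = (real i, 1, 1)" "grid_point i 4 = (real i, 2, 1)" "grid_point i 5 = (real i, 2, 0)"
  "grid_point i 6 = (real i, 3, 0)" "grid_point i 7 = (real i, 3, 1)"
  unfolding grid_point_def by simp_all

lemma grid_point_eq_iff:
  assumes "l < 8" "l' < 8"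
  shows "grid_point i l = grid_point i' l' \<longleftrightarrow> i = i' \<and> l = l'"
proof
  assume "grid_point i l = grid_point i' l'"
  then have eq: "i = i'" "l div 2 = l' div 2" "(l mod 4 = 1 \<or> l mod 4 = 2) = (l' mod 4 = 1 \<or> l' mod 4 = 2)"
    unfolding grid_point_def by (auto split: if_splits)
  have "l = l'"
    using eq(2,3) by (rule_tac less_8_cases[OF assms(1)]; rule_tac less_8_cases[OF assms(2)]; simp)
  then show "i = i' \<and> l = l'" using eq(1) by blast
qed simp

lemma surface_vertices: "\<Union>(surface_triangles g) = {grid_point i l | i l. i \<le> 2 * g + 1 \<and> l < 8}"
proof
  have *: "(real i, real j, real k) \<in> {grid_point i l | i l. i \<le> 2 * g + 1 \<and> l < 8}"
    if "i \<le> 2 * g + 1" "j \<le> 3" "k \<le> 1" for i j k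
  proof -
    have "\<exists>l<8. (real i, real j, real k) = grid_point i l"
    proof -
      have "j \<in> {0, 1, 2, 3}" "k \<in> {0, 1}" using that by auto
      then consider "(j, k) = (0, 1)" | "(j, k) = (0, 0)" | "(j, k) = (1, 0)" | "(j, k) = (1, 1)"
        | "(j, k) = (2, 1)" | "(j, k) = (2, 0)" | "(j, k) = (3, 0)" | "(j, k) = (3, 1)" by auto
      then show ?thesis
      proof cases
        case 1 then show ?thesis by (intro exI[of _ 0]) (simp add: grid_point_simps)
      next
        case 2 then show ?thesis by (intro exI[of _ 1]) (simp add: grid_point_simps)
      next
        case 3 then show ?thesis by (intro exI[of _ 2]) (simp add: grid_point_simps)
      next
        case 4 then show ?thesis by (intro exI[of _ 3]) (simp add: grid_point_simps)
      next
        case 5 then show ?thesis by (intro exI[of _ 4]) (simp add: grid_point_simps)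
      next
        case 6 then show ?thesis by (intro exI[of _ 5]) (simp add: grid_point_simps)
      next
        case 7 then show ?thesis by (intro exI[of _ 6]) (simp add: grid_point_simps)
      next
        case 8 then show ?thesis by (intro exI[of _ 7]) (simp add: grid_point_simps)
      qed
    qed
    then show ?thesis using that by blast
  qed
  show "\<Union>(surface_triangles g) \<subseteq> {grid_point i l | i l. i \<le> 2 * g + 1 \<and> l < 8}"
  proof
    fix p assume "p \<in> \<Union>(surface_triangles g)"
    then obtain b d e where bde: "(b, d, e) \<in> surface_squares g" "p \<in> {b, b + d, b + e, b + d + e}"
      unfolding surface_triangles_def by blast
    from bde(1) consider (XY) i j k where "b = (real i, real j, real k)" "d = (1, 0, 0)" "e = (0, 1, 0)"
        "i \<le> 2 * g" "j \<le> 2" "k \<le> 1"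
      | (XZ) i j where "b = (real i, real j, real 0)" "d = (1, 0, 0)" "e = (0, 0, 1)" "i \<le> 2 * g" "j \<le> 3"
      | (YZ) i j where "b = (real i, real j, real 0)" "d = (0, 1, 0)" "e = (0, 0, 1)" "i \<le> 2 * g + 1" "j \<le> 2"
      unfolding surface_squares_def of_nat_0 by blast
    moreover have coord: "\<exists>i j k. p = (real i, real j, real k) \<and> i \<le> 2 * g + 1 \<and> j \<le> 3 \<and> k \<le> 1"
      if "p = (real i, real j, real k)" "i \<le> 2 * g + 1" "j \<le> 3" "k \<le> 1" for i j k
      using that by blast
    ultimately have "\<exists>i j k. p = (real i, real j, real k) \<and> i \<le> 2 * g + 1 \<and> j \<le> 3 \<and> k \<le> 1"
    proof cases
      case XY
      then have "p \<in> {(real i, real j, real k), (real (Suc i), real j, real k),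
          (real i, real (Suc j), real k), (real (Suc i), real (Suc j), real k)}" using bde(2) by (simp add: add.commute)
      then show ?thesis using XY(4-6) by (elim insertE emptyE) (erule coord; simp)+
    next
      case XZ
      then have "p \<in> {(real i, real j, real 0), (real (Suc i), real j, real 0),
          (real i, real j, real 1), (real (Suc i), real j, real 1)}" using bde(2) by (simp add: add.commute)
      then show ?thesis using XZ(4,5) by (elim insertE emptyE) (erule coord; simp)+
    next
      case YZ
      then have "p \<in> {(real i, real j, real 0), (real i, real (Suc j), real 0),
          (real i, real j, real 1), (real i, real (Suc j), real 1)}" using bde(2) by (simp add: add.commute)
      then show ?thesis using YZ(4,5) by (elim insertE emptyE) (erule coord; simp)+
    qed
    then show "p \<in> {grid_point i l | i l. i \<le> 2 * g + 1 \<and> l < 8}" using * by blast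
  qed
  show "{grid_point i l | i l. i \<le> 2 * g + 1 \<and> l < 8} \<subseteq> \<Union>(surface_triangles g)"
  proof
    fix p assume "p \<in> {grid_point i l | i l. i \<le> 2 * g + 1 \<and> l < 8}"
    then obtain i l where il: "p = grid_point i l" "i \<le> 2 * g + 1" "l < 8" by blast
    define j where "j = l div 2"
    obtain k where k: "p = (real i, real j, real k)" "k \<le> 1"
    proof (cases "l mod 4 = 1 \<or> l mod 4 = 2")
      case True
      then show ?thesis using that[of 0] by (simp add: il(1) grid_point_def j_def)
    next
      case False
      then show ?thesis using that[of 1] by (simp add: il(1) grid_point_def j_def)
    qed
    have "l div 2 \<le> 3" using il(3) by linarith
    then have j: "j \<le> 3" unfolding j_def .
    have "{(real i, real j, 0), (real i, real j, 1)} \<in> edges_of (surface_triangles g)"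
      by (rule grid_edges(3)[OF il(2) j])
    moreover have "p \<in> {(real i, real j, 0), (real i, real j, 1)}" using k by (cases k) auto
    ultimately show "p \<in> \<Union>(surface_triangles g)" by (auto elim!: edges_ofE simp: doubleton_eq_iff)
  qed
qed

lemma grid_point_edges:
  shows "i \<le> 2 * g \<Longrightarrow> l < 8 \<Longrightarrow> {grid_point i l, grid_point (Suc i) l} \<in> edges_of (surface_triangles g)"
    and "i \<le> 2 * g + 1 \<Longrightarrow> l < 7 \<Longrightarrow> {grid_point i l, grid_point i (Suc l)} \<in> edges_of (surface_triangles g)"
proof -
  show "{grid_point i l, grid_point (Suc i) l} \<in> edges_of (surface_triangles g)" if "i \<le> 2 * g" "l < 8"
  proof -
    have "l div 2 \<le> 3" using that(2) by linarith
    then show ?thesis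
      using grid_edges(1)[OF that(1), of "l div 2" 0] grid_edges(1)[OF that(1), of "l div 2" 1]
      unfolding grid_point_def by auto
  qed
  show "{grid_point i l, grid_point i (Suc l)} \<in> edges_of (surface_triangles g)" if il: "i \<le> 2 * g + 1" "l < 7"
  proof -
    note z = grid_edges(3)[OF il(1)] and y = grid_edges(2)[OF il(1)]
    consider "l = 0" | "l = 1" | "l = 2" | "l = 3" | "l = 4" | "l = 5" | "l = 6" using il(2) by linarith
    then show ?thesis
    proof cases
      case 1 then show ?thesis using z[of 0] by (simp add: grid_point_simps insert_commute)
    next
      case 2 then show ?thesis using y[of 0 0] by (simp add: grid_point_def insert_commute)
    next
      case 3 then show ?thesis using z[of 1] by (simp add: grid_point_def insert_commute)
    next
      case 4 then show ?thesis using y[of 1 1] by (simp add: grid_point_def insert_commute)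
    next
      case 5 then show ?thesis using z[of 2] by (simp add: grid_point_def insert_commute)
    next
      case 6 then show ?thesis using y[of 2 0] by (simp add: grid_point_def insert_commute)
    next
      case 7 then show ?thesis using z[of 3] by (simp add: grid_point_def insert_commute)
    qed
  qed
qed

text \<open>The chosen square lies in the outer wall \<open>x = 0\<close>, which no tunnel touches,
  so it is there for every \<open>g\<close>. Its diagonal joins \<open>grid_point 0 1\<close> to
  \<open>grid_point 0 3\<close>.\<close>

lemma corner_triangles:
  "{grid_point 0 1, grid_point 0 3, grid_point 0 2} \<in> surface_triangles g" "{grid_point 0 1, grid_point 0 3, grid_point 0 0} \<in> surface_triangles g"
proof -
  have sq: "((real 0, real 0, 0), (0, 1, 0), (0, 0, 1)) \<in> surface_squares g"
    by (rule surface_squaresI(3)) auto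
  have "{grid_point 0 1, grid_point 0 3, grid_point 0 2} = {(real 0, real 0, 0), (real 0, real 0, 0) + (0, 1, 0), (real 0, real 0, 0) + (0, 1, 0) + (0, 0, 1)}"
    by (auto simp: grid_point_simps)
  then show "{grid_point 0 1, grid_point 0 3, grid_point 0 2} \<in> surface_triangles g" unfolding surface_triangles_def using sq by blast
  have "{grid_point 0 1, grid_point 0 3, grid_point 0 0} = {(real 0, real 0, 0), (real 0, real 0, 0) + (0, 0, 1), (real 0, real 0, 0) + (0, 1, 0) + (0, 0, 1)}"
    by (auto simp: grid_point_simps)
  then show "{grid_point 0 1, grid_point 0 3, grid_point 0 0} \<in> surface_triangles g" unfolding surface_triangles_def using sq by blast
qed

definition up_row :: "nat \<Rightarrow> nat \<Rightarrow> pt list" where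
  "up_row g l = map (\<lambda>i. grid_point i l) [1..<2 * g + 2]"

text \<open>A snake through all grid points except \<open>grid_point 0 1\<close>,
  \<open>grid_point 0 2\<close> and \<open>grid_point 0 3\<close>, running through the rows beyond
  layer 0 alternately forward and backward. It starts next to \<open>grid_point 0 3\<close> and ends
  at \<open>grid_point 0 0\<close>, the tip of the last fan, so that a Hamiltonian cycle can go on
  from there.\<close>

definition base_path :: "nat \<Rightarrow> pt list" where
  "base_path g = map (grid_point 0) [4, 5, 6, 7] @ up_row g 7 @ rev (up_row g 6) @ up_row g 5 @ rev (up_row g 4) @
     up_row g 3 @ rev (up_row g 2) @ up_row g 1 @ rev (up_row g 0) @ [grid_point 0 0]"

abbreviation adjacent :: "'a set set \<Rightarrow> 'a \<Rightarrow> 'a \<Rightarrow> bool" where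
  "adjacent E u v \<equiv> {u, v} \<in> E"

lemma successively_upt:
  assumes "\<And>i. m \<le> i \<Longrightarrow> Suc i < n \<Longrightarrow> P (f i) (f (Suc i))"
  shows "successively P (map f [m..<n])"
  unfolding successively_conv_nth using assms by auto

lemma successively_adjacent_rev:
  "successively (adjacent E) xs \<Longrightarrow> successively (adjacent E) (rev xs)"
  by (simp add: insert_commute)

lemma up_row_simps:
  "up_row g l \<noteq> []" "hd (up_row g l) = grid_point 1 l" "last (up_row g l) = grid_point (2 * g + 1) l"
  "set (up_row g l) = (\<lambda>i. grid_point i l) ` {1..2 * g + 1}"
proof -
  have "set [1..<2 * g + 2] = {1..2 * g + 1}" by auto
  then show "set (up_row g l) = (\<lambda>i. grid_point i l) ` {1..2 * g + 1}" unfolding up_row_def by (simp only: set_map)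
  have upt: "[1..<2 * g + 2] = [1..<2 * g + 1] @ [2 * g + 1]" using upt_Suc_append[of 1 "2 * g + 1"] by simp
  show "last (up_row g l) = grid_point (2 * g + 1) l" unfolding up_row_def upt by (simp del: upt_Suc)
qed (simp_all add: up_row_def hd_map del: upt_Suc)

lemma base_path_simps:
  "base_path g \<noteq> []" "hd (base_path g) = grid_point 0 4" "last (base_path g) = grid_point 0 0"
  unfolding base_path_def by simp_all

lemma distinct_base_path: "distinct (base_path g)"
proof -
  have d: "distinct (up_row g l)" for l
    unfolding up_row_def distinct_map by (simp add: inj_on_def grid_point_def)
  show ?thesis unfolding base_path_def
    by (auto simp: d up_row_simps(4) grid_point_eq_iff)
qed

lemma set_base_path: "\<Union>(surface_triangles g) = set (base_path g) \<union> {grid_point 0 1, grid_point 0 2, grid_point 0 3}"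
proof -
  have "\<Union>(surface_triangles g) = (\<Union>l<8. (\<lambda>i. grid_point i l) ` {..2 * g + 1})"
    unfolding surface_vertices by auto
  also have "{..2 * g + 1} = insert 0 {1..2 * g + 1}" by auto
  also have "{..<8} = {0, 1, 2, 3, 4, 5, 6, 7::nat}" by auto
  finally show ?thesis unfolding base_path_def by (simp add: up_row_simps(4)) blast
qed

lemma corner_notin_base_path:
  "grid_point 0 1 \<notin> set (base_path g)" "grid_point 0 2 \<notin> set (base_path g)" "grid_point 0 3 \<notin> set (base_path g)"
  unfolding base_path_def by (auto simp: up_row_simps(4) grid_point_eq_iff)

lemma successively_base_path: "successively (adjacent (edges_of (surface_triangles g))) (base_path g)"
proof -
  let ?E = "edges_of (surface_triangles g)"
  have row: "successively (adjacent ?E) (up_row g l)" if "l < 8" for l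
    unfolding up_row_def using that by (intro successively_upt grid_point_edges(1)) auto
  note rrow = successively_adjacent_rev[OF row]
  have layer: "{grid_point i l, grid_point i (Suc l)} \<in> ?E" "{grid_point i (Suc l), grid_point i l} \<in> ?E" if "i \<le> 2 * g + 1" "l < 7" for i l
    using grid_point_edges(2)[OF that] by (simp_all add: insert_commute)
  have L: "{grid_point i 4, grid_point i 5} \<in> ?E" "{grid_point i 5, grid_point i 6} \<in> ?E" "{grid_point i 6, grid_point i 7} \<in> ?E"
    "{grid_point i 7, grid_point i 6} \<in> ?E" "{grid_point i 6, grid_point i 5} \<in> ?E" "{grid_point i 5, grid_point i 4} \<in> ?E" "{grid_point i 4, grid_point i 3} \<in> ?E"
    "{grid_point i 3, grid_point i 2} \<in> ?E" "{grid_point i 2, grid_point i 1} \<in> ?E" "{grid_point i 1, grid_point i 0} \<in> ?E" if "i \<le> 2 * g + 1" for i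
    using layer[OF that, of 4] layer[OF that, of 5] layer[OF that, of 6] layer[OF that, of 3]
      layer[OF that, of 2] layer[OF that, of 1] layer[OF that, of 0] by (simp_all flip: numeral_2_eq_2)
  have x: "{grid_point 0 7, grid_point 1 7} \<in> ?E" "{grid_point 1 0, grid_point 0 0} \<in> ?E"
    using grid_point_edges(1)[of 0 g 7] grid_point_edges(1)[of 0 g 0] by (simp_all add: insert_commute)
  show ?thesis
    unfolding base_path_def
    by (simp add: successively_append_iff successively_Cons row rrow up_row_simps hd_rev last_rev L x del: successively_rev One_nat_def)
qed

subsection \<open>Long cycles in a graph with four fans\<close>

abbreviation cut_edges :: "'a set set \<Rightarrow> 'a set \<Rightarrow> 'a set set" where
  "cut_edges F A \<equiv> {e \<in> F. e \<inter> A \<noteq> {} \<and> \<not> e \<subseteq> A}"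

lemma Suc_mod_inj:
  assumes "i < n" "j < n" "Suc i mod n = Suc j mod n"
  shows "i = j"
  using assms by (auto simp: mod_Suc split: if_splits)

text \<open>A vertex occurs at one position only, so it starts at most one edge and ends at most
  one.\<close>

lemma cycle_degree:
  assumes "distinct p"
  shows "card {e \<in> cycle_edges p. v \<in> e} \<le> 2"
proof -
  let ?n = "length p"
  let ?e = "\<lambda>i. {p ! i, p ! (Suc i mod ?n)}"
  let ?A = "{i. i < ?n \<and> p ! i = v}" and ?B = "{i. i < ?n \<and> p ! (Suc i mod ?n) = v}"
  have "card ?A \<le> Suc 0"
    using assms by (subst card_le_Suc0_iff_eq) (auto simp: nth_eq_iff_index_eq)
  moreover have "card ?B \<le> Suc 0"
  proof (subst card_le_Suc0_iff_eq)
    show "\<forall>i\<in>?B. \<forall>j\<in>?B. i = j"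
    proof (intro ballI)
      fix i j assume ij: "i \<in> ?B" "j \<in> ?B"
      have "Suc i mod ?n < ?n" "Suc j mod ?n < ?n"
        using ij by (intro mod_less_divisor; auto)+
      then have "Suc i mod ?n = Suc j mod ?n" using assms ij by (simp add: nth_eq_iff_index_eq[symmetric])
      then show "i = j" using Suc_mod_inj ij by blast
    qed
  qed simp
  moreover have "card {e \<in> cycle_edges p. v \<in> e} \<le> card (?e ` (?A \<union> ?B))"
    by (rule card_mono) (auto simp: cycle_edges_def)
  moreover have "card (?e ` (?A \<union> ?B)) \<le> card (?A \<union> ?B)" by (rule card_image_le) simp
  moreover have "card (?A \<union> ?B) \<le> card ?A + card ?B" by (rule card_Un_le)
  ultimately show ?thesis by linarith
qed

lemma cyclic_exit:
  assumes "i < n" "P i" "j < n" "\<not> P j"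
  shows "\<exists>k<n. P k \<and> \<not> P (Suc k mod n)"
proof (rule ccontr)
  assume "\<not> ?thesis"
  then have step: "P (Suc k mod n)" if "k < n" "P k" for k using that by blast
  have "P ((i + k) mod n)" for k
  proof (induction k)
    case 0 then show ?case using assms by simp
  next
    case (Suc k)
    have "P (Suc ((i + k) mod n) mod n)" by (rule step) (use Suc assms in auto)
    then show ?case by (simp add: mod_Suc_eq)
  qed
  \<comment> \<open>So many steps lead from \<open>i\<close> to \<open>j\<close> modulo
    \<open>n\<close>; adding \<open>n\<close> keeps the subtraction of naturals exact when
    \<open>j < i\<close>.\<close>
  from this[of "n + j - i"] have "P ((n + j) mod n)" using assms by simp
  then show False using assms by simp
qed

text \<open>The cycle leaves \<open>A\<close> and also leaves its complement, and each exit is a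
  crossing edge. The two could coincide only if two steps led back to the start, against length at
  least 3.\<close>

lemma cycle_cut:
  assumes "is_cycle E p" "x \<in> set p" "x \<in> A" "y \<in> set p" "y \<notin> A"
  shows "2 \<le> card (cut_edges (cycle_edges p) A)"
proof -
  let ?n = "length p"
  let ?e = "\<lambda>i. {p ! i, p ! (Suc i mod ?n)}"
  have n: "3 \<le> ?n" and dist: "distinct p" using assms(1) unfolding is_cycle_def by auto
  obtain i0 where i0: "i0 < ?n" "p ! i0 \<in> A" using assms(2,3) by (metis in_set_conv_nth)
  obtain j0 where j0: "j0 < ?n" "p ! j0 \<notin> A" using assms(4,5) by (metis in_set_conv_nth)
  obtain i where i: "i < ?n" "p ! i \<in> A" "p ! (Suc i mod ?n) \<notin> A"
    using cyclic_exit[of i0 ?n "\<lambda>k. p ! k \<in> A" j0] i0 j0 by blast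
  obtain j where j: "j < ?n" "p ! j \<notin> A" "p ! (Suc j mod ?n) \<in> A"
    using cyclic_exit[of j0 ?n "\<lambda>k. p ! k \<notin> A" i0] i0 j0 by blast
  have "?e i \<noteq> ?e j"
  proof
    assume "?e i = ?e j"
    then have "p ! i = p ! (Suc j mod ?n)" "p ! j = p ! (Suc i mod ?n)"
      using i j unfolding doubleton_eq_iff by auto
    moreover have "Suc i mod ?n < ?n" "Suc j mod ?n < ?n"
      using i(1) by (intro mod_less_divisor; linarith)+
    ultimately have "i = Suc j mod ?n" "j = Suc i mod ?n"
      using dist i(1) j(1) by (simp_all add: nth_eq_iff_index_eq)
    then have i2: "Suc (Suc i mod ?n) mod ?n = i" by metis
    consider "Suc (Suc i) < ?n" | "Suc (Suc i) = ?n" | "Suc i = ?n" using i(1) by linarith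
    then show False using i2 n by cases auto
  qed
  then have "card {?e i, ?e j} = 2" by simp
  moreover have "{?e i, ?e j} \<subseteq> cut_edges (cycle_edges p) A"
    using i j unfolding cycle_edges_def by auto
  moreover have "finite (cut_edges (cycle_edges p) A)" unfolding cycle_edges_image by simp
  ultimately show ?thesis using card_mono[of "cut_edges (cycle_edges p) A" "{?e i, ?e j}"] by simp
qed

lemma Union_cycle_edges: "\<Union>(cycle_edges p) = set p"
proof
  show "\<Union>(cycle_edges p) \<subseteq> set p"
  proof
    fix v assume "v \<in> \<Union>(cycle_edges p)"
    then obtain i where i: "i < length p" "v = p ! i \<or> v = p ! (Suc i mod length p)"
      unfolding cycle_edges_def by auto
    moreover have "Suc i mod length p < length p" using i(1) by (intro mod_less_divisor) linarith
    ultimately show "v \<in> set p" by auto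
  qed
  show "set p \<subseteq> \<Union>(cycle_edges p)" 
  proof
    fix v assume "v \<in> set p"
    then obtain i where i: "i < length p" "v = p ! i" by (auto simp: in_set_conv_nth)
    then have "{p ! i, p ! (Suc i mod length p)} \<in> cycle_edges p" unfolding cycle_edges_def by blast
    then show "v \<in> \<Union>(cycle_edges p)" using i(2) by blast
  qed
qed

lemma card_cycle_edge:
  assumes "is_cycle E p" "e \<in> cycle_edges p"
  shows "card e = 2"
proof -
  obtain i where i: "i < length p" "e = {p ! i, p ! (Suc i mod length p)}"
    using assms(2) unfolding cycle_edges_def by blast
  have "Suc i mod length p \<noteq> i" using assms(1) i(1) unfolding is_cycle_def by (auto simp: mod_Suc)
  moreover have "Suc i mod length p < length p" using i(1) by (intro mod_less_divisor) linarith
  ultimately have "p ! i \<noteq> p ! (Suc i mod length p)"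
    using assms(1) i(1) unfolding is_cycle_def by (simp add: nth_eq_iff_index_eq)
  then show ?thesis using i(2) by simp
qed

section \<open>Graphs with four fans\<close>

text \<open>A core graph on \<open>U\<close> with four fans. Fan \<open>i\<close> is the path \<open>x i 0, x i 1, \<dots>\<close>, all of it joined
  to the two hubs \<open>p i\<close> and \<open>q i\<close>, with \<open>x i 0\<close> also joined to the tip \<open>r i\<close>. Removing the four
  vertices \<open>a, b, c, d\<close> separates the fans from each other, the last one keeping the rest of the core.\<close>

locale four_fans =
  fixes E :: "'a set set" and U :: "'a set" and a b c d y :: 'a
    and p q r :: "nat \<Rightarrow> 'a" and x :: "nat \<Rightarrow> nat \<Rightarrow> 'a" and M :: "nat \<Rightarrow> nat" and m :: nat
  assumes U: "finite U" "{a, b, c, d} \<subseteq> U" "distinct [a, b, c, d]" "y \<in> U - {a, b, c, d}"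
    and hubs: "p 0 = a" "q 0 = b" "p 1 = c" "q 1 = d" "p 2 = c" "q 2 = d" "p 3 = a" "q 3 = b"
    and tips: "r 0 = d" "r 1 = a" "r 2 = b" "r 3 = y"
    and x_inj: "\<And>i i' j j'. i < 4 \<Longrightarrow> i' < 4 \<Longrightarrow> j < M i \<Longrightarrow> j' < M i' \<Longrightarrow> x i j = x i' j' \<Longrightarrow> i = i' \<and> j = j'"
    and x_U: "\<And>i j. i < 4 \<Longrightarrow> j < M i \<Longrightarrow> x i j \<notin> U"
    and M: "M 0 = m" "M 1 = m" "M 2 = m" "M 3 + card U = m + 4"
    and E: "\<And>e. e \<in> E \<Longrightarrow> e \<subseteq> U \<or> (\<exists>i<4. e \<in> fan_edges (p i) (q i) (r i) (x i) (M i))"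
begin

abbreviation "S \<equiv> {a, b, c, d}"
abbreviation "X i \<equiv> x i ` {..<M i}"
definition "P i = (if i = 3 then X 3 \<union> (U - S) else X i)"
definition "V = U \<union> (\<Union>i<4. X i)"

lemma less4: "i < 4 \<longleftrightarrow> i = 0 \<or> i = 1 \<or> i = 2 \<or> i = (3::nat)"
  by linarith

lemma pq: "i < 4 \<Longrightarrow> p i \<in> S" "i < 4 \<Longrightarrow> q i \<in> S" "i < 4 \<Longrightarrow> p i \<in> U" "i < 4 \<Longrightarrow> q i \<in> U" "i < 4 \<Longrightarrow> r i \<in> U"
  using hubs tips U(2,4) unfolding less4 by auto

lemma r_S: "i < 3 \<Longrightarrow> r i \<in> S"
  using tips less4[of i] by auto

lemma card_X: "i < 4 \<Longrightarrow> card (X i) = M i"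
  by (subst card_image) (auto simp: inj_on_def dest: x_inj)

lemma X_disjoint: "i < 4 \<Longrightarrow> i' < 4 \<Longrightarrow> i \<noteq> i' \<Longrightarrow> X i \<inter> X i' = {}"
  by (auto dest: x_inj)

lemma X_U: "i < 4 \<Longrightarrow> X i \<inter> U = {}"
  using x_U by auto

lemma P_disjoint: "i < 4 \<Longrightarrow> i' < 4 \<Longrightarrow> i \<noteq> i' \<Longrightarrow> P i \<inter> P i' = {}"
  using X_disjoint[of i i'] X_U[of i] X_U[of i'] unfolding P_def by auto

lemma P_S: "i < 4 \<Longrightarrow> P i \<inter> S = {}"
  using X_U[of i] U(2) unfolding P_def by auto

lemma X_P: "X i \<subseteq> P i" unfolding P_def by auto

lemma P_V: "i < 4 \<Longrightarrow> P i \<subseteq> V" unfolding P_def V_def by auto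

lemma card_S: "card S = 4" using U(3) by auto

text \<open>For \<open>i = 3\<close>, the equation for \<open>M 3\<close> makes up for the
  \<open>card U - 4\<close> core vertices in the piece.\<close>

lemma card_P: "i < 4 \<Longrightarrow> card (P i) = m"
proof -
  assume i: "i < 4"
  show ?thesis
  proof (cases "i = 3")
    case True
    have "card (X 3 \<union> (U - S)) = card (X 3) + card (U - S)"
      by (rule card_Un_disjoint) (use X_U[of 3] U(1) in auto)
    moreover have "card (U - S) = card U - 4" using card_Diff_subset[of S U] U(2) card_S by simp
    moreover have "4 \<le> card U" using card_mono[OF U(1,2)] card_S by simp
    ultimately show ?thesis using M(4) card_X[of 3] True unfolding P_def by simp
  next
    case False
    then show ?thesis using i M card_X[of i] less4[of i] unfolding P_def by auto
  qed
qed

lemma card_V: "card V = card U + (\<Sum>i<4. M i)" "card V = 4 * m + 4"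
proof -
  have "card (\<Union>i<4. X i) = (\<Sum>i<4. card (X i))"
    by (rule card_UN_disjoint) (use X_disjoint in auto)
  also have "\<dots> = (\<Sum>i<4. M i)" using card_X by (intro sum.cong) auto
  finally have "card (\<Union>i<4. X i) = (\<Sum>i<4. M i)" .
  moreover have "card V = card U + card (\<Union>i<4. X i)"
    unfolding V_def by (rule card_Un_disjoint) (use U(1) X_U in auto)
  ultimately show "card V = card U + (\<Sum>i<4. M i)" by simp
  then show "card V = 4 * m + 4" using M by (simp add: eval_nat_numeral)
qed

lemma finite_V: "finite V" unfolding V_def using U(1) by simp

lemma fan_edge_cases:
  assumes "e \<in> E" "i < 4" "e \<inter> X i \<noteq> {}"
  obtains j where "j < M i" "e = {x i j, p i}" | j where "j < M i" "e = {x i j, q i}"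
    | "0 < M i" "e = {x i 0, r i}" | j where "Suc j < M i" "e = {x i (Suc j), x i j}"
proof -
  obtain i' where i': "i' < 4" "e \<in> fan_edges (p i') (q i') (r i') (x i') (M i')"
    using E[OF assms(1)] X_U[OF assms(2)] assms(3) by blast
  then obtain j where j: "j < M i'" "e \<in> {{x i' j, p i'}, {x i' j, q i'}, {x i' j, if j = 0 then r i' else x i' (j - 1)}}"
    unfolding fan_edges_def by blast
  have "e \<subseteq> X i' \<union> U" using j pq(3-5)[OF i'(1)] by auto
  then have "i' = i" using X_disjoint[OF assms(2) i'(1)] X_U[OF assms(2)] assms(3) by blast
  then show ?thesis using j that by (cases j) auto
qed

text \<open>Fan edges leave their fan only towards a hub or a tip, and these lie in \<open>S\<close>
  with one exception: the tip of fan 3 is \<open>y\<close>, which belongs to the same piece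
  \<open>P 3\<close>.\<close>

lemma cut_P:
  assumes "e \<in> E" "i < 4" "e \<inter> P i \<noteq> {}" "\<not> e \<subseteq> P i"
  shows "e \<inter> S \<noteq> {}"
proof (cases "e \<inter> X i = {}")
  case False
  from assms(1,2) False show ?thesis
  proof (cases rule: fan_edge_cases)
    case (1 j) then show ?thesis using pq(1)[OF assms(2)] by auto
  next
    case (2 j) then show ?thesis using pq(2)[OF assms(2)] by auto
  next
    case 3
    show ?thesis
    proof (cases "i = 3")
      case True
      then have "e \<subseteq> P i" using 3 tips(4) U(4) unfolding P_def by auto
      then show ?thesis using assms(4) by blast
    next
      case False
      then show ?thesis using r_S[of i] assms(2) 3 by auto
    qed
  next
    case (4 j)
    then have "e \<subseteq> X i" by auto
    then show ?thesis using X_P assms(4) by blast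
  qed
next
  case True
  then have i: "i = 3" "e \<inter> (U - S) \<noteq> {}" using assms(3) unfolding P_def by (auto split: if_splits)
  show ?thesis
  proof (cases "e \<subseteq> U")
    case True
    then show ?thesis using assms(4) i unfolding P_def by auto
  next
    case False
    then obtain i' j where j: "i' < 4" "j < M i'" "e \<in> {{x i' j, p i'}, {x i' j, q i'}, {x i' j, if j = 0 then r i' else x i' (j - 1)}}"
      using E[OF assms(1)] unfolding fan_edges_def by blast
    have "j - 1 < M i'" using j by linarith
    then have sub: "e \<subseteq> X i' \<union> {p i', q i', r i'}" using j(2,3) by auto
    have "e \<inter> (U - S) = {}" if "i' \<noteq> 3"
    proof -
      have "r i' \<in> S" using r_S[of i'] j(1) that by simp
      then show ?thesis using sub pq(1,2)[OF j(1)] X_U[OF j(1)] by blast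
    qed
    then have "i' = 3" using i(2) by blast
    then have "x i j \<in> e \<inter> X i" using j i(1) by auto
    then show ?thesis using \<open>e \<inter> X i = {}\<close> by blast
  qed
qed

end

context four_fans
begin

text \<open>Rebuilds the edge set of a cycle from little data: its edges \<open>A\<close> inside the
  core, the numbers \<open>g i\<close> and \<open>h i\<close> of vertices missed at the two ends of
  fan \<open>i\<close>, and in \<open>R i\<close> the core neighbours of the two ends of the visited
  interval.\<close>

definition decode :: "'a set set \<Rightarrow> (nat \<Rightarrow> 'a set \<times> 'a set) \<Rightarrow> (nat \<Rightarrow> nat) \<Rightarrow> (nat \<Rightarrow> nat) \<Rightarrow> 'a set set" where
  "decode A R g h = A \<union> (\<Union>i<4. {{x i (Suc j), x i j} | j. g i \<le> j \<and> Suc j < M i - h i} \<union>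
     {{x i (g i), u} | u. u \<in> fst (R i)} \<union> {{x i (M i - h i - 1), u} | u. u \<in> snd (R i)})"

lemma E_V:
  assumes "e \<in> E"
  shows "e \<subseteq> V"
proof (cases "e \<subseteq> U")
  case False
  then obtain i j where j: "i < 4" "j < M i" "e \<in> {{x i j, p i}, {x i j, q i}, {x i j, if j = 0 then r i else x i (j - 1)}}"
    using E[OF assms] unfolding fan_edges_def by blast
  have "j - 1 < M i" using j(2) by linarith
  then have "e \<subseteq> X i \<union> U" using j pq(3-5)[OF j(1)] by auto
  then show ?thesis using j(1) unfolding V_def by blast
qed (auto simp: V_def)

end

section \<open>The trace of a long cycle on the fans\<close>

text \<open>Of a cycle, only its edge set \<open>F\<close> and vertex set \<open>Z\<close> are kept,
  with the degree bound and the two crossing edges of every cut; the cyclic order is forgotten. The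
  last assumption says that fewer than \<open>m\<close> vertices are missed.\<close>

locale long_cycle = four_fans +
  fixes F :: "'a set set" and Z :: "'a set"
  assumes F: "F \<subseteq> E" "finite F" "\<Union>F = Z" "\<And>e. e \<in> F \<Longrightarrow> card e = 2"
    and deg: "\<And>v. card {e \<in> F. v \<in> e} \<le> 2"
    and cut: "\<And>A. A \<inter> Z \<noteq> {} \<Longrightarrow> Z - A \<noteq> {} \<Longrightarrow> 2 \<le> card (cut_edges F A)"
    and Z: "Z \<subseteq> V" "card V < card Z + m"
begin

lemma edge_two: "e \<in> F \<Longrightarrow> u \<in> e \<Longrightarrow> v \<in> e \<Longrightarrow> w \<in> e \<Longrightarrow> u = v \<or> u = w \<or> v = w"
  using F(4)[of e] by (auto simp: card_2_iff)

lemma Z_P: "i < 4 \<Longrightarrow> Z \<inter> P i \<noteq> {}"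
proof
  assume i: "i < 4" and "Z \<inter> P i = {}"
  then have "Z \<subseteq> V - P i" using Z by blast
  then have "card Z \<le> card (V - P i)" using finite_V by (intro card_mono) auto
  also have "\<dots> = card V - m"
    using card_Diff_subset[OF finite_subset[OF P_V[OF i] finite_V] P_V[OF i]] card_P[OF i] by simp
  finally have "card Z \<le> card V - m" .
  moreover have "m \<le> card V" using card_V(2) by simp
  ultimately show False using Z(2) by simp
qed

lemma Z_diff_P: "i < 4 \<Longrightarrow> Z - P i \<noteq> {}"
proof -
  assume i: "i < 4"
  define j where "j = (if i = 0 then 1 else 0::nat)"
  have "j < 4" "j \<noteq> i" unfolding j_def by auto
  then show ?thesis using Z_P[of j] P_disjoint[of j i] i by blast
qed

text \<open>A common edge would contain a vertex of each piece and, by \<open>cut_P\<close>, one of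
  \<open>S\<close>: three vertices.\<close>

lemma cut_P_disjoint: "i < 4 \<Longrightarrow> j < 4 \<Longrightarrow> i \<noteq> j \<Longrightarrow> cut_edges F (P i) \<inter> cut_edges F (P j) = {}"
proof (rule ccontr)
  assume ij: "i < 4" "j < 4" "i \<noteq> j" and "cut_edges F (P i) \<inter> cut_edges F (P j) \<noteq> {}"
  then obtain e where e: "e \<in> F" "e \<inter> P i \<noteq> {}" "\<not> e \<subseteq> P i" "e \<inter> P j \<noteq> {}" by blast
  have "e \<in> E" using e(1) F(1) by blast
  then obtain s where s: "s \<in> e" "s \<in> S" using cut_P[OF _ ij(1) e(2,3)] by blast
  obtain u where u: "u \<in> e" "u \<in> P i" using e(2) by blast
  obtain v where v: "v \<in> e" "v \<in> P j" using e(4) by blast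
  have "u \<noteq> v" using u v P_disjoint[OF ij] by blast
  moreover have "u \<noteq> s" using u s P_S[OF ij(1)] by blast
  moreover have "v \<noteq> s" using v s P_S[OF ij(2)] by blast
  ultimately show False using edge_two[OF e(1) u(1) v(1) s(1)] by blast
qed

text \<open>The four disjoint cuts have at least two edges each, and all these edges meet
  \<open>S\<close>, whose four vertices have degree at most 2. Eight is thus both a lower and an
  upper bound for the total, which leaves exactly two for every cut.\<close>

lemma card_cut_P: "i < 4 \<Longrightarrow> card (cut_edges F (P i)) = 2"
proof -
  assume i: "i < 4"
  have ge: "2 \<le> card (cut_edges F (P j))" if "j < 4" for j
    using cut[of "P j"] Z_P[OF that] Z_diff_P[OF that] by blast
  have "(\<Sum>j<4. card (cut_edges F (P j))) = card (\<Union>j<4. cut_edges F (P j))"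
    by (rule card_UN_disjoint[symmetric]) (use F(2) cut_P_disjoint in auto)
  also have "\<dots> \<le> card (\<Union>s\<in>S. {e \<in> F. s \<in> e})"
  proof (rule card_mono)
    show "(\<Union>j<4. cut_edges F (P j)) \<subseteq> (\<Union>s\<in>S. {e \<in> F. s \<in> e})"
    proof
      fix e assume "e \<in> (\<Union>j<4. cut_edges F (P j))"
      then obtain j where "j < 4" "e \<in> F" "e \<inter> P j \<noteq> {}" "\<not> e \<subseteq> P j" by blast
      then have "e \<inter> S \<noteq> {}" using cut_P F(1) by blast
      then show "e \<in> (\<Union>s\<in>S. {e \<in> F. s \<in> e})" using \<open>e \<in> F\<close> by blast
    qed
  qed (use F(2) in auto)
  also have "\<dots> \<le> (\<Sum>s\<in>S. card {e \<in> F. s \<in> e})" by (rule card_UN_le) simp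
  also have "\<dots> \<le> of_nat (card S) * 2" by (rule sum_bounded_above) (rule deg)
  finally have "(\<Sum>j<4. card (cut_edges F (P j))) \<le> 8" using card_S by simp
  then have "card (cut_edges F (P 0)) + card (cut_edges F (P 1)) + card (cut_edges F (P 2)) + card (cut_edges F (P 3)) \<le> 8"
    by (simp add: eval_nat_numeral)
  then show ?thesis using ge[of 0] ge[of 1] ge[of 2] ge[of 3] i unfolding less4 by auto
qed

text \<open>An edge leaving the fan also leaves its piece, with the tip edge as the only possible
  exception; hence the bound 2 + 1.\<close>

lemma card_cut_X: "i < 4 \<Longrightarrow> card (cut_edges F (X i)) \<le> 3"
proof -
  assume i: "i < 4"
  have "cut_edges F (X i) \<subseteq> insert {x i 0, r i} (cut_edges F (P i))"
  proof
    fix e assume e: "e \<in> cut_edges F (X i)"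
    then have eE: "e \<in> E" "e \<in> F" "e \<inter> X i \<noteq> {}" "\<not> e \<subseteq> X i" using F(1) by auto
    show "e \<in> insert {x i 0, r i} (cut_edges F (P i))"
    proof (cases "e \<subseteq> P i")
      case False
      then show ?thesis using eE X_P by blast
    next
      case True
      from eE(1) i eE(3) show ?thesis
      proof (cases rule: fan_edge_cases)
        case (1 j) then show ?thesis using True pq(1)[OF i] P_S[OF i] by blast
      next
        case (2 j) then show ?thesis using True pq(2)[OF i] P_S[OF i] by blast
      next
        case (4 j)
        then have "e \<subseteq> X i" by auto
        then show ?thesis using eE by blast
      qed blast
    qed
  qed
  then have "card (cut_edges F (X i)) \<le> card (insert {x i 0, r i} (cut_edges F (P i)))"
    using F(2) by (intro card_mono) auto
  also have "\<dots> \<le> Suc (card (cut_edges F (P i)))" by (rule card_insert_le_m1) auto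
  finally show ?thesis using card_cut_P[OF i] by simp
qed

text \<open>Without this edge, the part \<open>A\<close> of the fan up to \<open>l\<close> and the
  part \<open>B\<close> beyond it are not joined by any edge. Both are visited, so each has two
  crossing edges, and these four distinct edges leave the fan, which allows only three.\<close>

lemma path_edge:
  assumes i: "i < 4" and j: "j \<le> l" "l < k" "k < M i" "x i j \<in> Z" "x i k \<in> Z"
  shows "{x i (Suc l), x i l} \<in> F"
proof (rule ccontr)
  assume notF: "{x i (Suc l), x i l} \<notin> F"
  define A where "A = x i ` {..l}"
  define B where "B = x i ` {l<..<M i}"
  have AB: "A \<subseteq> X i" "B \<subseteq> X i" "A \<inter> B = {}" "A \<union> B = X i"
  proof -
    have lM: "l < M i" using j by linarith
    then show "A \<subseteq> X i" "B \<subseteq> X i" unfolding A_def B_def by auto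
    have "{..l} \<union> {l<..<M i} = {..<M i}" using lM by auto
    then show "A \<union> B = X i" unfolding A_def B_def image_Un[symmetric] by simp
    show "A \<inter> B = {}"
    proof (rule ccontr)
      assume "A \<inter> B \<noteq> {}"
      then obtain u v where "u \<le> l" "l < v" "v < M i" "x i u = x i v" unfolding A_def B_def by auto
      then show False using x_inj[OF i i, of u v] lM by simp
    qed
  qed
  have nX: "\<not> e \<subseteq> X i" if e: "e \<in> F" "e \<inter> A \<noteq> {} \<and> \<not> e \<subseteq> A \<or> e \<inter> B \<noteq> {} \<and> \<not> e \<subseteq> B" for e
  proof
    assume sub: "e \<subseteq> X i"
    have "e \<in> E" "e \<inter> X i \<noteq> {}" using e F(1) AB by auto
    from this(1) i this(2) show False
    proof (cases rule: fan_edge_cases)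
      case (1 k) then show False using sub pq(3)[OF i] X_U[OF i] by blast
    next
      case (2 k) then show False using sub pq(4)[OF i] X_U[OF i] by blast
    next
      case 3 then show False using sub pq(5)[OF i] X_U[OF i] by blast
    next
      case (4 k)
      have "k = l"
      proof (rule ccontr)
        assume "k \<noteq> l"
        then consider "Suc k \<le> l" | "l < k" by linarith
        then have "e \<subseteq> A \<or> e \<subseteq> B" using 4 unfolding A_def B_def by cases auto
        then show False using e(2) AB(3) by blast
      qed
      then show False using 4 e(1) notF by simp
    qed
  qed
  have one: "e \<inter> B = {}" if e: "e \<in> cut_edges F A" for e
  proof (rule ccontr)
    assume "e \<inter> B \<noteq> {}"
    then obtain u v where uv: "u \<in> e" "u \<in> A" "v \<in> e" "v \<in> B" using e by blast
    have "\<not> e \<subseteq> X i" using nX[of e] e by blast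
    then obtain w where w: "w \<in> e" "w \<notin> X i" by blast
    have "e \<in> F" using e by blast
    then show False using edge_two[OF _ uv(1,3) w(1)] uv w AB by blast
  qed
  have "2 \<le> card (cut_edges F A)"
  proof (rule cut)
    show "A \<inter> Z \<noteq> {}" using j unfolding A_def by blast
    have "x i k \<in> B" using j unfolding B_def by auto
    then show "Z - A \<noteq> {}" using j(5) AB(3) by blast
  qed
  moreover have "2 \<le> card (cut_edges F B)"
  proof (rule cut)
    have "x i k \<in> B" using j unfolding B_def by auto
    then show "B \<inter> Z \<noteq> {}" using j(5) by blast
    have "x i j \<in> A" using j unfolding A_def by auto
    then show "Z - B \<noteq> {}" using j(4) AB(3) by blast
  qed
  moreover have "card (cut_edges F A \<union> cut_edges F B) = card (cut_edges F A) + card (cut_edges F B)"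
    by (rule card_Un_disjoint) (use F(2) one in auto)
  moreover have "card (cut_edges F A \<union> cut_edges F B) \<le> card (cut_edges F (X i))"
    by (rule card_mono) (use F(2) nX AB in auto)
  ultimately show False using card_cut_X[OF i] by linarith
qed

lemma in_Z: "e \<in> F \<Longrightarrow> v \<in> e \<Longrightarrow> v \<in> Z"
  using F(3) by blast

text \<open>By \<open>path_edge\<close> everything between the first and the last visited vertex is
  visited along the path. Strictly inside, the two path edges exhaust the degree, so core neighbours
  occur only at the ends. The last conjunct ensures that a fan with \<open>g \<noteq> 0\<close> is
  visited.\<close>

lemma interval:
  assumes i: "i < 4"
  shows "\<exists>g h. g + h \<le> M i \<and> (\<forall>j<M i. x i j \<in> Z \<longleftrightarrow> g \<le> j \<and> j < M i - h) \<and>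
    (\<forall>j. g \<le> j \<and> Suc j < M i - h \<longrightarrow> {x i (Suc j), x i j} \<in> F) \<and>
    (\<forall>j u. j < M i \<and> u \<in> U \<and> {x i j, u} \<in> F \<longrightarrow> j = g \<or> Suc j = M i - h) \<and>
    (Z \<inter> X i = {} \<longrightarrow> g = 0)"
proof (cases "Z \<inter> X i = {}")
  case True
  then have "x i j \<notin> Z" if "j < M i" for j using that by auto
  \<comment> \<open>An unvisited fan counts as missed entirely from the end away from the tip:
    \<open>g = 0\<close> and \<open>h = M i\<close>.\<close>
  then show ?thesis by (rule_tac exI[of _ 0], rule_tac exI[of _ "M i"]) (auto dest: in_Z)
next
  case False
  define J where "J = {j. j < M i \<and> x i j \<in> Z}"
  have J: "finite J" "J \<noteq> {}" using False unfolding J_def by auto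
  define g where "g = Min J"
  define k where "k = Max J"
  have gk: "g \<in> J" "k \<in> J" "g \<le> k" unfolding g_def k_def using J by auto
  have bounds: "g \<le> j" "j \<le> k" if "j \<in> J" for j unfolding g_def k_def using that J by auto
  have kM: "k < M i" "x i g \<in> Z" "x i k \<in> Z" using gk unfolding J_def by auto
  have edge: "{x i (Suc j), x i j} \<in> F" if "g \<le> j" "j < k" for j
    by (rule path_edge[OF i that kM(1)]) (use kM in auto)
  have vis: "x i j \<in> Z" if "g \<le> j" "j \<le> k" for j
  proof (cases "j = k")
    case True then show ?thesis using kM by simp
  next
    case False
    then have "{x i (Suc j), x i j} \<in> F" using edge that by simp
    then show ?thesis by (rule in_Z) simp
  qed
  have ends: "j = g \<or> j = k" if j: "j < M i" "u \<in> U" "{x i j, u} \<in> F" for j u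
  proof (rule ccontr)
    assume c: "\<not> (j = g \<or> j = k)"
    have "x i j \<in> Z" using j(3) by (rule in_Z) simp
    then have "g < j" "j < k" using c bounds[of j] j(1) unfolding J_def by auto
    then have e: "{x i (Suc j), x i j} \<in> F" "{x i j, x i (j - 1)} \<in> F" using edge[of j] edge[of "j - 1"] by auto
    have lt: "Suc j < M i" "j - 1 < M i" using \<open>j < k\<close> kM by auto
    have ne: "x i (Suc j) \<noteq> x i j" "x i (Suc j) \<noteq> x i (j - 1)" "x i j \<noteq> x i (j - 1)"
      using x_inj[OF i i lt(1) j(1)] x_inj[OF i i lt] x_inj[OF i i j(1) lt(2)] \<open>g < j\<close> by auto
    have nu: "u \<noteq> x i (Suc j)" "u \<noteq> x i j" "u \<noteq> x i (j - 1)" using j(1,2) lt x_U[OF i] by auto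
    \<comment> \<open>Two path edges and an edge into the core would give \<open>x i j\<close>
      degree 3.\<close>
    have "card {{x i (Suc j), x i j}, {x i j, x i (j - 1)}, {x i j, u}} = 3"
      using ne nu by (auto simp: card_insert_if doubleton_eq_iff)
    moreover have "card {{x i (Suc j), x i j}, {x i j, x i (j - 1)}, {x i j, u}} \<le> card {e \<in> F. x i j \<in> e}"
      by (rule card_mono) (use F(2) e j(3) in auto)
    ultimately show False using deg[of "x i j"] by linarith
  qed
  have eq: "M i - (M i - 1 - k) = Suc k" using kM by linarith
  show ?thesis
  proof (rule exI[of _ g], rule exI[of _ "M i - 1 - k"], intro conjI allI impI)
    show "g + (M i - 1 - k) \<le> M i" using gk kM by linarith
    show "x i j \<in> Z \<longleftrightarrow> g \<le> j \<and> j < M i - (M i - 1 - k)" if "j < M i" for j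
      unfolding eq using vis[of j] bounds[of j] that unfolding J_def by auto
    show "{x i (Suc j), x i j} \<in> F" if "g \<le> j \<and> Suc j < M i - (M i - 1 - k)" for j
      using that edge unfolding eq by auto
    show "j = g \<or> Suc j = M i - (M i - 1 - k)" if "j < M i \<and> u \<in> U \<and> {x i j, u} \<in> F" for j u
      using that ends unfolding eq by auto
  qed (use False in blast)
qed

text \<open>If both fans missed their vertex next to the tip, they could be left only through the
  common hubs. Two visited fans need four such edges, all that the degrees of the hubs allow. So the
  hubs have no other edges and nothing leaves \<open>B\<close>, although the cycle also visits
  \<open>P k\<close> outside \<open>B\<close>.\<close>

lemma tip_missed:
  assumes i: "i < 4" "i' < 4" "i \<noteq> i'" "p i = p i'" "q i = q i'" and k: "k < 4" "k \<noteq> i" "k \<noteq> i'"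
    and vis: "Z \<inter> X i \<noteq> {}" "Z \<inter> X i' \<noteq> {}"
  shows "x i 0 \<in> Z \<and> 0 < M i \<or> x i' 0 \<in> Z \<and> 0 < M i'"
proof (rule ccontr)
  assume no: "\<not> ?thesis"
  let ?a = "p i" and ?b = "q i"
  define B where "B = {?a, ?b} \<union> X i \<union> X i'"
  have form: "\<exists>v\<in>X l. e = {v, ?a} \<or> e = {v, ?b} \<or> e \<subseteq> X l"
    if l: "l = i \<or> l = i'" and e: "e \<in> F" "e \<inter> X l \<noteq> {}" for e l
  proof -
    have l4: "l < 4" using l i by auto
    have "e \<in> E" using e F(1) by blast
    then show ?thesis using l4 e(2)
    proof (cases rule: fan_edge_cases)
      case (1 j) then show ?thesis using l i(4) by auto
    next
      case (2 j) then show ?thesis using l i(5) by auto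
    next
      case 3
      then have "x l 0 \<in> Z" using e(1) by (intro in_Z[of e]) auto
      then show ?thesis using no l 3 by auto
    next
      case (4 j)
      then have "e \<subseteq> X l" by auto
      then show ?thesis using 4 by (intro bexI[of _ "x l j"]) auto
    qed
  qed
  have PB: "P k \<inter> B = {}"
    using P_S[OF k(1)] pq(1,2)[OF i(1)] P_disjoint[OF k(1) i(1) k(2)] P_disjoint[OF k(1) i(2) k(3)]
      X_P[of i] X_P[of i'] unfolding B_def by blast
  have ge: "2 \<le> card (cut_edges F (X l))" if "l = i \<or> l = i'" for l
  proof (rule cut)
    show "X l \<inter> Z \<noteq> {}" using vis that by blast
    show "Z - X l \<noteq> {}" using Z_P[OF k(1)] PB that unfolding B_def by blast
  qed
  let ?D = "{e \<in> F. ?a \<in> e} \<union> {e \<in> F. ?b \<in> e}"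
  have sub: "cut_edges F (X i) \<union> cut_edges F (X i') \<subseteq> ?D"
    using form by blast
  have aX: "?a \<notin> X l" "?b \<notin> X l" if "l = i \<or> l = i'" for l
    using that pq(3,4)[OF i(1)] X_U[of l] i(1,2) by blast+
  have "cut_edges F (X i) \<inter> cut_edges F (X i') = {}"
  proof (rule ccontr)
    assume "\<not> ?thesis"
    then obtain e where e: "e \<in> F" "e \<inter> X i \<noteq> {}" "\<not> e \<subseteq> X i" "e \<inter> X i' \<noteq> {}" by blast
    then obtain v where "v \<in> X i" "e = {v, ?a} \<or> e = {v, ?b}" using form[of i e] by blast
    then show False using e(4) aX[of i'] X_disjoint[OF i(1-3)] by blast
  qed
  then have "card (cut_edges F (X i) \<union> cut_edges F (X i')) = card (cut_edges F (X i)) + card (cut_edges F (X i'))"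
    using F(2) by (intro card_Un_disjoint) auto
  moreover have "card ?D \<le> card {e \<in> F. ?a \<in> e} + card {e \<in> F. ?b \<in> e}" by (rule card_Un_le)
  ultimately have "card ?D \<le> card (cut_edges F (X i) \<union> cut_edges F (X i'))"
    using ge[of i] ge[of i'] deg[of ?a] deg[of ?b] by simp
  then have D: "cut_edges F (X i) \<union> cut_edges F (X i') = ?D"
    using sub F(2) by (intro card_seteq) auto
  have "cut_edges F B = {}"
  proof (rule ccontr)
    assume "cut_edges F B \<noteq> {}"
    then obtain e where e: "e \<in> F" "e \<inter> B \<noteq> {}" "\<not> e \<subseteq> B" by blast
    have "e \<inter> X i \<noteq> {} \<or> e \<inter> X i' \<noteq> {}"
      using e(1,2) D unfolding B_def by blast
    then obtain l where l: "l = i \<or> l = i'" "e \<inter> X l \<noteq> {}" by blast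
    then show False using form[OF l(1) e(1) l(2)] e(3) unfolding B_def by blast
  qed
  moreover have "2 \<le> card (cut_edges F B)"
  proof (rule cut)
    show "B \<inter> Z \<noteq> {}" using vis(1) unfolding B_def by blast
    show "Z - B \<noteq> {}" using Z_P[OF k(1)] PB by blast
  qed
  ultimately show False by (metis card.empty not_numeral_le_zero)
qed

text \<open>An edge that meets a fan either follows its path, with both ends visited, or goes to the
  core and then starts at an end of the interval; all other edges lie inside
  \<open>U\<close>.\<close>

lemma fan_decomposition:
  assumes gh: "\<And>i. i < 4 \<Longrightarrow> g i + h i \<le> M i"
    and vis: "\<And>i j. i < 4 \<Longrightarrow> j < M i \<Longrightarrow> x i j \<in> Z \<longleftrightarrow> g i \<le> j \<and> j < M i - h i"
    and path: "\<And>i j. i < 4 \<Longrightarrow> g i \<le> j \<Longrightarrow> Suc j < M i - h i \<Longrightarrow> {x i (Suc j), x i j} \<in> F"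
    and ends: "\<And>i j u. i < 4 \<Longrightarrow> j < M i \<Longrightarrow> u \<in> U \<Longrightarrow> {x i j, u} \<in> F \<Longrightarrow> j = g i \<or> Suc j = M i - h i"
  shows "F = decode (F \<inter> Pow U) (\<lambda>i. ({u \<in> U. {x i (g i), u} \<in> F}, {u \<in> U. {x i (M i - h i - 1), u} \<in> F})) g h"
    (is "F = ?D")
proof
  show "?D \<subseteq> F" unfolding decode_def using path by auto
  show "F \<subseteq> ?D"
  proof
    fix e assume eF: "e \<in> F"
    then have eE: "e \<in> E" using F(1) by blast
    show "e \<in> ?D"
    proof (cases "e \<subseteq> U")
      case True then show ?thesis using eF unfolding decode_def by blast
    next
      case False
      then obtain i where i: "i < 4" "e \<in> fan_edges (p i) (q i) (r i) (x i) (M i)" using E[OF eE] by blast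
      then have "e \<inter> X i \<noteq> {}" unfolding fan_edges_def by auto
      have attach: "e \<in> ?D" if ju: "j < M i" "u \<in> U" "e = {x i j, u}" for j u
      proof -
        consider "j = g i" | "j = M i - h i - 1" using ends[OF i(1) ju(1,2)] ju(3) eF by force
        then show ?thesis
        proof cases
          case 1
          then have "u \<in> {u \<in> U. {x i (g i), u} \<in> F}" using ju eF by simp
          then show ?thesis using i(1) ju(3) 1 unfolding decode_def by auto
        next
          case 2
          then have "u \<in> {u \<in> U. {x i (M i - h i - 1), u} \<in> F}" using ju eF by simp
          then show ?thesis using i(1) ju(3) 2 unfolding decode_def by auto
        qed
      qed
      from eE i(1) \<open>e \<inter> X i \<noteq> {}\<close> show ?thesis
      proof (cases rule: fan_edge_cases)
        case (1 j) then show ?thesis using attach pq(3)[OF i(1)] by blast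
      next
        case (2 j) then show ?thesis using attach pq(4)[OF i(1)] by blast
      next
        case 3 then show ?thesis using attach pq(5)[OF i(1)] by blast
      next
        case (4 j)
        have "x i (Suc j) \<in> Z" "x i j \<in> Z" using 4 eF by (auto intro: in_Z[of e])
        then have "g i \<le> j" "Suc j < M i - h i" using vis[OF i(1)] 4 by auto
        then show ?thesis using 4(2) i(1) unfolding decode_def by blast
      qed
    qed
  qed
qed

text \<open>Missed vertices are counted by place, in the core or at a fan end. Once the length of
  the cycle is fixed, this equation recovers the last gap.\<close>

lemma card_Z:
  assumes gh: "\<And>i. i < 4 \<Longrightarrow> g i + h i \<le> M i"
    and vis: "\<And>i j. i < 4 \<Longrightarrow> j < M i \<Longrightarrow> x i j \<in> Z \<longleftrightarrow> g i \<le> j \<and> j < M i - h i"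
  shows "card V = card Z + card (U - Z) + (\<Sum>i<4. g i + h i)"
proof -
  have VZ: "V - Z = (U - Z) \<union> (\<Union>i<4. X i - Z)" unfolding V_def by blast
  have cX: "card (X i - Z) = g i + h i" if i: "i < 4" for i
  proof -
    have "X i - Z = x i ` ({..<g i} \<union> {M i - h i..<M i})" using vis[OF i] gh[OF i] by auto
    moreover have "inj_on (x i) ({..<g i} \<union> {M i - h i..<M i})"
      using x_inj[OF i i] gh[OF i] unfolding inj_on_def by auto
    moreover have "card ({..<g i} \<union> {M i - h i..<M i}) = g i + h i"
      using gh[OF i] by (subst card_Un_disjoint) auto
    ultimately show ?thesis by (simp add: card_image)
  qed
  have "card (\<Union>i<4. X i - Z) = (\<Sum>i<4. card (X i - Z))"
    by (rule card_UN_disjoint) (use X_disjoint in auto)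
  also have "\<dots> = (\<Sum>i<4. g i + h i)" using cX by (intro sum.cong) auto
  finally have "card (\<Union>i<4. X i - Z) = (\<Sum>i<4. g i + h i)" .
  moreover have "card (V - Z) = card (U - Z) + card (\<Union>i<4. X i - Z)"
    unfolding VZ by (rule card_Un_disjoint) (use U(1) X_U in auto)
  moreover have "card V = card Z + card (V - Z)"
    using Z(1) finite_V by (metis card_Diff_subset card_mono finite_subset le_add_diff_inverse)
  ultimately show ?thesis by simp
qed

lemma F_encoded:
  "\<exists>g h. F = decode (F \<inter> Pow U) (\<lambda>i. ({u \<in> U. {x i (g i), u} \<in> F}, {u \<in> U. {x i (M i - h i - 1), u} \<in> F})) g h \<and>
     card V = card Z + card (U - Z) + (\<Sum>i<4. g i + h i) \<and> (g 0 = 0 \<or> g 3 = 0) \<and> (g 1 = 0 \<or> g 2 = 0)"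
proof -
  define Q where "Q i g h \<longleftrightarrow> g + h \<le> M i \<and> (\<forall>j<M i. x i j \<in> Z \<longleftrightarrow> g \<le> j \<and> j < M i - h) \<and>
    (\<forall>j. g \<le> j \<and> Suc j < M i - h \<longrightarrow> {x i (Suc j), x i j} \<in> F) \<and>
    (\<forall>j u. j < M i \<and> u \<in> U \<and> {x i j, u} \<in> F \<longrightarrow> j = g \<or> Suc j = M i - h) \<and>
    (Z \<inter> X i = {} \<longrightarrow> g = 0)" for i g h
  have "\<exists>gh. Q i (fst gh) (snd gh)" if "i < 4" for i
    using interval[OF that, folded Q_def] by auto
  then obtain gh where Q: "\<And>i. i < 4 \<Longrightarrow> Q i (fst (gh i)) (snd (gh i))" by metis
  define g where "g i = fst (gh i)" for i
  define h where "h i = snd (gh i)" for i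
  note gh = Q[folded g_def h_def, unfolded Q_def]
  have hit: "Z \<inter> X i \<noteq> {}" if "i < 4" "g i \<noteq> 0" for i
    using gh[OF that(1)] that(2) by argo
  have z: "g i = 0 \<or> g i' = 0"
    if "i < 4" "i' < 4" "i \<noteq> i'" "p i = p i'" "q i = q i'" "k < 4" "k \<noteq> i" "k \<noteq> i'" for i i' k
  proof (rule ccontr)
    assume c: "\<not> ?thesis"
    then have "Z \<inter> X i \<noteq> {}" "Z \<inter> X i' \<noteq> {}" using hit that(1,2) by blast+
    then have "x i 0 \<in> Z \<and> 0 < M i \<or> x i' 0 \<in> Z \<and> 0 < M i'" using tip_missed[OF that] by blast
    then show False using c gh[OF that(1)] gh[OF that(2)] by auto
  qed
  \<comment> \<open>The pairs are fans 0 and 3 with hubs \<open>a\<close>, \<open>b\<close> and fans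
    1 and 2 with hubs \<open>c\<close>, \<open>d\<close>. The instances 1 and, in the next line, 0
    name a fan outside the pair.\<close>
  have "g 0 = 0 \<or> g 3 = 0" by (rule z[of _ _ 1]) (simp_all add: hubs)
  moreover have "g 1 = 0 \<or> g 2 = 0" by (rule z[of _ _ 0]) (simp_all add: hubs del: One_nat_def)
  moreover have "card V = card Z + card (U - Z) + (\<Sum>i<4. g i + h i)"
    by (rule card_Z) (use gh in blast)+
  moreover have "F = decode (F \<inter> Pow U) (\<lambda>i. ({u \<in> U. {x i (g i), u} \<in> F}, {u \<in> U. {x i (M i - h i - 1), u} \<in> F})) g h"
    by (rule fan_decomposition) (use gh in blast)+
  ultimately show ?thesis by blast
qed

end

section \<open>Counting the codes of long cycles\<close>

context four_fans
begin

text \<open>Only the last five components depend on \<open>N\<close>: the tip gaps \<open>s\<close>,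
  \<open>s'\<close>, one for each pair of fans, and the end gaps \<open>h0\<close>,
  \<open>h1\<close>, \<open>h2\<close>. They are the source of the exponent 5. The others record the
  core edges, the neighbours of the interval ends, the number of missed core vertices and, for each
  pair, which tip gap vanishes. Extensionality on \<open>{..<4}\<close> makes the set
  finite.\<close>

definition params :: "nat \<Rightarrow> ('a set set \<times> (nat \<Rightarrow> 'a set \<times> 'a set) \<times> nat \<times> bool \<times> bool \<times> nat \<times> nat \<times> nat \<times> nat \<times> nat) set" where
  "params N = Pow (Pow U) \<times> ({..<4} \<rightarrow>\<^sub>E Pow U \<times> Pow U) \<times> {..card U} \<times> UNIV \<times> UNIV \<times>
     {..N} \<times> {..N} \<times> {..N} \<times> {..N} \<times> {..N}"

text \<open>Of the eight gaps, two vanish (either one of fans 0 and 3 has gap 0 at its tip, and likewise for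
  fans 1 and 2) and one more is determined by the total number \<open>N\<close> of missed vertices.\<close>

definition gaps :: "bool \<Rightarrow> bool \<Rightarrow> nat \<Rightarrow> nat \<Rightarrow> nat \<Rightarrow> nat" where
  "gaps \<beta> \<beta>' s s' i = (if i = 0 then if \<beta> then 0 else s else if i = 3 then if \<beta> then s else 0
     else if i = 1 then if \<beta>' then 0 else s' else if \<beta>' then s' else 0)"

definition end_gaps :: "nat \<Rightarrow> nat \<Rightarrow> nat \<Rightarrow> nat \<Rightarrow> nat \<Rightarrow> nat" where
  "end_gaps h0 h1 h2 h3 i = (if i = 0 then h0 else if i = 1 then h1 else if i = 2 then h2 else h3)"

text \<open>The last argument of \<open>end_gaps\<close> solves the equation of
  \<open>card_Z\<close> for the remaining gap; \<open>N\<close> counts all missed vertices and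
  \<open>\<rho>\<close> those in the core.\<close>

definition decode_params where
  "decode_params N = (\<lambda>(A, R, \<rho>, \<beta>, \<beta>', s, s', h0, h1, h2).
     decode A R (gaps \<beta> \<beta>' s s') (end_gaps h0 h1 h2 (N - \<rho> - s - s' - h0 - h1 - h2)))"

lemma card_params:
  "finite (params N)"
  "card (params N) = 2 ^ 2 ^ card U * (2 ^ card U * 2 ^ card U) ^ 4 * (card U + 1) * 4 * (N + 1) ^ 5"
proof -
  show "finite (params N)" unfolding params_def using U(1)
    by (intro finite_cartesian_product finite_PiE) auto
  have "card ({..<4::nat} \<rightarrow>\<^sub>E Pow U \<times> Pow U) = (2 ^ card U * 2 ^ card U) ^ 4"
    by (subst card_PiE) (use U(1) in \<open>auto simp: card_cartesian_product card_Pow prod_constant\<close>)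
  moreover have "A * (K * (k * (2 * (2 * (B * (B * (B * (B * B)))))))) = A * K * k * 4 * B ^ 5" for A K k B :: nat
  proof -
    have "B * (B * (B * (B * B))) = B ^ 5" by (simp add: eval_nat_numeral)
    then show ?thesis by simp
  qed
  ultimately show "card (params N) = 2 ^ 2 ^ card U * (2 ^ card U * 2 ^ card U) ^ 4 * (card U + 1) * 4 * (N + 1) ^ 5"
    unfolding params_def card_cartesian_product using U(1)
    by (simp only: card_Pow card_UNIV_bool card_atMost finite_Pow_iff Suc_eq_plus1)
qed

lemma decode_cong:
  assumes "\<And>i. i < 4 \<Longrightarrow> R i = R' i" "\<And>i. i < 4 \<Longrightarrow> g i = g' i" "\<And>i. i < 4 \<Longrightarrow> h i = h' i"
  shows "decode A R g h = decode A R' g' h'"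
  unfolding decode_def using assms by simp

lemma long_cycles_encoded:
  assumes "is_cycle E l" "length l = k" "k \<le> card V" "card V < k + m"
  shows "cycle_edges l \<in> decode_params (card V - k) ` params (card V - k)"
proof -
  let ?F = "cycle_edges l" and ?Z = "set l" and ?N = "card V - k"
  have lE: "cycle_edges l \<subseteq> E" and dist: "distinct l" using assms(1) unfolding is_cycle_def by auto
  have cZ: "card ?Z = k" using distinct_card[OF dist] assms(2) by simp
  have "long_cycle E U a b c d y p q r x M m ?F ?Z"
  proof (unfold_locales)
    show "cycle_edges l \<subseteq> E" by (rule lE)
    show "finite ?F" unfolding cycle_edges_image by simp
    show "\<Union>?F = ?Z" by (rule Union_cycle_edges)
    show "card e = 2" if "e \<in> ?F" for e by (rule card_cycle_edge[OF assms(1) that])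
    show "card {e \<in> ?F. v \<in> e} \<le> 2" for v by (rule cycle_degree[OF dist])
    show "2 \<le> card (cut_edges ?F A)" if "A \<inter> ?Z \<noteq> {}" "?Z - A \<noteq> {}" for A
      using that cycle_cut[OF assms(1)] by blast
    show "?Z \<subseteq> V"
    proof
      fix v assume "v \<in> ?Z"
      then obtain e where "v \<in> e" "e \<in> E" using Union_cycle_edges[of l] lE by blast
      then show "v \<in> V" using E_V by blast
    qed
    show "card V < card ?Z + m" using assms(4) cZ by simp
  qed
  then interpret C: long_cycle E U a b c d y p q r x M m ?F ?Z .
  obtain g h where gh: "?F = decode (?F \<inter> Pow U)
      (\<lambda>i. ({u \<in> U. {x i (g i), u} \<in> ?F}, {u \<in> U. {x i (M i - h i - 1), u} \<in> ?F})) g h"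
    "card V = card ?Z + card (U - ?Z) + (\<Sum>i<4. g i + h i)" "g 0 = 0 \<or> g 3 = 0" "g 1 = 0 \<or> g 2 = 0"
    using C.F_encoded by (elim exE conjE) (rule that)
  define R where "R = (\<lambda>i\<in>{..<4}. ({u \<in> U. {x i (g i), u} \<in> ?F}, {u \<in> U. {x i (M i - h i - 1), u} \<in> ?F}))"
  define \<rho> where "\<rho> = card (U - ?Z)"
  have sum4: "(\<Sum>i<4. g i + h i) = g 0 + g 1 + g 2 + g 3 + h 0 + h 1 + h 2 + h 3"
    by (simp add: eval_nat_numeral)
  have N: "?N = \<rho> + (g 0 + g 1 + g 2 + g 3 + h 0 + h 1 + h 2 + h 3)"
    using gh(2) cZ unfolding sum4 \<rho>_def by simp
  define \<beta> where "\<beta> \<longleftrightarrow> g 0 = 0"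
  define \<beta>' where "\<beta>' \<longleftrightarrow> g 1 = 0"
  \<comment> \<open>One summand of \<open>g 0 + g 3\<close> vanishes, so the sum is the other one,
    and likewise for \<open>g 1 + g 2\<close>; \<open>\<beta>\<close> and \<open>\<beta>'\<close>
    tell which.\<close>
  define t where "t = (?F \<inter> Pow U, R, \<rho>, \<beta>, \<beta>', g 0 + g 3, g 1 + g 2, h 0, h 1, h 2)"
  have "decode_params ?N t = decode (?F \<inter> Pow U)
      (\<lambda>i. ({u \<in> U. {x i (g i), u} \<in> ?F}, {u \<in> U. {x i (M i - h i - 1), u} \<in> ?F})) g h"
    unfolding decode_params_def t_def prod.case
  proof (rule decode_cong)
    fix i :: nat assume i: "i < 4"
    show "gaps \<beta> \<beta>' (g 0 + g 3) (g 1 + g 2) i = g i"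
      using i gh(3,4) unfolding gaps_def \<beta>_def \<beta>'_def less4 by auto
    show "end_gaps (h 0) (h 1) (h 2) (?N - \<rho> - (g 0 + g 3) - (g 1 + g 2) - h 0 - h 1 - h 2) i = h i"
      using i unfolding end_gaps_def N less4 by auto
  qed (simp add: R_def)
  moreover have "t \<in> params ?N"
  proof -
    have "\<rho> \<le> card U" unfolding \<rho>_def using U(1) by (intro card_mono) auto
    then show ?thesis unfolding t_def params_def R_def N by auto
  qed
  ultimately show ?thesis using gh(1) by (intro image_eqI[of _ _ t]) simp_all
qed

lemma card_long_cycles:
  assumes "k \<le> card V" "card V < k + m"
  shows "card (cycles_of_length E k) \<le>
    2 ^ 2 ^ card U * (2 ^ card U * 2 ^ card U) ^ 4 * (card U + 1) * 4 * (card V - k + 1) ^ 5"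
proof -
  have "cycles_of_length E k \<subseteq> decode_params (card V - k) ` params (card V - k)"
    unfolding cycles_of_length_def using long_cycles_encoded assms by blast
  then have "card (cycles_of_length E k) \<le> card (decode_params (card V - k) ` params (card V - k))"
    using card_params(1) by (intro card_mono) auto
  also have "\<dots> \<le> card (params (card V - k))" by (rule card_image_le[OF card_params(1)])
  finally show ?thesis unfolding card_params(2) .
qed

end

subsection \<open>The family of triangulations\<close>

lemma cycle_edges_map: "cycle_edges (map h p) = (`) h ` cycle_edges p"
proof -
  have "cycle_edges (map h p) = (\<lambda>i. h ` {p ! i, p ! (Suc i mod length p)}) ` {..<length p}"
    unfolding cycle_edges_image
  proof (rule image_cong)
    fix i assume "i \<in> {..<length p}"
    then have "i < length p" "Suc i mod length p < length p" by (auto intro!: mod_less_divisor)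
    then show "{map h p ! i, map h p ! (Suc i mod length (map h p))} = h ` {p ! i, p ! (Suc i mod length p)}" by simp
  qed simp
  then show ?thesis unfolding cycle_edges_image image_image .
qed

lemma is_cycle_vertices:
  assumes "is_cycle E p"
  shows "set p \<subseteq> \<Union>E"
proof -
  have "\<Union>(cycle_edges p) \<subseteq> \<Union>E" using assms unfolding is_cycle_def by (intro Union_mono) simp
  then show ?thesis unfolding Union_cycle_edges .
qed

lemma is_cycle_map:
  assumes "is_cycle E p" "inj_on h (\<Union>E)"
  shows "is_cycle ((`) h ` E) (map h p)"
proof -
  have "inj_on h (set p)" by (rule inj_on_subset[OF assms(2) is_cycle_vertices[OF assms(1)]])
  then show ?thesis using assms(1) unfolding is_cycle_def cycle_edges_map by (auto simp: distinct_map)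
qed

context
  fixes V :: "'a set" and E :: "'a set set" and h :: "'a \<Rightarrow> 'b"
  assumes inj: "inj_on h V" and EV: "\<And>e. e \<in> E \<Longrightarrow> e \<subseteq> V"
begin

lemma inv_image_edge: "e \<in> E \<Longrightarrow> inv_into V h ` h ` e = e"
  using inj EV by (simp add: inv_into_image_cancel)

lemma inv_vertex: "v \<in> V \<Longrightarrow> inv_into V h (h v) = v"
  using inj by simp

lemma inj_edges: "inj_on h (\<Union>E)"
  using inj EV by (meson Sup_least inj_on_subset)

lemma relabel_hamiltonian:
  assumes "hamiltonian V E"
  shows "hamiltonian (h ` V) ((`) h ` E)"
proof -
  obtain p where p: "is_cycle E p" "set p = V" using assms unfolding hamiltonian_def by blast
  then show ?thesis unfolding hamiltonian_def
    using is_cycle_map[OF p(1) inj_edges] by (intro exI[of _ "map h p"]) auto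
qed

text \<open>Pulling back along the inverse of \<open>h\<close> shows that every cycle of the image
  graph is the image of a cycle of \<open>E\<close>.\<close>

lemma relabel_cycles:
  assumes "finite E"
  shows "card (cycles_of_length ((`) h ` E) k) \<le> card (cycles_of_length E k)"
proof -
  let ?k = "inv_into V h"
  have img: "(`) ?k ` (`) h ` E = E"
  proof -
    have "(`) ?k ` (`) h ` E = (\<lambda>e. ?k ` h ` e) ` E" by (rule image_image)
    also have "\<dots> = (\<lambda>e. e) ` E" by (rule image_cong[OF refl inv_image_edge])
    finally show ?thesis by simp
  qed
  have injk: "inj_on ?k (\<Union>((`) h ` E))"
    by (rule inj_on_subset[OF inj_on_inv_into[of "h ` V" h V]]) (use EV in auto)
  have "cycles_of_length ((`) h ` E) k \<subseteq> (`) ((`) h) ` cycles_of_length E k"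
  proof
    fix D assume "D \<in> cycles_of_length ((`) h ` E) k"
    then obtain p where p: "is_cycle ((`) h ` E) p" "length p = k" "D = cycle_edges p"
      unfolding cycles_of_length_def by blast
    have "is_cycle E (map ?k p)" using is_cycle_map[OF p(1) injk] unfolding img .
    moreover have "map h (map ?k p) = p"
    proof -
      have "set p \<subseteq> \<Union>((`) h ` E)" by (rule is_cycle_vertices[OF p(1)])
      then have "set p \<subseteq> h ` V" using EV by blast
      then show ?thesis by (auto simp: f_inv_into_f intro!: map_idI)
    qed
    ultimately have "cycle_edges (map ?k p) \<in> cycles_of_length E k" "D = (`) h ` cycle_edges (map ?k p)"
      unfolding cycles_of_length_def p(3) using p(2) by (auto simp: cycle_edges_map[symmetric])
    then show "D \<in> (`) ((`) h) ` cycles_of_length E k" by blast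
  qed
  moreover have "finite (cycles_of_length E k)"
    by (rule finite_subset[of _ "Pow E"]) (use assms in \<open>auto simp: cycles_of_length_def is_cycle_def\<close>)
  ultimately show ?thesis by (rule surj_card_le[rotated])
qed

text \<open>The drawing stays the same: points and arcs are looked up through the inverse of
  \<open>h\<close>, so the faces do not change at all.\<close>

lemma relabel_triangulation:
  fixes Q :: "'c::topological_space set"
  assumes "triangulation_of V E Q"
  shows "triangulation_of (h ` V) ((`) h ` E) Q"
proof -
  let ?k = "inv_into V h"
  obtain \<phi> A where emb: "graph_embedding V E Q \<phi> A" and tri: "\<forall>D\<in>faces V E Q \<phi> A. triangular_face E A D"
    and sg: "simple_graph V E" using assms unfolding triangulation_of_def by blast
  define \<phi>' where "\<phi>' = \<phi> \<circ> ?k"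
  define A' where "A' e = A (?k ` e)" for e
  have \<phi>': "\<phi>' (h v) = \<phi> v" if "v \<in> V" for v unfolding \<phi>'_def using inv_vertex[OF that] by simp
  have A': "A' (h ` e) = A e" if "e \<in> E" for e unfolding A'_def using inv_image_edge[OF that] by simp
  have \<phi>'im: "\<phi>' ` h ` e = \<phi> ` e" if "e \<subseteq> V" for e
    unfolding image_image using \<phi>' that by (intro image_cong) auto
  have "simple_graph (h ` V) ((`) h ` E)"
    unfolding simple_graph_def
  proof (intro conjI ballI)
    show "finite (h ` V)" using sg unfolding simple_graph_def by simp
    fix e assume "e \<in> (`) h ` E"
    then obtain e' where e': "e' \<in> E" "e = h ` e'" by blast
    then obtain u v where uv: "u \<in> V" "v \<in> V" "u \<noteq> v" "e' = {u, v}" using sg unfolding simple_graph_def by blast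
    then show "\<exists>u\<in>h ` V. \<exists>v\<in>h ` V. u \<noteq> v \<and> e = {u, v}"
      using inj_onD[OF inj, of u v] e'(2) by (intro bexI[of _ "h u"] bexI[of _ "h v"]) auto
  qed
  moreover have "graph_embedding (h ` V) ((`) h ` E) Q \<phi>' A'"
    unfolding graph_embedding_def
  proof (intro conjI allI ballI impI)
    have "inj_on \<phi> V" using emb unfolding graph_embedding_def by blast
    then show "inj_on \<phi>' (h ` V)" using \<phi>' unfolding inj_on_def by auto
    show "\<phi>' ` h ` V \<subseteq> Q" using emb \<phi>'im[of V] unfolding graph_embedding_def by auto
  next
    fix u v assume "{u, v} \<in> (`) h ` E"
    then obtain e where e: "e \<in> E" "{u, v} = h ` e" by blast
    then have "u \<in> h ` e" "v \<in> h ` e" by auto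
    then obtain u' v' where uv: "u' \<in> e" "v' \<in> e" "u = h u'" "v = h v'" by blast
    have V: "u' \<in> V" "v' \<in> V" using EV[OF e(1)] uv by auto
    have "h ` {u', v'} = h ` e" using e(2) uv by simp
    then have "{u', v'} = e" using inj_on_image_eq_iff[OF inj] V EV[OF e(1)] by blast
    then have uvE: "{u', v'} \<in> E" using e(1) by simp
    moreover from emb have "\<forall>u v. {u, v} \<in> E \<longrightarrow> (\<exists>\<gamma>. arc \<gamma> \<and> pathstart \<gamma> = \<phi> u \<and> pathfinish \<gamma> = \<phi> v \<and>
             path_image \<gamma> = A {u, v} \<and> path_image \<gamma> \<subseteq> Q)"
      unfolding graph_embedding_def by (elim conjE)
    ultimately have "\<exists>\<gamma>. arc \<gamma> \<and> pathstart \<gamma> = \<phi> u' \<and> pathfinish \<gamma> = \<phi> v' \<and>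
             path_image \<gamma> = A {u', v'} \<and> path_image \<gamma> \<subseteq> Q" by simp
    moreover have "A' {u, v} = A {u', v'}" using A'[OF uvE] uv by simp
    ultimately show "\<exists>\<gamma>. arc \<gamma> \<and> pathstart \<gamma> = \<phi>' u \<and> pathfinish \<gamma> = \<phi>' v \<and>
             path_image \<gamma> = A' {u, v} \<and> path_image \<gamma> \<subseteq> Q"
      unfolding uv(3,4) \<phi>'[OF V(1)] \<phi>'[OF V(2)] by simp
  next
    fix e assume "e \<in> (`) h ` E"
    then obtain e' where e': "e' \<in> E" "e = h ` e'" by blast
    then show "A' e \<inter> \<phi>' ` h ` V = \<phi>' ` e"
      using emb A'[OF e'(1)] \<phi>'im[OF order_refl] \<phi>'im[OF EV[OF e'(1)]] unfolding graph_embedding_def by simp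
  next
    fix e D assume "e \<in> (`) h ` E" "D \<in> (`) h ` E" "e \<noteq> D"
    then obtain e' D' where e: "e' \<in> E" "e = h ` e'" "D' \<in> E" "D = h ` D'" "e' \<noteq> D'" by blast
    have "h ` e' \<inter> h ` D' = h ` (e' \<inter> D')" using inj_on_image_Int[OF inj EV[OF e(1)] EV[OF e(3)]] by simp
    moreover have "A e' \<inter> A D' = \<phi> ` (e' \<inter> D')" using emb e unfolding graph_embedding_def by blast
    moreover have "\<phi>' ` h ` (e' \<inter> D') = \<phi> ` (e' \<inter> D')" by (rule \<phi>'im) (use EV[OF e(1)] in blast)
    ultimately show "A' e \<inter> A' D = \<phi>' ` (e \<inter> D)" unfolding e(2,4) A'[OF e(1)] A'[OF e(3)] by simp
  qed
  moreover have "faces (h ` V) ((`) h ` E) Q \<phi>' A' = faces V E Q \<phi> A"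
  proof -
    have "(\<Union>e\<in>(`) h ` E. A' e) = (\<Union>e\<in>E. A e)" using A' by auto
    then show ?thesis unfolding faces_def \<phi>'im[OF order_refl] by simp
  qed
  moreover have "triangular_face ((`) h ` E) A' D" if D: "triangular_face E A D" for D
  proof -
    obtain u v w f f' where uvw: "is_cycle E [u, v, w]" "homeomorphism (cball (0::complex) 1) (closure D) f f'"
        "f ` ball 0 1 = D" "f ` sphere 0 1 = A {u, v} \<union> A {v, w} \<union> A {w, u}"
      using D unfolding triangular_face_def by blast
    have "cycle_edges [u, v, w] = {{u, v}, {v, w}, {w, u}}"
      unfolding cycle_edges_image by (simp add: lessThan_Suc insert_commute)
    then have E: "{u, v} \<in> E" "{v, w} \<in> E" "{w, u} \<in> E" using uvw(1) unfolding is_cycle_def by auto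
    have "is_cycle ((`) h ` E) [h u, h v, h w]" using is_cycle_map[OF uvw(1) inj_edges] by simp
    moreover have "A' {h u, h v} = A {u, v}" "A' {h v, h w} = A {v, w}" "A' {h w, h u} = A {w, u}"
      using A'[OF E(1)] A'[OF E(2)] A'[OF E(3)] by simp_all
    ultimately show ?thesis
      unfolding triangular_face_def using uvw(2-4)
      by (intro exI[of _ "h u"] exI[of _ "h v"] exI[of _ "h w"] exI[of _ f] exI[of _ f']) simp
  qed
  ultimately show ?thesis
    unfolding triangulation_of_def using tri by (intro conjI exI[of _ \<phi>'] exI[of _ A']) auto
qed

end

section \<open>Assembly of the graphs and their Hamiltonian cycles\<close>

lemma is_cycleI:
  assumes "distinct xs" "3 \<le> length xs" "successively (adjacent E) xs" "{last xs, hd xs} \<in> E"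
  shows "is_cycle E xs"
  unfolding is_cycle_def
proof (intro conjI assms(1,2) subsetI)
  fix e assume "e \<in> cycle_edges xs"
  then obtain i where i: "i < length xs" "e = {xs ! i, xs ! (Suc i mod length xs)}" unfolding cycle_edges_def by blast
  have ne: "xs \<noteq> []" using assms(2) by auto
  show "e \<in> E"
  proof (cases "Suc i < length xs")
    case True
    then show ?thesis using assms(3) i unfolding successively_conv_nth by simp
  next
    case False
    then have "Suc i = length xs" using i(1) by linarith
    then have "i = length xs - 1" "Suc i mod length xs = 0" by auto
    then show ?thesis using assms(4) i(2) ne by (simp add: last_conv_nth hd_conv_nth)
  qed
qed

lemma fan_edgesI:
  "j < m \<Longrightarrow> {x j, p} \<in> fan_edges p q r x m" "j < m \<Longrightarrow> {x j, q} \<in> fan_edges p q r x m"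
  "0 < m \<Longrightarrow> {x 0, r} \<in> fan_edges p q r x m" "Suc j < m \<Longrightarrow> {x j, x (Suc j)} \<in> fan_edges p q r x m"
proof -
  show "{x j, x (Suc j)} \<in> fan_edges p q r x m" if "Suc j < m"
    unfolding fan_edges_def using that by (intro UN_I[of "Suc j"]) (auto simp: insert_commute)
  show "{x 0, r} \<in> fan_edges p q r x m" if "0 < m"
    unfolding fan_edges_def using that by (intro UN_I[of 0]) auto
  show "{x j, p} \<in> fan_edges p q r x m" "{x j, q} \<in> fan_edges p q r x m" if "j < m"
    unfolding fan_edges_def using that by (intro UN_I[of j]; simp)+
qed

lemma fan_list:
  assumes "0 < m" "fan_edges p q r x m \<subseteq> E" "inj_on x {..<m}"
  defines "L \<equiv> map x [0..<m]"
  shows "L \<noteq> []" "hd L = x 0" "last L = x (m - 1)" "set L = x ` {..<m}" "distinct L"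
    "successively (adjacent E) L" "successively (adjacent E) (rev L)"
    "{x (m - 1), p} \<in> E" "{x (m - 1), q} \<in> E" "{x 0, p} \<in> E" "{x 0, q} \<in> E" "{x 0, r} \<in> E"
proof -
  have hub: "{x j, p} \<in> E" "{x j, q} \<in> E" if "j < m" for j
    using fan_edgesI(1)[OF that, of x p q r] fan_edgesI(2)[OF that, of x q p r] assms(2) by blast+
  show "L \<noteq> []" "hd L = x 0" "last L = x (m - 1)" "set L = x ` {..<m}" "distinct L"
    unfolding L_def using assms(1,3) by (auto simp: hd_map last_map distinct_map lessThan_atLeast0)
  show s: "successively (adjacent E) L"
    unfolding L_def by (rule successively_upt) (use fan_edgesI(4) assms(2) in fast)
  show "successively (adjacent E) (rev L)" by (rule successively_adjacent_rev[OF s])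
  show "{x (m - 1), p} \<in> E" "{x (m - 1), q} \<in> E" "{x 0, p} \<in> E" "{x 0, q} \<in> E" "{x 0, r} \<in> E"
    using hub[of "m - 1"] hub[of 0] fan_edgesI(3)[OF assms(1), of x r p q] assms(1,2) by auto
qed

text \<open>The size of the core \<open>U\<close>, the extra vertex being \<open>d\<close>. It
  depends on \<open>g\<close> alone and not on the length of the fans.\<close>

definition core_size :: "nat \<Rightarrow> nat" where
  "core_size g = Suc (card (\<Union>(surface_triangles g)))"

text \<open>The number of codes in \<open>params\<close> apart from the five gaps, for a core of
  \<open>u\<close> vertices.\<close>

definition cycle_const :: "nat \<Rightarrow> nat" where
  "cycle_const u = 2 ^ 2 ^ u * (2 ^ u * 2 ^ u) ^ 4 * (u + 1) * 4"

lemma four_fan_triangulation: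
  assumes m: "core_size g \<le> m"
  shows "\<exists>(V :: pt set) E. finite V \<and> finite E \<and> (\<forall>e\<in>E. e \<subseteq> V) \<and> triangulation_of V E (orientable_surface g) \<and>
     hamiltonian V E \<and> card V = 4 * m + 4 \<and>
     (\<forall>k\<le>card V. card V < k + m \<longrightarrow>
        card (cycles_of_length E k) \<le> cycle_const (core_size g) * (card V - k + 1) ^ 5)"
proof -
  let ?T0 = "surface_triangles g" and ?Q = "orientable_surface g"
  define a where "a = grid_point 0 1"
  define b where "b = grid_point 0 3"
  define c where "c = grid_point 0 2"
  define y where "y = grid_point 0 0"
  define d where "d = (1/3) *\<^sub>R a + (1/3) *\<^sub>R b + (1/3) *\<^sub>R c"
  have T0: "flat_triangulation ?T0 ?Q" by (rule surface_triangles_flat)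
  have abc: "{a, b, c} \<in> ?T0" and aby: "{a, b, y} \<in> ?T0"
    using corner_triangles unfolding a_def b_def c_def y_def by blast+
  have ne: "a \<noteq> b" "a \<noteq> c" "b \<noteq> c" "y \<noteq> a" "y \<noteq> b" "y \<noteq> c"
    unfolding a_def b_def c_def y_def by (simp_all add: grid_point_eq_iff)
  define T1 where "T1 = ?T0 - {{a, b, c}} \<union> {{a, b, d}, {a, c, d}, {b, c, d}}"
  have d: "d \<notin> \<Union>?T0" and T1: "flat_triangulation T1 ?Q"
    using stellar_subdivision[OF T0 abc] unfolding d_def T1_def by blast+
  have E1: "edges_of ?T0 \<subseteq> edges_of T1"
    unfolding T1_def edges_of_stellar[OF abc ne(1-3) d] by blast
  define U where "U = insert d (\<Union>?T0)"
  have U1: "\<Union>T1 = U" unfolding U_def T1_def using abc by auto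
  have abcyU: "a \<in> \<Union>?T0" "b \<in> \<Union>?T0" "c \<in> \<Union>?T0" "y \<in> \<Union>?T0" using abc aby by blast+
  have dn: "d \<noteq> a" "d \<noteq> b" "d \<noteq> c" "d \<noteq> y" using d abcyU by blast+
  have finU: "finite U" unfolding U_def using flat_triangulationD(4)[OF T0] by simp
  have cardU: "card U = core_size g"
    unfolding U_def core_size_def using d flat_triangulationD(4)[OF T0] by simp
  have SU: "{a, b, c, d} \<subseteq> U" using abcyU unfolding U_def by blast
  have "card {a, b, c, d} = 4" using ne dn by simp
  then have cU4: "4 \<le> card U" using card_mono[OF finU SU] by simp
  \<comment> \<open>The last piece also contains the \<open>card U - 4\<close> core vertices other
    than \<open>a\<close>, \<open>b\<close>, \<open>c\<close>, \<open>d\<close>, so its fan is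
    shorter by that number. As \<open>card U = core_size g\<close> is at most \<open>m\<close>, the
    subtraction is exact and \<open>M3\<close> is positive.\<close>
  define M3 where "M3 = m + 4 - card U"
  have m0: "0 < m" "0 < M3" using m cU4 cardU unfolding M3_def by auto
  have abdT1: "{a, b, d} \<in> T1" "{c, d, a} \<in> T1" "{c, d, b} \<in> T1"
    unfolding T1_def by (auto simp: insert_commute)
  have abyT1: "{a, b, y} \<in> T1"
  proof -
    have "{a, b, y} \<noteq> {a, b, c}" using ne by blast
    then show ?thesis unfolding T1_def using aby by blast
  qed
  \<comment> \<open>The four triangles to be filled are pairwise distinct, so filling one leaves the
    others in place.\<close>
  have n1: "{c, d, a} \<noteq> {a, b, d}" "{c, d, b} \<noteq> {a, b, d}" "{c, d, b} \<noteq> {c, d, a}"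
    "{a, b, y} \<noteq> {a, b, d}" "{a, b, y} \<noteq> {c, d, a}" "{a, b, y} \<noteq> {c, d, b}"
    using ne dn by blast+
  obtain x0 T2 where f0: "flat_triangulation T2 ?Q" "inj_on x0 {..<m}" "x0 ` {..<m} \<inter> \<Union>T1 = {}"
    "\<Union>T2 = \<Union>T1 \<union> x0 ` {..<m}" "edges_of T2 = edges_of T1 \<union> fan_edges a b d x0 m" "T1 - {{a, b, d}} \<subseteq> T2"
    using fan_insertion[OF T1 abdT1(1), of m] by (elim exE conjE) (rule that)
  have T2m: "{c, d, a} \<in> T2" "{c, d, b} \<in> T2" "{a, b, y} \<in> T2"
    using f0(6) abdT1(2,3) abyT1 n1(1,2,4) by blast+
  obtain x1 T3 where f1: "flat_triangulation T3 ?Q" "inj_on x1 {..<m}" "x1 ` {..<m} \<inter> \<Union>T2 = {}"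
    "\<Union>T3 = \<Union>T2 \<union> x1 ` {..<m}" "edges_of T3 = edges_of T2 \<union> fan_edges c d a x1 m" "T2 - {{c, d, a}} \<subseteq> T3"
    using fan_insertion[OF f0(1) T2m(1), of m] by (elim exE conjE) (rule that)
  have T3m: "{c, d, b} \<in> T3" "{a, b, y} \<in> T3" using f1(6) T2m(2,3) n1(3,5) by blast+
  obtain x2 T4 where f2: "flat_triangulation T4 ?Q" "inj_on x2 {..<m}" "x2 ` {..<m} \<inter> \<Union>T3 = {}"
    "\<Union>T4 = \<Union>T3 \<union> x2 ` {..<m}" "edges_of T4 = edges_of T3 \<union> fan_edges c d b x2 m" "T3 - {{c, d, b}} \<subseteq> T4"
    using fan_insertion[OF f1(1) T3m(1), of m] by (elim exE conjE) (rule that)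
  have T4m: "{a, b, y} \<in> T4" using f2(6) T3m(2) n1(6) by blast
  obtain x3 T5 where f3: "flat_triangulation T5 ?Q" "inj_on x3 {..<M3}" "x3 ` {..<M3} \<inter> \<Union>T4 = {}"
    "\<Union>T5 = \<Union>T4 \<union> x3 ` {..<M3}" "edges_of T5 = edges_of T4 \<union> fan_edges a b y x3 M3" "T4 - {{a, b, y}} \<subseteq> T5"
    using fan_insertion[OF f2(1) T4m, of M3] by (elim exE conjE) (rule that)
  let ?E = "edges_of T5" and ?V = "\<Union>T5"
  have E5: "?E = edges_of T1 \<union> fan_edges a b d x0 m \<union> fan_edges c d a x1 m \<union> fan_edges c d b x2 m \<union> fan_edges a b y x3 M3"
    using f3(5) f2(5) f1(5) f0(5) by simp
  have V5: "?V = U \<union> x0 ` {..<m} \<union> x1 ` {..<m} \<union> x2 ` {..<m} \<union> x3 ` {..<M3}"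
    using f3(4) f2(4) f1(4) f0(4) U1 by simp
  define x where "x i = (if i = 0 then x0 else if i = 1 then x1 else if i = 2 then x2 else x3)" for i :: nat
  define M where "M i = (if i < 3 then m else M3)" for i :: nat
  define p where "p i = (if i = 0 \<or> i = 3 then a else c)" for i :: nat
  define q where "q i = (if i = 0 \<or> i = 3 then b else d)" for i :: nat
  define r where "r i = (if i = 0 then d else if i = 1 then a else if i = 2 then b else y)" for i :: nat
  have lt4: "i = 0 \<or> i = 1 \<or> i = 2 \<or> i = 3" if "i < 4" for i :: nat using that by linarith
  have dm: "A \<inter> C = {} \<and> C \<inter> A = {}" if "A \<inter> B = {}" "C \<subseteq> B" for A B C :: "pt set" using that by blast
  have s: "U \<subseteq> \<Union>T1" "\<Union>T1 \<subseteq> \<Union>T2" "\<Union>T2 \<subseteq> \<Union>T3" "\<Union>T3 \<subseteq> \<Union>T4"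
    "x0 ` {..<m} \<subseteq> \<Union>T2" "x1 ` {..<m} \<subseteq> \<Union>T3" "x2 ` {..<m} \<subseteq> \<Union>T4"
    by (simp_all add: U1 f0(4) f1(4) f2(4))
  have s': "U \<subseteq> \<Union>T2" "U \<subseteq> \<Union>T3" "U \<subseteq> \<Union>T4" "x0 ` {..<m} \<subseteq> \<Union>T3" "x0 ` {..<m} \<subseteq> \<Union>T4" "x1 ` {..<m} \<subseteq> \<Union>T4"
    using s by (meson subset_trans)+
  have dU: "x0 ` {..<m} \<inter> U = {}" "x1 ` {..<m} \<inter> U = {}" "x2 ` {..<m} \<inter> U = {}" "x3 ` {..<M3} \<inter> U = {}"
    using dm[OF f0(3) s(1)] dm[OF f1(3) s'(1)] dm[OF f2(3) s'(2)] dm[OF f3(3) s'(3)] by (simp_all only:)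
  have d01: "x0 ` {..<m} \<inter> x1 ` {..<m} = {}" "x0 ` {..<m} \<inter> x2 ` {..<m} = {}" "x1 ` {..<m} \<inter> x2 ` {..<m} = {}"
    "x0 ` {..<m} \<inter> x3 ` {..<M3} = {}" "x1 ` {..<m} \<inter> x3 ` {..<M3} = {}" "x2 ` {..<m} \<inter> x3 ` {..<M3} = {}"
    using dm[OF f1(3) s(5)] dm[OF f2(3) s'(4)] dm[OF f2(3) s(6)] dm[OF f3(3) s'(5)] dm[OF f3(3) s'(6)] dm[OF f3(3) s(7)]
    by (simp_all only:)
  interpret ff: four_fans ?E U a b c d y p q r x M m
  proof (unfold_locales)
    show "finite U" by (rule finU)
    show "{a, b, c, d} \<subseteq> U" by (rule SU)
    show "distinct [a, b, c, d]" using ne dn by simp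
    show "y \<in> U - {a, b, c, d}" using abcyU ne dn unfolding U_def by simp
    show "p 0 = a" "q 0 = b" "p 1 = c" "q 1 = d" "p 2 = c" "q 2 = d" "p 3 = a" "q 3 = b"
      "r 0 = d" "r 1 = a" "r 2 = b" "r 3 = y" unfolding p_def q_def r_def by simp_all
    show "M 0 = m" "M 1 = m" "M 2 = m" unfolding M_def by simp_all
    show "M 3 + card U = m + 4" unfolding M_def M3_def using m cardU by simp
    have disj: "x i ` {..<M i} \<inter> x i' ` {..<M i'} = {}" if "i < i'" "i' < 4" for i i'
    proof -
      have "i < 4" using that by linarith
      from lt4[OF this] lt4[OF that(2)] that(1) show ?thesis
        using d01 by (elim disjE) (simp_all add: x_def M_def)
    qed
    show "i = i' \<and> j = j'" if ij: "i < 4" "i' < 4" "j < M i" "j' < M i'" "x i j = x i' j'" for i i' j j'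
    proof -
      have "i = i'"
      proof (rule ccontr)
        assume "i \<noteq> i'"
        then have "x i ` {..<M i} \<inter> x i' ` {..<M i'} = {}"
          using disj[of i i'] disj[of i' i] ij(1,2) by (cases "i < i'") (auto simp: Int_commute)
        then show False using ij by blast
      qed
      moreover have "inj_on (x i) {..<M i}"
        using lt4[OF ij(1)] f0(2) f1(2) f2(2) f3(2) by (elim disjE) (simp_all add: x_def M_def)
      ultimately show ?thesis using ij by (auto dest: inj_onD)
    qed
    show "x i j \<notin> U" if "i < 4" "j < M i" for i j
    proof -
      have "x i ` {..<M i} \<inter> U = {}"
        using lt4[OF that(1)] dU by (elim disjE) (simp_all add: x_def M_def)
      then show ?thesis using that by blast
    qed
    show "e \<subseteq> U \<or> (\<exists>i<4. e \<in> fan_edges (p i) (q i) (r i) (x i) (M i))" if "e \<in> ?E" for e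
    proof -
      have fan: "fan_edges (p 0) (q 0) (r 0) (x 0) (M 0) = fan_edges a b d x0 m"
        "fan_edges (p 1) (q 1) (r 1) (x 1) (M 1) = fan_edges c d a x1 m"
        "fan_edges (p 2) (q 2) (r 2) (x 2) (M 2) = fan_edges c d b x2 m"
        "fan_edges (p 3) (q 3) (r 3) (x 3) (M 3) = fan_edges a b y x3 M3"
        unfolding p_def q_def r_def x_def M_def by simp_all
      have "e \<in> edges_of T1 \<or> e \<in> fan_edges (p 0) (q 0) (r 0) (x 0) (M 0) \<or>
          e \<in> fan_edges (p 1) (q 1) (r 1) (x 1) (M 1) \<or> e \<in> fan_edges (p 2) (q 2) (r 2) (x 2) (M 2) \<or>
          e \<in> fan_edges (p 3) (q 3) (r 3) (x 3) (M 3)"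
        using that unfolding E5 fan by blast
      moreover have "e \<subseteq> U" if "e \<in> edges_of T1"
        using that U1 by (auto elim!: edges_ofE)
      moreover have "(0::nat) < 4" "(1::nat) < 4" "(2::nat) < 4" "(3::nat) < 4" by simp_all
      ultimately show ?thesis by blast
    qed
  qed
  have VV: "ff.V = ?V"
  proof -
    have "{..<4} = {0, 1, 2, 3::nat}" by auto
    then show ?thesis unfolding ff.V_def V5 by (simp add: x_def M_def Un_assoc)
  qed
  have cV: "card ?V = 4 * m + 4" using ff.card_V(2) unfolding VV .
  have ham: "hamiltonian ?V ?E"
  proof -
    define l0 where "l0 = map x0 [0..<m]"
    define l1 where "l1 = map x1 [0..<m]"
    define l2 where "l2 = map x2 [0..<m]"
    define l3 where "l3 = map x3 [0..<M3]"
    \<comment> \<open>From \<open>b\<close> the snake leads to \<open>y\<close>, the tip of fan 3.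
      Fan 3 is run from its tip to the hub \<open>a\<close>, fan 0 backwards from the hub
      \<open>a\<close> to its tip \<open>d\<close>, fan 1 from the hub \<open>d\<close> to the hub
      \<open>c\<close>, and fan 2 backwards from the hub \<open>c\<close> to its tip
      \<open>b\<close>, which closes the cycle.\<close>
    define L where "L = [b] @ base_path g @ l3 @ [a] @ rev l0 @ [d] @ l1 @ [c] @ rev l2"
    have "fan_edges a b d x0 m \<subseteq> ?E" "fan_edges c d a x1 m \<subseteq> ?E" "fan_edges c d b x2 m \<subseteq> ?E" "fan_edges a b y x3 M3 \<subseteq> ?E"
      unfolding E5 by blast+
    note L0 = fan_list[OF m0(1) this(1) f0(2), folded l0_def] and L1 = fan_list[OF m0(1) this(2) f1(2), folded l1_def]
      and L2 = fan_list[OF m0(1) this(3) f2(2), folded l2_def] and L3 = fan_list[OF m0(2) this(4) f3(2), folded l3_def]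
    have sym: "{v, u} \<in> ?E" if "{u, v} \<in> ?E" for u v using that by (simp add: insert_commute)
    have adj: "{b, grid_point 0 4} \<in> ?E"
    proof -
      have "{grid_point 0 3, grid_point 0 (Suc 3)} \<in> edges_of ?T0" by (rule grid_point_edges(2)) simp_all
      then show ?thesis using E1 unfolding b_def E5 by auto
    qed
    have path: "successively (adjacent ?E) (base_path g)"
      by (rule successively_mono[OF successively_base_path]) (use E1 E5 in blast)
    have UW: "U = set (base_path g) \<union> {a, b, c, d}"
      unfolding U_def set_base_path a_def b_def c_def by blast
    have nW: "a \<notin> set (base_path g)" "b \<notin> set (base_path g)" "c \<notin> set (base_path g)" "d \<notin> set (base_path g)"
      using corner_notin_base_path d unfolding a_def b_def c_def set_base_path by blast+
    have WU: "set (base_path g) \<subseteq> U" using UW by blast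
    have notU: "u \<notin> x0 ` {..<m}" "u \<notin> x1 ` {..<m}" "u \<notin> x2 ` {..<m}" "u \<notin> x3 ` {..<M3}" if "u \<in> U" for u
      using dU that by blast+
    have abcdU: "a \<in> U" "b \<in> U" "c \<in> U" "d \<in> U" using SU by blast+
    have "successively (adjacent ?E) L"
      unfolding L_def
      by (simp add: successively_append_iff successively_Cons path base_path_simps y_def[symmetric] adj hd_rev last_rev
          L0(1-3,6-) L1(1-3,6-) L2(1-3,6-) L3(1-3,6-)
          L0(8-)[THEN sym] L1(8-)[THEN sym] L2(8-)[THEN sym] L3(8-)[THEN sym] del: successively_rev One_nat_def)
    moreover have "{last L, hd L} \<in> ?E"
      unfolding L_def by (simp add: last_rev L2(1-3,12))
    moreover have "distinct L"
    proof -
      have disj: "set (base_path g) \<inter> set l0 = {}" "set (base_path g) \<inter> set l1 = {}"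
        "set (base_path g) \<inter> set l2 = {}" "set (base_path g) \<inter> set l3 = {}"
        "set l3 \<inter> set l0 = {}" "set l3 \<inter> set l1 = {}" "set l3 \<inter> set l2 = {}"
        "set l0 \<inter> set l1 = {}" "set l0 \<inter> set l2 = {}" "set l1 \<inter> set l2 = {}"
        unfolding L0(4) L1(4) L2(4) L3(4)
        using dm[OF dU(1) WU] dm[OF dU(2) WU] dm[OF dU(3) WU] dm[OF dU(4) WU] d01 by (simp_all only: Int_commute)
      have notin: "u \<notin> set l0" "u \<notin> set l1" "u \<notin> set l2" "u \<notin> set l3" if "u \<in> U" for u
        unfolding L0(4) L1(4) L2(4) L3(4) by (rule notU[OF that])+
      show ?thesis
        unfolding L_def
        by (simp add: distinct_base_path L0(5) L1(5) L2(5) L3(5) Int_Un_distrib disj nW ne ne[symmetric] dn dn[symmetric]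
            notin[OF abcdU(1)] notin[OF abcdU(2)] notin[OF abcdU(3)] notin[OF abcdU(4)])
    qed
    moreover have "3 \<le> length L" unfolding L_def by simp
    moreover have "set L = ?V"
      unfolding L_def V5 UW set_append set_rev L0(4) L1(4) L2(4) L3(4) by auto
    ultimately show ?thesis unfolding hamiltonian_def using is_cycleI by blast
  qed
  have EV: "\<forall>e\<in>?E. e \<subseteq> ?V" by (auto elim!: edges_ofE)
  have finV: "finite ?V" using flat_triangulationD(4)[OF f3(1)] .
  have finE: "finite ?E" by (rule finite_subset[of _ "Pow ?V"]) (use EV finV in auto)
  have "card (cycles_of_length ?E k) \<le> cycle_const (core_size g) * (card ?V - k + 1) ^ 5"
    if "k \<le> card ?V" "card ?V < k + m" for k
    using ff.card_long_cycles[of k] that unfolding VV cardU cycle_const_def by simp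
  then show ?thesis
    using EV finV finE flat_triangulation_imp_triangulation[OF f3(1)] ham cV
    by (intro exI[of _ ?V] exI[of _ ?E]) simp
qed

text \<open>So far the vertices are points of 3-space; being finitely many, they can be renamed by
  natural numbers.\<close>

lemma four_fan_triangulation_nat:
  assumes m: "core_size g \<le> m"
  shows "\<exists>(V :: nat set) E. triangulation_of V E (orientable_surface g) \<and>
     hamiltonian V E \<and> card V = 4 * m + 4 \<and>
     (\<forall>k\<le>card V. card V < k + m \<longrightarrow>
        card (cycles_of_length E k) \<le> cycle_const (core_size g) * (card V - k + 1) ^ 5)"
proof -
  obtain V :: "pt set" and E where VE: "finite V" "finite E" "\<forall>e\<in>E. e \<subseteq> V" "triangulation_of V E (orientable_surface g)"
     "hamiltonian V E" "card V = 4 * m + 4"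
     "\<forall>k\<le>card V. card V < k + m \<longrightarrow>
        card (cycles_of_length E k) \<le> cycle_const (core_size g) * (card V - k + 1) ^ 5"
    using four_fan_triangulation[OF m] by (elim exE conjE) (rule that)
  obtain h :: "pt \<Rightarrow> nat" where h: "inj_on h V" using VE(1) finite_imp_inj_to_nat_seg by metis
  have EV: "\<And>e. e \<in> E \<Longrightarrow> e \<subseteq> V" using VE(3) by blast
  have "card (h ` V) = card V" by (rule card_image[OF h])
  then show ?thesis
    using relabel_triangulation[OF h EV VE(4)] relabel_hamiltonian[OF h EV VE(5)]
      order_trans[OF relabel_cycles[OF h EV VE(2)]] VE(6,7)
    by (intro exI[of _ "h ` V"] exI[of _ "(`) h ` E"]) simp
qed

theorem theorem2:
  fixes t :: nat and f :: "nat \<Rightarrow> real"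
  assumes "t \<ge> 4"
    and "t mod 12 \<in> {0, 3, 4, 7}"
    and "\<And>n. f n \<ge> 1"
    and "\<exists>n0. \<forall>n\<ge>n0. f n < real n / real t - 1"
  shows "\<exists>(\<G> :: (nat set \<times> nat set set) set) (C :: real).
           infinite ((\<lambda>(V, E). card V) ` \<G>) \<and> C > 0 \<and>
           (\<forall>(V, E)\<in>\<G>.
              triangulation_of V E
                (orientable_surface (nat \<lceil>(real t - 3) * (real t - 4) / 12\<rceil>)) \<and>
              hamiltonian V E \<and>
              (\<forall>k::nat. \<lceil>real (card V) - f (card V)\<rceil> \<le> int k \<and> k \<le> card V \<longrightarrow>
                 real (card (cycles_of_length E k)) \<le> C * f (card V) ^ (2 * t - 3)))"
proof -
  define g where "g = nat \<lceil>(real t - 3) * (real t - 4) / 12\<rceil>"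
  obtain n0 where n0: "\<And>n. n \<ge> n0 \<Longrightarrow> f n < real n / real t - 1" using assms(4) by blast
  \<comment> \<open>\<open>n0\<close> brings the bound on \<open>f\<close> into force, and
    \<open>core_size g\<close> makes room for the core in the fourth piece.\<close>
  define m0 where "m0 = n0 + core_size g"
  define K where "K = cycle_const (core_size g)"
  have K: "0 < K" unfolding K_def cycle_const_def by simp
  define good where "good m VE \<longleftrightarrow> (case VE of (V, E) \<Rightarrow> triangulation_of V E (orientable_surface g) \<and>
     hamiltonian V E \<and> card V = 4 * m + 4 \<and>
     (\<forall>k\<le>card V. card V < k + m \<longrightarrow> card (cycles_of_length E k) \<le> K * (card V - k + 1) ^ 5))"
    for m and VE :: "nat set \<times> nat set set"
  define \<G> where "\<G> = {VE. \<exists>m\<ge>m0. good m VE}"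
  have ex: "\<exists>VE. good m VE" if "m0 \<le> m" for m
    using four_fan_triangulation_nat[of g m] that unfolding good_def K_def m0_def by auto
  have "(\<lambda>m. 4 * m + 4) ` {m0..} \<subseteq> (\<lambda>(V, E). card V) ` \<G>"
  proof
    fix n assume "n \<in> (\<lambda>m. 4 * m + 4) ` {m0..}"
    then obtain m where m: "m0 \<le> m" "n = 4 * m + 4" by auto
    then obtain V E where VE: "good m (V, E)" using ex[OF m(1)] by auto
    then have "n = card V" "(V, E) \<in> \<G>" unfolding \<G>_def using m by (auto simp: good_def)
    then show "n \<in> (\<lambda>(V, E). card V) ` \<G>" by force
  qed
  moreover have "infinite ((\<lambda>m::nat. 4 * m + 4) ` {m0..})"
    by (subst finite_image_iff) (auto simp: inj_on_def infinite_Ici)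
  ultimately have inf: "infinite ((\<lambda>(V, E). card V) ` \<G>)" using finite_subset by blast
  have bound: "real (card (cycles_of_length E k)) \<le> (32 * real K) * f (card V) ^ (2 * t - 3)"
    if VE: "(V, E) \<in> \<G>" and k: "\<lceil>real (card V) - f (card V)\<rceil> \<le> int k" "k \<le> card V" for V E k
  proof -
    obtain m where m: "m0 \<le> m" "good m (V, E)" using VE unfolding \<G>_def by blast
    have cV: "card V = 4 * m + 4" using m(2) unfolding good_def by simp
    have f1: "1 \<le> f (card V)" by (rule assms(3))
    have "n0 \<le> card V" using m(1) cV unfolding m0_def by linarith
    then have "f (card V) < real (card V) / real t - 1" by (rule n0)
    \<comment> \<open>With \<open>card V = 4 * m + 4\<close> the right-hand side is exactly
      \<open>m\<close>, so a cycle of admissible length misses fewer than \<open>m\<close>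
      vertices.\<close>
    also have "\<dots> \<le> real (card V) / 4 - 1" using assms(1) by (intro diff_right_mono divide_left_mono) auto
    finally have fm: "f (card V) < real m" unfolding cV by (simp add: add_divide_distrib)
    have diff: "real (card V) - real k \<le> f (card V)" using k(1) by linarith
    have "card V < k + m" using diff fm by linarith
    moreover have "\<forall>k\<le>card V. card V < k + m \<longrightarrow> card (cycles_of_length E k) \<le> K * (card V - k + 1) ^ 5"
      using m(2) unfolding good_def prod.case by (elim conjE)
    ultimately have "card (cycles_of_length E k) \<le> K * (card V - k + 1) ^ 5"
      using k(2) by blast
    then have "real (card (cycles_of_length E k)) \<le> real (K * (card V - k + 1) ^ 5)" by (rule of_nat_mono)
    also have "\<dots> = real K * (real (card V) - real k + 1) ^ 5" using k(2) by (simp add: of_nat_diff add.commute)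
    \<comment> \<open>At most \<open>f (card V)\<close> vertices are missed, and this value is at
      least 1, so adding 1 at most doubles it. The factor 32 is the fifth power of 2.\<close>
    also have "\<dots> \<le> real K * (2 * f (card V)) ^ 5"
      using diff f1 k(2) by (intro mult_left_mono power_mono) auto
    also have "\<dots> = (32 * real K) * f (card V) ^ 5" by (simp add: power_mult_distrib)
    also have "\<dots> \<le> (32 * real K) * f (card V) ^ (2 * t - 3)"
      using f1 assms(1) by (intro mult_left_mono power_increasing) auto
    finally show ?thesis .
  qed
  show ?thesis
    unfolding g_def[symmetric]
    by (rule exI[of _ \<G>], rule exI[of _ "32 * real K"])
      (use inf K bound in \<open>auto simp: \<G>_def good_def\<close>)
qed

end
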